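(* Let $q:\mathbb{R}\to\mathbb{R}$ be $C^\infty$, let $(X_t)_{t\ge0}$ be the process satisfying $$dX_t=\sqrt2\,dB_t-q'(X_t)\,dt,$$ where $B$ is a standard Brownian motion, let $(P_t)_{t\ge0}$ be its semigroup and let $\pi(du)=e^{-q(u)}du/\mathcal{Z}$, where $\mathcal{Z}$ is the normalizing constant. Assume that $$\lim_{|x|\to+\infty}q''(x)=+\infty.$$ Then there exists $\lambda>0$ such that $$\forall x,y\in\mathbb{R},\ \exists C_{x,y}>0,\ \forall t\ge0,\quad \mathcal{W}(\delta_xP_t,\delta_yP_t)\le C_{x,y}\,e^{-\lambda t}.$$ Furthermore, for all $x\in\mathbb{R}$ there exists $C_x$ such that $$\forall t\ge0,\quad \mathcal{W}(\pi,\delta_xP_t)\le C_x\,e^{-\lambda t}.$$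
   Context: $\delta_xP_t$ denotes the law of $X_t$ when $X_0=x$. For probability measures $\mu_1,\mu_2$ on $\mathbb{R}$, $\mathcal{W}(\mu_1,\mu_2)=\inf_\nu\iint|x-y|\,\nu(dx,dy)$, the infimum being over all probability measures $\nu$ on $\mathbb{R}^2$ with marginals $\mu_1$ and $\mu_2$. *)

theory Defs
  imports "HOL-Probability.Probability"
begin

definition smooth :: "(real \<Rightarrow> real) \<Rightarrow> bool" where
  "smooth f \<longleftrightarrow> (\<forall>n x. (deriv ^^ n) f field_differentiable (at x))"

text \<open>
  Processes are indexed by real times, but only times \<open>t \<ge> 0\<close> are constrained.  Any filtration
  indexed by \<open>[0, \<infinity>)\<close> extends to one indexed by all reals, by the constant value \<open>F 0\<close> at
  negative times.
\<close>

locale standard_brownian_motion =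
  prob_space M + filtration "space M" F
  for M :: "'a measure" and F :: "real \<Rightarrow> 'a measure" +
  fixes B :: "real \<Rightarrow> 'a \<Rightarrow> real"
  assumes subalgebra_F: "\<And>t. 0 \<le> t \<Longrightarrow> sets (F t) \<subseteq> sets M"
    and adapted_B: "\<And>t. 0 \<le> t \<Longrightarrow> B t \<in> borel_measurable (F t)"
    and B_0: "AE \<omega> in M. B 0 \<omega> = 0"
    and continuous_B: "AE \<omega> in M. continuous_on {0..} (\<lambda>t. B t \<omega>)"
    and normal_increments: "\<And>s t. 0 \<le> s \<Longrightarrow> s < t \<Longrightarrow>
      distributed M lborel (\<lambda>\<omega>. B t \<omega> - B s \<omega>) (normal_density 0 (sqrt (t - s)))"
    and indep_increments: "\<And>s t. 0 \<le> s \<Longrightarrow> s < t \<Longrightarrow>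
      indep_set (sets (F s)) (sets (vimage_algebra (space M) (\<lambda>\<omega>. B t \<omega> - B s \<omega>) borel))"

text \<open>
  A solution of \<open>dX\<^sub>t = \<sqrt>2 dB\<^sub>t - q'(X\<^sub>t) dt\<close> with \<open>X\<^sub>0 = x\<close>, in integral form.  The diffusion
  coefficient is constant, so its stochastic integral over \<open>[0, t]\<close> is \<open>\<sqrt>2 B\<^sub>t\<close> (as \<open>B\<^sub>0 = 0\<close>);
  the drift integral is a pathwise integral of a continuous function.
\<close>

locale langevin_solution =
  standard_brownian_motion M F B
  for M :: "'a measure" and F :: "real \<Rightarrow> 'a measure" and B :: "real \<Rightarrow> 'a \<Rightarrow> real" +
  fixes q :: "real \<Rightarrow> real" and x :: real and X :: "real \<Rightarrow> 'a \<Rightarrow> real"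
  assumes adapted_X: "\<And>t. 0 \<le> t \<Longrightarrow> X t \<in> borel_measurable (F t)"
    and continuous_X: "AE \<omega> in M. continuous_on {0..} (\<lambda>t. X t \<omega>)"
    and X_0: "AE \<omega> in M. X 0 \<omega> = x"
    and X_sde: "AE \<omega> in M. \<forall>t\<ge>0.
      X t \<omega> = X 0 \<omega> + sqrt 2 * B t \<omega> - integral {0..t} (\<lambda>s. deriv q (X s \<omega>))"

definition gibbs_measure :: "(real \<Rightarrow> real) \<Rightarrow> real measure" where
  "gibbs_measure q = density lborel (\<lambda>u. ennreal (exp (- q u) / (LINT v|lborel. exp (- q v))))"

definition couplings :: "real measure \<Rightarrow> real measure \<Rightarrow> (real \<times> real) measure set" where
  "couplings \<mu>\<^sub>1 \<mu>\<^sub>2 =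
    {\<nu>. prob_space \<nu> \<and> sets \<nu> = sets borel \<and> distr \<nu> borel fst = \<mu>\<^sub>1 \<and> distr \<nu> borel snd = \<mu>\<^sub>2}"

definition wasserstein :: "real measure \<Rightarrow> real measure \<Rightarrow> ennreal" where
  "wasserstein \<mu>\<^sub>1 \<mu>\<^sub>2 = (INF \<nu>\<in>couplings \<mu>\<^sub>1 \<mu>\<^sub>2. \<integral>\<^sup>+ z. ennreal \<bar>fst z - snd z\<bar> \<partial>\<nu>)"

end

theory Submission
  imports Defs "HOL-Real_Asymp.Real_Asymp"
begin

text \<open>
  Write \<open>L f = f'' - q' f'\<close> for the generator, \<open>\<pi>\<close> for the Gibbs measure and \<open>P\<^sub>t\<close> for the
  semigroup.  Everything rests on one increasing function \<open>G\<close> (\<open>ex_contracting_function\<close>): its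
  derivative lies between \<open>1\<close> and a constant, so increments of \<open>G\<close> are comparable to distances, and
  \<open>h = - L G\<close> satisfies \<open>l (G y - G x) \<le> h y - h x\<close> for \<open>x \<le> y\<close>.  When \<open>q\<close> is uniformly convex the
  identity has this property, because then \<open>h = q'\<close>.  In general \<open>q''\<close> may be negative on a compact set,
  and \<open>G = id - A \<phi>\<close> with \<open>\<phi>\<close> solving the Poisson equation \<open>L \<phi> = arctan - \<pi>(arctan)\<close> repairs
  this: \<open>h = q' + A (arctan - \<pi>(arctan))\<close> has derivative at least \<open>1\<close> once \<open>A\<close> is large, and \<open>\<phi>\<close> is
  decreasing with bounded derivative because \<open>arctan\<close> is increasing and bounded.

  Let \<open>x \<le> y\<close>.  The law of the process started at \<open>x\<close> is stochastically below the law started at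
  \<open>y\<close>.  Hence \<open>u t = P\<^sub>t G y - P\<^sub>t G x\<close> is nonnegative, and Dynkin's formula gives
  \<open>u' = - (P\<^sub>t h y - P\<^sub>t h x) \<le> - l u\<close>, so \<open>u\<close> decays exponentially.  On the line the
  Wasserstein distance of ordered laws is the difference of their means, which \<open>u\<close> dominates
  (\<open>cdf_contraction\<close>).

  The stochastic order and the Markov property are read off from the implicit Euler scheme.  Its
  one-step map is increasing and Lipschitz however fast \<open>q'\<close> grows, and along almost every path it
  converges to the solution (\<open>implicit_scheme_tendsto\<close>).  Its expectations are iterates of an
  explicit kernel, so \<open>P\<^sub>t f\<close> is a limit of iterated kernels that does not depend on the probability
  space carrying the solution; monotonicity, Lipschitz continuity and \<open>P\<^sub>s P\<^sub>t = P\<^sub>s\<^sub>+\<^sub>t\<close> follow.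

  Dynkin's formula is obtained without stochastic integrals (\<open>Dynkin_martingale\<close>).  Along a grid, the
  increments of \<open>f\<close> are compared with those of its Gaussian smoothing.  The differences form a
  martingale sum that is bounded in \<open>L\<^sup>2\<close> and converges path by path, hence its limit is centred.
  Applied to \<open>sqrt (1 + x\<^sup>2)\<close> the formula supplies all the moments needed for unbounded \<open>L f\<close>.

  Finally, solving \<open>L \<phi> = g - \<pi>(g)\<close> and inserting \<open>\<phi>\<close> in Dynkin's formula shows that time averages
  of \<open>P\<^sub>s g\<close> converge to \<open>\<pi>(g)\<close>.  Together with the Markov property this gives \<open>\<pi> P\<^sub>t = \<pi>\<close>
  (\<open>gibbs_invariant\<close>).  The distribution function of \<open>\<pi>\<close> is therefore the \<open>\<pi>\<close>-average of those of
  the laws at time \<open>t\<close>, and averaging the contraction estimate over the starting point yields the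
  second claim.
\<close>


section \<open>Confining potentials\<close>

lemma mono_of_DERIV:
  fixes f f' :: "real \<Rightarrow> real"
  assumes "\<And>u. a \<le> u \<Longrightarrow> u \<le> b \<Longrightarrow> (f has_real_derivative f' u) (at u)"
    and "\<And>u. a \<le> u \<Longrightarrow> u \<le> b \<Longrightarrow> 0 \<le> f' u" and "a \<le> b"
  shows "f a \<le> f b"
  using assms by (intro DERIV_nonneg_imp_nondecreasing[of a b f]) auto

text \<open>
  Since \<open>p'\<close> is smallest at the left end of the tail, the left-hand side is at most the integral of
  \<open>p' exp (- p)\<close>, which is explicit.  It is stated for a general \<open>p\<close> so that it covers both tails, the
  left one by reflection.
\<close>

lemma mills_ratio:
  fixes p p' :: "real \<Rightarrow> real"
  assumes d: "\<And>u. (p has_real_derivative p' u) (at u)"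
    and p'_ge: "\<And>u. x \<le> u \<Longrightarrow> p' x \<le> p' u" and pos: "0 \<le> p' x"
    and int: "integrable lborel (\<lambda>u. exp (- p u))"
    and lim: "((\<lambda>u. exp (- p u)) \<longlongrightarrow> 0) at_top"
    and [measurable]: "p' \<in> borel_measurable borel"
  shows "p' x * (LINT u|lborel. indicator {x..} u * exp (- p u)) \<le> exp (- p x)"
proof -
  have "continuous_on UNIV p"
    by (meson d DERIV_isCont continuous_at_imp_continuous_on)
  then have [measurable]: "p \<in> borel_measurable borel" by (rule borel_measurable_continuous_onI)
  have lim': "((\<lambda>u. - exp (- p u)) \<longlongrightarrow> 0) at_top"
    using tendsto_minus[OF lim] by simp
  have "ennreal (p' x * (LINT u|lborel. indicator {x..} u * exp (- p u)))
      = ennreal (LINT u|lborel. p' x * (indicator {x..} u * exp (- p u)))" by simp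
  also have "\<dots> = (\<integral>\<^sup>+u. ennreal (p' x * (indicator {x..} u * exp (- p u))) \<partial>lborel)"
  proof (subst nn_integral_eq_integral)
    have "integrable lborel (\<lambda>u. indicator {x..} u * exp (- p u))"
      using integrable_mult_indicator[OF _ int, of "{x..}"] by simp
    then show "integrable lborel (\<lambda>u. p' x * (indicator {x..} u * exp (- p u)))" by simp
  qed (use pos in auto)
  also have "\<dots> \<le> (\<integral>\<^sup>+u. ennreal (p' u * exp (- p u)) * indicator {x..} u \<partial>lborel)"
    using p'_ge by (intro nn_integral_mono) (auto simp: indicator_def intro!: ennreal_leI mult_right_mono)
  also have "\<dots> = ennreal (0 - (- exp (- p x)))"
    by (rule nn_integral_FTC_atLeast[OF _ _ _ lim'])
       (use order.trans[OF pos p'_ge] in \<open>auto intro!: derivative_eq_intros d\<close>)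
  finally show ?thesis by (simp add: ennreal_le_iff)
qed

locale confining_potential =
  fixes q :: "real \<Rightarrow> real"
  assumes smooth_q: "smooth q"
    and curvature_at_infinity: "filterlim (deriv (deriv q)) at_top at_infinity"
begin

abbreviation q1 :: "real \<Rightarrow> real" where "q1 \<equiv> deriv q"
abbreviation q2 :: "real \<Rightarrow> real" where "q2 \<equiv> deriv (deriv q)"

lemma DERIV_q: "(q has_real_derivative q1 x) (at x)"
  using smooth_q[unfolded smooth_def, rule_format, of 0 x]
  by (simp add: DERIV_deriv_iff_field_differentiable)

lemma DERIV_q1: "(q1 has_real_derivative q2 x) (at x)"
  using smooth_q[unfolded smooth_def, rule_format, of 1 x]
  by (simp add: DERIV_deriv_iff_field_differentiable)

lemma continuous_on_q: "continuous_on A q"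
  by (meson DERIV_q DERIV_isCont continuous_at_imp_continuous_on)

lemma continuous_on_q1: "continuous_on A q1"
  by (meson DERIV_q1 DERIV_isCont continuous_at_imp_continuous_on)

lemma continuous_on_q2: "continuous_on A q2"
proof -
  have "(q2 has_real_derivative deriv q2 x) (at x)" for x
    using smooth_q[unfolded smooth_def, rule_format, of 2 x]
    by (simp add: DERIV_deriv_iff_field_differentiable numeral_2_eq_2)
  then show ?thesis by (meson DERIV_isCont continuous_at_imp_continuous_on)
qed

lemma measurable_q [measurable]: "q \<in> borel_measurable borel"
  and measurable_q1 [measurable]: "q1 \<in> borel_measurable borel"
  by (auto intro!: borel_measurable_continuous_onI continuous_on_q continuous_on_q1)

lemma q2_ge_outside: "\<exists>R. \<forall>x. R \<le> \<bar>x\<bar> \<longrightarrow> c \<le> q2 x"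
  using curvature_at_infinity
  by (force simp: filterlim_at_top eventually_at_infinity)

lemma ex_curvature_bound: "\<exists>K>0. \<forall>x. - K \<le> q2 x"
proof -
  obtain R where R: "\<And>x. R \<le> \<bar>x\<bar> \<Longrightarrow> 0 \<le> q2 x" using q2_ge_outside by blast
  have "bounded (q2 ` {-\<bar>R\<bar>..\<bar>R\<bar>})"
    by (intro compact_imp_bounded compact_continuous_image continuous_on_q2) auto
  then obtain b where "\<forall>y\<in>q2 ` {-\<bar>R\<bar>..\<bar>R\<bar>}. norm y \<le> b" unfolding bounded_iff by blast
  then have b: "\<And>x. x \<in> {-\<bar>R\<bar>..\<bar>R\<bar>} \<Longrightarrow> \<bar>q2 x\<bar> \<le> b" by simp
  have "- (\<bar>b\<bar> + 1) \<le> q2 x" for x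
  proof (cases "R \<le> \<bar>x\<bar>")
    case True
    then show ?thesis using R[of x] by linarith
  next
    case False
    then have "x \<in> {-\<bar>R\<bar>..\<bar>R\<bar>}" by auto
    from b[OF this] show ?thesis by linarith
  qed
  then show ?thesis by (intro exI[of _ "\<bar>b\<bar> + 1"]) auto
qed

text \<open>
  A bound on how fast two paths driven by the same noise can separate.
\<close>

definition K :: real where "K = (SOME K. 0 < K \<and> (\<forall>x. - K \<le> q2 x))"

lemma K_pos: "0 < K" and q2_ge: "- K \<le> q2 x"
  using someI_ex[OF ex_curvature_bound] unfolding K_def by auto

lemma q1_one_sided_Lipschitz: "x \<le> y \<Longrightarrow> - K * (y - x) \<le> q1 y - q1 x"
proof -
  assume le: "x \<le> y"
  have "(\<lambda>u. q1 u + K * u) x \<le> (\<lambda>u. q1 u + K * u) y"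
  proof (rule mono_of_DERIV[where f = "\<lambda>u. q1 u + K * u" and f' = "\<lambda>u. q2 u + K", OF _ _ le])
    show "0 \<le> q2 u + K" for u using q2_ge[of u] by linarith
  qed (auto intro!: derivative_eq_intros DERIV_q1)
  then show ?thesis by (simp add: algebra_simps)
qed

lemma ex_convexity_radius:
  "\<exists>R\<ge>1. (\<forall>x\<ge>R. x \<le> q1 x) \<and> (\<forall>x\<le>-R. q1 x \<le> x) \<and> (\<forall>x. R \<le> \<bar>x\<bar> \<longrightarrow> 1 \<le> q2 x)"
proof -
  obtain r where r: "\<And>x. r \<le> \<bar>x\<bar> \<Longrightarrow> 2 \<le> q2 x" using q2_ge_outside by blast
  define s where "s = \<bar>r\<bar> + 1"
  define R where "R = 2 * s + \<bar>q1 s\<bar> + \<bar>q1 (- s)\<bar>"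
  have s: "s \<ge> 1" "r \<le> s" by (auto simp: s_def)
  have R: "R \<ge> 1" "R \<ge> r" "R \<ge> s" "q1 s \<ge> 2 * s - R" "q1 (-s) \<le> R - 2 * s" using s by (auto simp: R_def)
  have "x \<le> q1 x" if "x \<ge> R" for x
  proof -
    have "q1 s - 2 * s \<le> q1 x - 2 * x"
      by (rule mono_of_DERIV[where f' = "\<lambda>u. q2 u - 2"])
         (use that s R r in \<open>auto intro!: derivative_eq_intros DERIV_q1\<close>)
    then show ?thesis using that R s by linarith
  qed
  moreover have "q1 x \<le> x" if "x \<le> - R" for x
  proof -
    have "q1 x - 2 * x \<le> q1 (-s) - 2 * (-s)"
      by (rule mono_of_DERIV[where f' = "\<lambda>u. q2 u - 2"])
         (use that s R r in \<open>auto intro!: derivative_eq_intros DERIV_q1\<close>)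
    then show ?thesis using that R s by linarith
  qed
  moreover have "1 \<le> q2 x" if "R \<le> \<bar>x\<bar>" for x using r[of x] that R by linarith
  ultimately show ?thesis using R by blast
qed

text \<open>
  Outside \<open>[-R, R]\<close> the potential is strongly convex and the drift points inwards at least linearly.
\<close>

definition R :: real where
  "R = (SOME R. R\<ge>1 \<and> (\<forall>x\<ge>R. x \<le> q1 x) \<and> (\<forall>x\<le>-R. q1 x \<le> x) \<and> (\<forall>x. R \<le> \<bar>x\<bar> \<longrightarrow> 1 \<le> q2 x))"

lemma R_ge: "1 \<le> R"
  and q1_right: "R \<le> x \<Longrightarrow> x \<le> q1 x"
  and q1_left: "x \<le> - R \<Longrightarrow> q1 x \<le> x"
  and q2_outside: "R \<le> \<bar>x\<bar> \<Longrightarrow> 1 \<le> q2 x"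
  using someI_ex[OF ex_convexity_radius] unfolding R_def[symmetric] by auto

lemma bounded_on_core:
  fixes f :: "real \<Rightarrow> real"
  assumes "continuous_on UNIV f"
  obtains b where "0 \<le> b" "\<And>x. \<bar>x\<bar> \<le> R \<Longrightarrow> \<bar>f x\<bar> \<le> b"
proof -
  have "bounded (f ` {-R..R})"
    using assms by (intro compact_imp_bounded compact_continuous_image) (auto intro: continuous_on_subset)
  then obtain b where "\<forall>y\<in>f ` {-R..R}. norm y \<le> b" unfolding bounded_iff by blast
  then have b: "\<And>x. x \<in> {-R..R} \<Longrightarrow> \<bar>f x\<bar> \<le> b" by simp
  show thesis by (rule that[of "\<bar>b\<bar>"]) (use order.trans[OF b abs_ge_self] in \<open>auto simp: abs_le_iff\<close>)
qed

section \<open>The Gibbs weight\<close>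

lemma q_quadratic_growth: "\<exists>c. \<forall>x. x\<^sup>2 / 2 - c \<le> q x"
proof -
  obtain b where b: "0 \<le> b" "\<And>x. \<bar>x\<bar> \<le> R \<Longrightarrow> \<bar>q x\<bar> \<le> b"
    using bounded_on_core[OF continuous_on_q] by blast
  have "x\<^sup>2 / 2 - (b + R\<^sup>2 / 2) \<le> q x" for x
  proof (cases "\<bar>x\<bar> \<le> R")
    case True
    then have "x\<^sup>2 \<le> R\<^sup>2" using R_ge by (auto intro: abs_le_square_iff[THEN iffD1])
    then show ?thesis using b(2)[OF True] by (auto simp: abs_le_iff)
  next
    case False
    then consider "x \<ge> R" | "x \<le> - R" by linarith
    then show ?thesis
    proof cases
      case 1
      have "q R - R\<^sup>2 / 2 \<le> q x - x\<^sup>2 / 2"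
        by (rule mono_of_DERIV[where f' = "\<lambda>u. q1 u - u"])
           (use 1 in \<open>auto intro!: derivative_eq_intros DERIV_q q1_right\<close>)
      then show ?thesis using b(2)[of R] R_ge by (auto simp: abs_le_iff)
    next
      case 2
      have "- (q x - x\<^sup>2 / 2) \<le> - (q (-R) - (-R)\<^sup>2 / 2)"
        by (rule mono_of_DERIV[where f' = "\<lambda>u. u - q1 u"])
           (use 2 in \<open>auto intro!: derivative_eq_intros DERIV_q q1_left\<close>)
      then show ?thesis using b(2)[of "-R"] R_ge by (auto simp: abs_le_iff)
    qed
  qed
  then show ?thesis by blast
qed

lemma integrable_weight_moment: "integrable lborel (\<lambda>x. \<bar>x\<bar> ^ k * exp (- q x))"
proof -
  obtain c where c: "\<And>x. x\<^sup>2 / 2 - c \<le> q x" using q_quadratic_growth by blast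
  show ?thesis
  proof (rule Bochner_Integration.integrable_bound)
    show "integrable lborel (\<lambda>x. (sqrt (2 * pi) * exp c) * (std_normal_density x * \<bar>x\<bar> ^ k))"
      by (intro integrable_mult_right integrable_std_normal_moment_abs)
    have "\<bar>x\<bar> ^ k * exp (- q x) \<le> (sqrt (2 * pi) * exp c) * (std_normal_density x * \<bar>x\<bar> ^ k)" for x
    proof -
      have "exp (- q x) \<le> exp (c - x\<^sup>2 / 2)" using c[of x] by simp
      also have "\<dots> = (sqrt (2 * pi) * exp c) * std_normal_density x"
        by (simp add: std_normal_density_def field_simps flip: exp_add)
      finally have "\<bar>x\<bar> ^ k * exp (- q x) \<le> \<bar>x\<bar> ^ k * ((sqrt (2 * pi) * exp c) * std_normal_density x)"
        by (rule mult_left_mono) simp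
      then show ?thesis by (simp only: ac_simps)
    qed
    then show "AE x in lborel. norm (\<bar>x\<bar> ^ k * exp (- q x))
        \<le> norm ((sqrt (2 * pi) * exp c) * (std_normal_density x * \<bar>x\<bar> ^ k))"
      by (intro always_eventually allI) (force simp: abs_mult)
  qed simp
qed

lemma integrable_weight: "integrable lborel (\<lambda>x. exp (- q x))"
  using integrable_weight_moment[of 0] by simp

definition Z :: real where "Z = (LINT x|lborel. exp (- q x))"

lemma Z_pos: "0 < Z"
proof -
  have "Z \<noteq> 0"
  proof
    assume "Z = 0"
    then have "AE x in lborel. exp (- q x) = 0"
      unfolding Z_def using integrable_weight
      by (subst (asm) integral_nonneg_eq_0_iff_AE) auto
    then have "(UNIV :: real set) \<in> null_sets lborel" by (subst (asm) AE_iff_null) auto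
    then show False by (auto simp: null_sets_def)
  qed
  moreover have "0 \<le> Z" unfolding Z_def by simp
  ultimately show ?thesis by linarith
qed

lemma gibbs_measure_eq: "gibbs_measure q = density lborel (\<lambda>u. ennreal (exp (- q u) / Z))"
  by (simp add: gibbs_measure_def Z_def)

lemma sets_gibbs [measurable_cong]: "sets (gibbs_measure q) = sets borel"
  by (simp add: gibbs_measure_def)

lemma prob_space_gibbs: "prob_space (gibbs_measure q)"
proof
  have "emeasure (gibbs_measure q) (space (gibbs_measure q)) = (\<integral>\<^sup>+u. ennreal (exp (- q u) / Z) \<partial>lborel)"
    by (simp add: gibbs_measure_eq emeasure_density)
  also have "\<dots> = ennreal (LINT u|lborel. exp (- q u) / Z)"
    using Z_pos integrable_weight by (intro nn_integral_eq_integral) auto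
  also have "\<dots> = 1" using Z_pos by (simp add: Z_def[symmetric])
  finally show "emeasure (gibbs_measure q) (space (gibbs_measure q)) = 1" .
qed

lemma integral_gibbs:
  assumes [measurable]: "f \<in> borel_measurable borel"
  shows "(LINT u|gibbs_measure q. f u) = (LINT u|lborel. f u * exp (- q u)) / Z"
  unfolding gibbs_measure_eq using Z_pos
  by (subst integral_density) (auto simp: field_simps)

lemma integrable_gibbs_iff:
  assumes [measurable]: "f \<in> borel_measurable borel"
  shows "integrable (gibbs_measure q) f \<longleftrightarrow> integrable lborel (\<lambda>u. f u * exp (- q u))"
proof -
  have "integrable (gibbs_measure q) f \<longleftrightarrow> integrable lborel (\<lambda>u. (1 / Z) * (f u * exp (- q u)))"
    unfolding gibbs_measure_eq using Z_pos
    by (subst integrable_density) (auto simp: field_simps)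
  also have "\<dots> \<longleftrightarrow> integrable lborel (\<lambda>u. f u * exp (- q u))"
    proof
    assume "integrable lborel (\<lambda>u. (1 / Z) * (f u * exp (- q u)))"
    from integrable_mult_right[OF this, of Z] show "integrable lborel (\<lambda>u. f u * exp (- q u))"
      using Z_pos by simp
  qed simp
  finally show ?thesis .
qed

lemma integrable_gibbs_abs: "integrable (gibbs_measure q) (\<lambda>x. \<bar>x\<bar>)"
  using integrable_weight_moment[of 1] by (subst integrable_gibbs_iff) auto

section \<open>The Poisson equation\<close>

lemma exp_minus_q_le: "\<exists>c. \<forall>x. exp (- q x) \<le> exp (c - \<bar>x\<bar>)"
proof -
  obtain c where c: "\<And>x. x\<^sup>2 / 2 - c \<le> q x" using q_quadratic_growth by blast
  have le: "\<bar>x\<bar> \<le> x\<^sup>2 / 2 + 1 / 2" for x :: real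
    using zero_le_power2[of "\<bar>x\<bar> - 1"] by (simp add: power2_diff)
  have "exp (- q x) \<le> exp ((c + 1 / 2) - \<bar>x\<bar>)" for x
  proof -
    have "- q x \<le> (c + 1 / 2) - \<bar>x\<bar>" using c[of x] le[of x] by linarith
    then show ?thesis by simp
  qed
  then show ?thesis by blast
qed

lemma weight_tendsto_0: "((\<lambda>x. exp (- q x)) \<longlongrightarrow> 0) at_top" "((\<lambda>x. exp (- q (- x))) \<longlongrightarrow> 0) at_top"
proof -
  obtain c where c: "\<And>x. exp (- q x) \<le> exp (c - \<bar>x\<bar>)" using exp_minus_q_le by blast
  have lim: "((\<lambda>u::real. exp (c - \<bar>u\<bar>)) \<longlongrightarrow> 0) at_top" by real_asymp
  show "((\<lambda>x. exp (- q x)) \<longlongrightarrow> 0) at_top" "((\<lambda>x. exp (- q (- x))) \<longlongrightarrow> 0) at_top"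
    using c[of "- x" for x]
    by (auto intro!: tendsto_sandwich[OF _ _ tendsto_const lim] always_eventually c)
qed

lemma q1_pos_right: "R \<le> x \<Longrightarrow> 1 \<le> q1 x" and q1_neg_left: "x \<le> - R \<Longrightarrow> q1 x \<le> - 1"
  using q1_right[of x] q1_left[of x] R_ge by linarith+

lemma weight_tail_right:
  assumes "R \<le> x"
  shows "q1 x * (LINT u|lborel. indicator {x..} u * exp (- q u)) \<le> exp (- q x)"
proof (rule mills_ratio)
  show "q1 x \<le> q1 u" if "x \<le> u" for u
    by (rule mono_of_DERIV[OF DERIV_q1 _ that])
       (use assms R_ge q2_outside in \<open>force intro: order.trans[OF zero_le_one]\<close>)
qed (use q1_pos_right[OF assms] in \<open>auto intro!: DERIV_q integrable_weight weight_tendsto_0\<close>)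

lemma weight_tail_left:
  assumes "x \<le> - R"
  shows "- q1 x * (LINT u|lborel. indicator {..x} u * exp (- q u)) \<le> exp (- q x)"
proof -
  have "(- q1 (- (- x))) * (LINT u|lborel. indicator {- x..} u * exp (- q (- u))) \<le> exp (- q (- (- x)))"
  proof (rule mills_ratio[where p = "\<lambda>u. q (- u)" and p' = "\<lambda>u. - q1 (- u)"])
    show "- q1 (- (- x)) \<le> - q1 (- u)" if "- x \<le> u" for u
    proof -
      have "q1 (- u) \<le> q1 x"
      proof (rule mono_of_DERIV[OF DERIV_q1])
        show "0 \<le> q2 v" if "- u \<le> v" "v \<le> x" for v
          using q2_outside[of v] that assms R_ge by auto
      qed (use that in auto)
      then show ?thesis by simp
    qed
    show "((\<lambda>u. q (- u)) has_real_derivative - q1 (- u)) (at u)" for u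
      using DERIV_mirror[of q "q1 (- u)" u] DERIV_q[of "- u"] by simp
    show "integrable lborel (\<lambda>u. exp (- q (- u)))"
      using lborel_integrable_real_affine_iff[of "-1" "\<lambda>u. exp (- q u)" 0] integrable_weight by simp
  qed (use q1_neg_left[OF assms] in \<open>auto intro!: weight_tendsto_0\<close>)
  also have "(LINT u|lborel. indicator {- x..} u * exp (- q (- u))) = (LINT u|lborel. indicator {..x} u * exp (- q u))"
    by (subst lborel_integral_real_affine[of "-1" _ 0])
       (auto intro!: Bochner_Integration.integral_cong simp: indicator_def)
  finally show ?thesis by simp
qed

abbreviation weighted :: "(real \<Rightarrow> real) \<Rightarrow> real set \<Rightarrow> real" where
  "weighted r A \<equiv> LINT u|lborel. indicator A u * (r u * exp (- q u))"

text \<open>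
  With \<open>\<phi>' = \<psi>\<close>, the equation \<open>\<phi>'' - q' \<phi>' = r\<close> reads \<open>(exp (- q) \<psi>)' = r exp (- q)\<close>; this is the
  solution that vanishes at \<open>- \<infinity>\<close> after multiplication by the weight.
\<close>

definition poisson_grad :: "(real \<Rightarrow> real) \<Rightarrow> real \<Rightarrow> real" where
  "poisson_grad r x = exp (q x) * weighted r {..x}"

context
  fixes r :: "real \<Rightarrow> real" and c :: real
  assumes continuous_r: "continuous_on UNIV r"
    and bounded_r: "\<And>x. \<bar>r x\<bar> \<le> c"
    and centred_r: "(LINT u|lborel. r u * exp (- q u)) = 0"
begin

lemma measurable_r: "r \<in> borel_measurable borel"
  by (rule borel_measurable_continuous_onI[OF continuous_r])

lemma integrable_r: "A \<in> sets borel \<Longrightarrow> integrable lborel (\<lambda>u. indicator A u * (r u * exp (- q u)))"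
proof -
  assume A: "A \<in> sets borel"
  note [measurable] = measurable_r
  have "integrable lborel (\<lambda>u. r u * exp (- q u))"
    by (rule Bochner_Integration.integrable_bound[where f="\<lambda>u. c * exp (- q u)"])
       (use integrable_weight order.trans[OF bounded_r abs_ge_self] in
         \<open>auto simp: abs_mult intro!: AE_I2 mult_right_mono\<close>)
  then show ?thesis using integrable_mult_indicator[of A lborel "\<lambda>u. r u * exp (- q u)"] A by simp
qed

lemma integral_r_le:
  assumes "A \<in> sets borel"
  shows "\<bar>weighted r A\<bar> \<le> c * (LINT u|lborel. indicator A u * exp (- q u))"
proof -
  have "\<bar>weighted r A\<bar> \<le> (LINT u|lborel. \<bar>indicator A u * (r u * exp (- q u))\<bar>)"
    by (rule integral_abs_bound)
  also have "\<dots> \<le> (LINT u|lborel. c * (indicator A u * exp (- q u)))"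
  proof (rule integral_mono)
    show "integrable lborel (\<lambda>u. \<bar>indicator A u * (r u * exp (- q u))\<bar>)"
      using integrable_r[OF assms] by (rule integrable_abs)
    show "integrable lborel (\<lambda>u. c * (indicator A u * exp (- q u)))"
      using integrable_mult_indicator[of A lborel "\<lambda>u. exp (- q u)"] integrable_weight assms by simp
    show "\<bar>indicator A u * (r u * exp (- q u))\<bar> \<le> c * (indicator A u * exp (- q u))" for u
      using bounded_r[of u] by (auto simp: indicator_def abs_mult)
  qed
  finally show ?thesis by simp
qed

text \<open>
  Centring makes the two tails cancel, so that the solution can be estimated from either side.
\<close>

lemma integral_r_right:
  "weighted r {..x} = - weighted r {x..}"
proof -
  note [measurable] = measurable_r
  have "weighted r {..x} + weighted r {x..}
    = (LINT u|lborel. indicator {..x} u * (r u * exp (- q u)) + indicator {x..} u * (r u * exp (- q u)))"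
    by (rule Bochner_Integration.integral_add[symmetric]) (auto intro!: integrable_r)
  also have "\<dots> = (LINT u|lborel. r u * exp (- q u))"
  proof (rule integral_cong_AE)
    show "AE u in lborel. indicator {..x} u * (r u * exp (- q u)) + indicator {x..} u * (r u * exp (- q u)) = r u * exp (- q u)"
      using AE_lborel_singleton[of x] by eventually_elim (auto simp: indicator_def)
  qed auto
  finally show ?thesis using centred_r by simp
qed

lemma DERIV_partial_integral_r:
  "((\<lambda>x. weighted r {..x}) has_real_derivative r x * exp (- q x)) (at x)"
proof -
  note [measurable] = measurable_r
  let ?f = "\<lambda>u. r u * exp (- q u)"
  let ?N = "\<lambda>x. LINT u|lborel. indicator {..x} u * ?f u"
  have cont: "continuous_on A ?f" for A
    by (intro continuous_intros continuous_on_q continuous_on_subset[OF continuous_r]) auto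
  have N: "?N y = ?N (x - 1) + integral {x - 1..y} ?f" if "y \<in> {x - 1..x + 1}" for y
  proof -
    have "?N y - ?N (x - 1) = (LINT u|lborel. indicator {..y} u * ?f u - indicator {..x - 1} u * ?f u)"
      by (rule Bochner_Integration.integral_diff[symmetric]) (auto intro!: integrable_r)
    also have "\<dots> = (LINT u|lborel. indicator {x - 1..y} u * ?f u)"
    proof (rule integral_cong_AE)
      show "AE u in lborel. indicator {..y} u * ?f u - indicator {..x - 1} u * ?f u = indicator {x - 1..y} u * ?f u"
        using AE_lborel_singleton[of "x - 1"] by eventually_elim (use that in \<open>auto simp: indicator_def\<close>)
    qed auto
    also have "\<dots> = integral {x - 1..y} ?f"
      using set_borel_integral_eq_integral(2)[of "{x - 1..y}" ?f] integrable_r[of "{x - 1..y}"]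
      by (simp add: set_lebesgue_integral_def set_integrable_def)
    finally show ?thesis by simp
  qed
  have "((\<lambda>y. ?N (x - 1) + integral {x - 1..y} ?f) has_real_derivative ?f x) (at x within {x - 1..x + 1})"
    by (auto intro!: derivative_eq_intros integral_has_real_derivative cont)
  then have "(?N has_real_derivative ?f x) (at x within {x - 1..x + 1})"
    by (rule has_field_derivative_transform_within[OF _ zero_less_one _ N[symmetric]]) auto
  then show ?thesis by (subst (asm) at_within_interior) auto
qed

lemma DERIV_poisson_grad:
  "(poisson_grad r has_real_derivative q1 x * poisson_grad r x + r x) (at x)"
proof -
  have "((\<lambda>x. exp (q x) * weighted r {..x}) has_real_derivative
      q1 x * poisson_grad r x + r x) (at x)"
    by (rule derivative_eq_intros DERIV_q DERIV_partial_integral_r refl)+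
       (simp add: poisson_grad_def field_simps flip: exp_add)
  then show ?thesis by (simp add: poisson_grad_def[abs_def])
qed

lemma continuous_on_poisson_grad: "continuous_on A (poisson_grad r)"
  by (meson DERIV_poisson_grad DERIV_isCont continuous_at_imp_continuous_on)

text \<open>
  Each tail is estimated from its own side: the factor \<open>exp q\<close> is exactly compensated by the Mills
  ratio of the weight.
\<close>

lemma q1_poisson_grad_outside:
  assumes "R \<le> \<bar>x\<bar>"
  shows "\<bar>q1 x * poisson_grad r x\<bar> \<le> c"
proof -
  have c: "0 \<le> c" using bounded_r[of 0] by linarith
  consider "R \<le> x" | "x \<le> - R" using assms by linarith
  then have "\<bar>q1 x\<bar> * \<bar>weighted r {..x}\<bar> \<le> c * exp (- q x)"
  proof cases
    case 1
    have "\<bar>q1 x\<bar> * \<bar>weighted r {..x}\<bar>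
       \<le> q1 x * (c * (LINT u|lborel. indicator {x..} u * exp (- q u)))"
      using q1_pos_right[OF 1] integral_r_le[of "{x..}"] by (subst integral_r_right) (auto intro!: mult_left_mono)
    also have "\<dots> \<le> c * exp (- q x)"
      using mult_left_mono[OF weight_tail_right[OF 1] c] by (simp add: algebra_simps)
    finally show ?thesis .
  next
    case 2
    have "\<bar>q1 x\<bar> * \<bar>weighted r {..x}\<bar>
       \<le> - q1 x * (c * (LINT u|lborel. indicator {..x} u * exp (- q u)))"
      using q1_neg_left[OF 2] mult_left_mono[OF integral_r_le[of "{..x}"], of "- q1 x"] by simp
    also have "\<dots> \<le> c * exp (- q x)"
      using mult_left_mono[OF weight_tail_left[OF 2] c] by (simp add: algebra_simps)
    finally show ?thesis .
  qed
  then have "exp (q x) * (\<bar>q1 x\<bar> * \<bar>weighted r {..x}\<bar>) \<le> exp (q x) * (c * exp (- q x))"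
    by (rule mult_left_mono) simp
  then show ?thesis by (simp add: poisson_grad_def abs_mult field_simps flip: exp_add)
qed

lemma poisson_grad_bounded: "\<exists>b. \<forall>x. \<bar>poisson_grad r x\<bar> \<le> b \<and> \<bar>q1 x * poisson_grad r x\<bar> \<le> b"
proof -
  obtain b1 where b1: "0 \<le> b1" "\<And>x. \<bar>x\<bar> \<le> R \<Longrightarrow> \<bar>poisson_grad r x\<bar> \<le> b1"
    using bounded_on_core[OF continuous_on_poisson_grad] by blast
  obtain b2 where b2: "0 \<le> b2" "\<And>x. \<bar>x\<bar> \<le> R \<Longrightarrow> \<bar>q1 x * poisson_grad r x\<bar> \<le> b2"
    using bounded_on_core[OF continuous_on_mult[OF continuous_on_q1 continuous_on_poisson_grad]] by blast
  have "\<bar>poisson_grad r x\<bar> \<le> b1 + b2 + c \<and> \<bar>q1 x * poisson_grad r x\<bar> \<le> b1 + b2 + c" for x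
  proof (cases "\<bar>x\<bar> \<le> R")
    case True
    have "0 \<le> c" using bounded_r[of 0] by linarith
    then show ?thesis using b1(1) b2(1) b1(2)[OF True] b2(2)[OF True] by linarith
  next
    case False
    then have "1 \<le> \<bar>q1 x\<bar>" using q1_pos_right[of x] q1_neg_left[of x] by linarith
    then have "\<bar>poisson_grad r x\<bar> \<le> \<bar>q1 x * poisson_grad r x\<bar>"
      by (simp add: abs_mult mult_le_cancel_right1)
    then show ?thesis using q1_poisson_grad_outside[of x] False b1(1) b2(1) by linarith
  qed
  then show ?thesis by blast
qed

text \<open>
  The integrand changes sign at most once, from negative to positive, and its total integral vanishes.
\<close>

lemma poisson_grad_nonpos:
  assumes "mono r"
  shows "poisson_grad r x \<le> 0"
proof (cases "r x \<le> 0")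
  case True
  have "0 \<le> (LINT u|lborel. - (indicator {..x} u * (r u * exp (- q u))))"
  proof (rule Bochner_Integration.integral_nonneg)
    show "0 \<le> - (indicator {..x} u * (r u * exp (- q u)))" for u
    proof (cases "u \<le> x")
      case True
      then show ?thesis
        using \<open>r x \<le> 0\<close> monoD[OF assms True] by (simp add: mult_le_0_iff)
    qed simp
  qed
  then show ?thesis by (simp add: poisson_grad_def mult_le_0_iff)
next
  case False
  have "0 \<le> weighted r {x..}"
  proof (rule Bochner_Integration.integral_nonneg)
    show "0 \<le> indicator {x..} u * (r u * exp (- q u))" for u
      using False monoD[OF assms, of x u] by (auto simp: indicator_def)
  qed
  then show ?thesis by (simp add: poisson_grad_def integral_r_right mult_le_0_iff)
qed

end

lemma antiderivative:
  fixes f :: "real \<Rightarrow> real"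
  assumes "continuous_on UNIV f"
  obtains F where "\<And>x. (F has_real_derivative f x) (at x)"
proof -
  define F where "F x = (LBINT u=0..x. f u)" for x :: real
  have "(F has_real_derivative f x) (at x)" for x
  proof -
    let ?a = "min 0 x - 1" and ?b = "max 0 x + 1"
    have "(F has_vector_derivative f x) (at x within {?a..?b})"
      unfolding F_def zero_ereal_def
      by (rule interval_integral_FTC2) (use assms in \<open>auto intro: continuous_on_subset\<close>)
    then have "(F has_vector_derivative f x) (at x)"
      by (subst (asm) at_within_interior) auto
    then show ?thesis by (simp add: has_real_derivative_iff_has_vector_derivative)
  qed
  then show thesis by (rule that)
qed

text \<open>
  The function \<open>G = id - A \<phi>\<close> of the introduction.  Monotonicity of \<open>arctan\<close> gives \<open>V \<ge> 1\<close>, its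
  boundedness gives the upper bounds, and its strictly positive derivative beats the negative part of
  \<open>q''\<close> on the compact core.
\<close>

lemma ex_contracting_function:
  "\<exists>G V V' h b l. 0 < l \<and> (\<forall>x. (G has_real_derivative V x) (at x)) \<and>
     (\<forall>x. (V has_real_derivative V' x) (at x)) \<and> continuous_on UNIV V' \<and>
     (\<forall>x. 1 \<le> V x \<and> V x \<le> b \<and> \<bar>V' x\<bar> \<le> b) \<and> (\<forall>x. V' x - q1 x * V x = - h x) \<and>
     (\<forall>x y. x \<le> y \<longrightarrow> l * (G y - G x) \<le> h y - h x)"
proof -
  interpret gibbs: prob_space "gibbs_measure q" by (rule prob_space_gibbs)
  define m where "m = (LINT u|gibbs_measure q. arctan u)"
  define r where "r u = arctan u - m" for u
  have arctan_bd: "\<bar>arctan u\<bar> \<le> 2" for u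
    using arctan_bounded[of u] pi_less_4 by (auto simp: abs_le_iff)
  have [measurable]: "(arctan :: real \<Rightarrow> real) \<in> borel_measurable borel"
    by (intro borel_measurable_continuous_onI continuous_on_arctan continuous_on_id)
  have ia: "integrable (gibbs_measure q) arctan"
    by (rule gibbs.integrable_const_bound[where B = 2]) (auto simp: arctan_bd)
  have cont: "continuous_on UNIV r" unfolding r_def by (intro continuous_intros)
  have bd: "\<bar>r u\<bar> \<le> 2 + \<bar>m\<bar>" for u using arctan_bd[of u] unfolding r_def by linarith
  have cent: "(LINT u|lborel. r u * exp (- q u)) = 0"
  proof -
    have "(LINT u|gibbs_measure q. r u) = 0"
      unfolding r_def using ia by (simp add: m_def gibbs.prob_space)
    then show ?thesis using Z_pos by (subst (asm) integral_gibbs) (auto intro: borel_measurable_continuous_onI[OF cont])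
  qed
  note pg = cont bd cent
  have mono: "mono r" by (auto simp: r_def mono_def arctan_le_iff)
  let ?\<psi> = "poisson_grad r"
  obtain b where b: "\<And>x. \<bar>?\<psi> x\<bar> \<le> b" "\<And>x. \<bar>q1 x * ?\<psi> x\<bar> \<le> b" using poisson_grad_bounded[OF pg] by blast
  obtain \<phi> where \<phi>: "\<And>x. (\<phi> has_real_derivative ?\<psi> x) (at x)"
    using antiderivative[OF continuous_on_poisson_grad[OF pg]] by blast
  \<comment> \<open>\<open>A arctan' \<ge> K + 1\<close> on \<open>[-R, R]\<close>, which outweighs \<open>q'' \<ge> - K\<close> there.\<close>
  define A where "A = (K + 1) * (1 + R\<^sup>2)"
  have A: "0 < A" unfolding A_def using K_pos R_ge by (intro mult_pos_pos) (auto intro: add_pos_nonneg)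
  define G where "G x = x - A * \<phi> x" for x
  define V where "V x = 1 - A * ?\<psi> x" for x
  define V' where "V' x = - A * (q1 x * ?\<psi> x + r x)" for x
  define h where "h x = q1 x + A * r x" for x
  define B where "B = 1 + A * (b + b + 2 + \<bar>m\<bar>)"
  have b0: "0 \<le> b" using b(1)[of 0] by linarith
  have dG: "(G has_real_derivative V x) (at x)" for x
    unfolding G_def[abs_def] V_def by (auto intro!: derivative_eq_intros \<phi>)
  have dV: "(V has_real_derivative V' x) (at x)" for x
    unfolding V'_def V_def[abs_def] by (auto intro!: derivative_eq_intros DERIV_poisson_grad[OF pg])
  have cV': "continuous_on UNIV V'"
    unfolding V'_def by (intro continuous_intros continuous_on_q1 continuous_on_poisson_grad[OF pg] cont)
  have V1: "1 \<le> V x" for x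
    using poisson_grad_nonpos[OF pg mono, of x] A by (simp add: V_def mult_le_0_iff)
  have VB: "V x \<le> B" for x
  proof -
    have "A * (- ?\<psi> x) \<le> A * (b + b + 2 + \<bar>m\<bar>)"
      using b(1)[of x] b0 A by (intro mult_left_mono) auto
    then show ?thesis unfolding V_def B_def by simp
  qed
  have V'B: "\<bar>V' x\<bar> \<le> B" for x
  proof -
    have "\<bar>V' x\<bar> = A * \<bar>q1 x * ?\<psi> x + r x\<bar>" using A by (simp add: V'_def abs_mult)
    also have "\<dots> \<le> A * (b + b + 2 + \<bar>m\<bar>)"
      using b(2)[of x] bd[of x] b0 A by (intro mult_left_mono) linarith+
    finally show ?thesis by (simp add: B_def)
  qed
  have Bpos: "1 \<le> B" using V1[of 0] VB[of 0] by linarith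
  have dh: "(h has_real_derivative q2 x + A * inverse (1 + x\<^sup>2)) (at x)" for x
    unfolding h_def[abs_def] r_def by (auto intro!: derivative_eq_intros DERIV_q1)
  have h1: "1 \<le> q2 x + A * inverse (1 + x\<^sup>2)" for x
  proof (cases "R \<le> \<bar>x\<bar>")
    case True
    then show ?thesis using q2_outside[OF True] A by (simp add: add_increasing2)
  next
    case False
    then have "x\<^sup>2 \<le> R\<^sup>2" using R_ge by (auto intro: abs_le_square_iff[THEN iffD1])
    then have "(K + 1) * (1 + x\<^sup>2) \<le> A" unfolding A_def using K_pos by (intro mult_left_mono) auto
    then have "K + 1 \<le> A * inverse (1 + x\<^sup>2)"
      by (simp add: field_simps add_pos_nonneg divide_inverse[symmetric] pos_le_divide_eq)
    then show ?thesis using q2_ge[of x] by linarith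
  qed
  have hG: "1 / B * (G y - G x) \<le> h y - h x" if "x \<le> y" for x y
  proof -
    have "h x - 1 / B * G x \<le> h y - 1 / B * G y"
    proof (rule mono_of_DERIV[OF _ _ that, where f' = "\<lambda>u. (q2 u + A * inverse (1 + u\<^sup>2)) - 1 / B * V u"])
      show "((\<lambda>x. h x - 1 / B * G x) has_real_derivative q2 u + A * inverse (1 + u\<^sup>2) - 1 / B * V u) (at u)" for u
        by (intro DERIV_diff dh DERIV_cmult dG)
      show "0 \<le> q2 u + A * inverse (1 + u\<^sup>2) - 1 / B * V u" for u
      proof -
        have "1 / B * V u \<le> 1" using VB[of u] Bpos by (simp add: field_simps)
        then show ?thesis using h1[of u] by linarith
      qed
    qed
    then show ?thesis by (simp add: algebra_simps)
  qed
  have eq: "V' x - q1 x * V x = - h x" for x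
    by (simp add: V'_def V_def h_def algebra_simps)
  show ?thesis
    by (rule exI[of _ G], rule exI[of _ V], rule exI[of _ V'], rule exI[of _ h], rule exI[of _ B], rule exI[of _ "1 / B"])
       (use dG dV cV' V1 VB V'B eq hG Bpos in auto)
qed

end

section \<open>The implicit Euler scheme\<close>

definition gauss :: "real \<Rightarrow> real measure" where
  "gauss h = density lborel (\<lambda>w. ennreal (normal_density 0 (sqrt h) w))"

lemma sets_gauss [measurable_cong, simp]: "sets (gauss h) = sets borel"
  and space_gauss [simp]: "space (gauss h) = UNIV"
  by (simp_all add: gauss_def)

lemma prob_space_gauss: "0 < h \<Longrightarrow> prob_space (gauss h)"
  unfolding gauss_def by (rule prob_space_normal_density) simp

lemma integrable_gauss_power: "0 < h \<Longrightarrow> integrable (gauss h) (\<lambda>w. w ^ k)"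
  unfolding gauss_def using integrable_normal_moment[of "sqrt h" 0 k]
  by (subst integrable_density) auto

lemma integral_gauss:
  assumes "0 < h"
  shows "(LINT w|gauss h. w) = 0" "(LINT w|gauss h. w\<^sup>2) = h" "(LINT w|gauss h. w ^ 4) = 3 * h\<^sup>2"
proof -
  have eq: "(LINT w|gauss h. w ^ k) = (LINT w|lborel. normal_density 0 (sqrt h) w * (w - 0) ^ k)" for k
    unfolding gauss_def by (subst integral_density) auto
  show "(LINT w|gauss h. w) = 0"
    using eq[of 1] integral_normal_moment_odd[of "sqrt h" 0 0] assms by simp
  show "(LINT w|gauss h. w\<^sup>2) = h"
    using eq[of 2] integral_normal_moment_even[of "sqrt h" 0 1] assms by (simp add: fact_numeral)
  show "(LINT w|gauss h. w ^ 4) = 3 * h\<^sup>2"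
    using eq[of 4] integral_normal_moment_even[of "sqrt h" 0 2] assms
    by (simp add: fact_numeral power_mult_distrib power_divide flip: power_mult)
qed

context confining_potential
begin

text \<open>
  The backward Euler step of \<open>y' = - q' (y)\<close>.  The explicit step would fail to be monotone, and could
  blow up, for a superlinear \<open>q'\<close>.
\<close>

definition implicit_step :: "real \<Rightarrow> real \<Rightarrow> real" where
  "implicit_step h = inv (\<lambda>y. y + h * q1 y)"

text \<open>
  The lower bound on \<open>q''\<close> gives \<open>id + h q'\<close> a slope of at least \<open>1 - h K\<close>, which is positive for small
  \<open>h\<close>; all properties of its inverse follow from this.
\<close>

lemma implicit_expand:
  assumes "0 \<le> h" "y \<le> y'"
  shows "(1 - h * K) * (y' - y) \<le> (y' + h * q1 y') - (y + h * q1 y)"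
  using mult_left_mono[OF q1_one_sided_Lipschitz[OF assms(2)] assms(1)] by (simp add: algebra_simps)

lemma implicit_step_eq:
  assumes "0 \<le> h" "h * K \<le> 1 / 2"
  shows "implicit_step h z + h * q1 (implicit_step h z) = z"
proof -
  let ?p = "\<lambda>y. y + h * q1 y"
  have "\<exists>y. ?p y = z"
  proof -
    define d where "d = 2 * \<bar>z - ?p 0\<bar>"
    have d: "0 \<le> d" "\<bar>z - ?p 0\<bar> \<le> (1 - h * K) * d"
      using assms mult_right_mono[of "1/2" "1 - h * K" d] by (auto simp: d_def)
    have "?p (- d) \<le> z" "z \<le> ?p d"
      using implicit_expand[OF assms(1), of "- d" 0] implicit_expand[OF assms(1), of 0 d] d by auto
    moreover have "continuous_on {- d..d} ?p"
      by (intro continuous_intros continuous_on_q1)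
    ultimately show ?thesis using IVT'[of ?p "- d" z d] d by auto
  qed
  then have "z \<in> range ?p" by auto
  then show ?thesis unfolding implicit_step_def by (rule f_inv_into_f)
qed

lemma exp_bound_inverse:
  fixes u :: real
  assumes "0 \<le> u" "u \<le> 1 / 2"
  shows "1 \<le> (1 - u) * exp (2 * u)"
proof -
  have "1 + u * (1 - 2 * u) \<le> (1 - u) * exp (2 * u)"
    using mult_left_mono[OF exp_ge_add_one_self[of "2 * u"], of "1 - u"] assms by (simp add: algebra_simps)
  moreover have "0 \<le> u * (1 - 2 * u)" using assms by simp
  ultimately show ?thesis by linarith
qed

lemma le_exp_of_expand:
  assumes "0 \<le> h" "h * K \<le> 1 / 2" "(1 - h * K) * d \<le> e" "0 \<le> d"
  shows "d \<le> exp (2 * K * h) * e"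
proof -
  have "d * 1 \<le> d * ((1 - h * K) * exp (2 * (h * K)))"
    using exp_bound_inverse[of "h * K"] assms K_pos by (intro mult_left_mono) auto
  also have "\<dots> = exp (2 * K * h) * ((1 - h * K) * d)" by (simp add: ac_simps)
  also have "\<dots> \<le> exp (2 * K * h) * e" using assms by (intro mult_left_mono) auto
  finally show ?thesis by simp
qed

lemma implicit_step_mono:
  assumes "0 \<le> h" "h * K \<le> 1 / 2" "z \<le> z'"
  shows "implicit_step h z \<le> implicit_step h z'"
proof (rule ccontr)
  assume "\<not> ?thesis"
  then have lt: "implicit_step h z' < implicit_step h z" by simp
  have "0 < (1 - h * K) * (implicit_step h z - implicit_step h z')"
    using assms lt by (intro mult_pos_pos) auto
  also have "\<dots> \<le> z - z'"
    using implicit_expand[OF assms(1) less_imp_le[OF lt]] implicit_step_eq[OF assms(1,2)] by simp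
  finally show False using assms(3) by simp
qed

lemma implicit_step_Lipschitz:
  assumes "0 \<le> h" "h * K \<le> 1 / 2"
  shows "\<bar>implicit_step h z - implicit_step h z'\<bar> \<le> exp (2 * K * h) * \<bar>z - z'\<bar>"
proof -
  have *: "\<bar>implicit_step h z - implicit_step h z'\<bar> \<le> exp (2 * K * h) * \<bar>z - z'\<bar>" if "z' \<le> z" for z z'
  proof -
    have m: "implicit_step h z' \<le> implicit_step h z" by (rule implicit_step_mono[OF assms that])
    have "implicit_step h z - implicit_step h z' \<le> exp (2 * K * h) * (z - z')"
      using implicit_expand[OF assms(1) m] implicit_step_eq[OF assms] m
      by (intro le_exp_of_expand[OF assms]) auto
    then show ?thesis using m that by simp
  qed
  show ?thesis
    using *[of z' z] *[of z z'] by (cases "z' \<le> z") (auto simp: abs_minus_commute)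
qed

lemma continuous_implicit_step:
  assumes "0 \<le> h" "h * K \<le> 1 / 2"
  shows "continuous_on UNIV (implicit_step h)"
proof (rule lipschitz_on_continuous_on)
  show "(exp (2 * K * h))-lipschitz_on UNIV (implicit_step h)"
    using implicit_step_Lipschitz[OF assms] by (intro lipschitz_onI) (auto simp: dist_real_def)
qed

lemma measurable_implicit_step:
  assumes "0 \<le> h" "h * K \<le> 1 / 2"
  shows "implicit_step h \<in> borel_measurable borel"
  by (rule borel_measurable_continuous_onI[OF continuous_implicit_step[OF assms]])

primrec implicit_scheme :: "real \<Rightarrow> real \<Rightarrow> (real \<Rightarrow> real) \<Rightarrow> real \<Rightarrow> nat \<Rightarrow> real" where
  "implicit_scheme h s b z 0 = z"
| "implicit_scheme h s b z (Suc k) =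
     implicit_step h (implicit_scheme h s b z k + sqrt 2 * (b (s + real (Suc k) * h) - b (s + real k * h)))"

text \<open>
  The solution itself satisfies the scheme up to a residual of size \<open>h \<epsilon>\<close>, where \<open>\<epsilon>\<close> bounds the
  oscillation of \<open>q'\<close> along the path over one step.  Each step amplifies the accumulated error by at
  most \<open>exp (2 K h)\<close>.
\<close>

lemma implicit_scheme_error:
  assumes s: "0 \<le> s" and h: "0 \<le> h" "h * K \<le> 1 / 2"
    and cont: "continuous_on {0..s + real n * h} y"
    and eq: "\<And>u. 0 \<le> u \<Longrightarrow> u \<le> s + real n * h \<Longrightarrow> y u = y 0 + sqrt 2 * b u - integral {0..u} (\<lambda>v. q1 (y v))"
    and osc: "\<And>u v. u \<in> {0..s + real n * h} \<Longrightarrow> v \<in> {0..s + real n * h} \<Longrightarrow> \<bar>u - v\<bar> \<le> h \<Longrightarrow> \<bar>q1 (y u) - q1 (y v)\<bar> \<le> \<epsilon>"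
    and k: "k \<le> n"
  shows "\<bar>implicit_scheme h s b (y s) k - y (s + real k * h)\<bar> \<le> exp (2 * K * h * real k) * (real k * h * \<epsilon>)"
  using k
proof (induction k)
  case 0
  then show ?case by simp
next
  case (Suc k)
  let ?u = "s + real k * h" and ?v = "s + real (Suc k) * h" and ?T = "s + real n * h"
  have uv: "0 \<le> ?u" "?u \<le> ?v" "?v \<le> ?T" "?v - ?u = h"
    using s h mult_left_mono[of "real (Suc k)" "real n" h] Suc.prems by (auto simp: algebra_simps)
  have \<epsilon>: "0 \<le> \<epsilon>" using osc[of 0 0] s h by simp
  have cont': "continuous_on {0..?T} (\<lambda>v. q1 (y v))"
    by (rule continuous_on_compose2[OF continuous_on_q1 cont]) auto
  have int: "(\<lambda>v. q1 (y v)) integrable_on {a..b}" if "0 \<le> a" "b \<le> ?T" for a b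
    by (rule integrable_continuous_real[OF continuous_on_subset[OF cont']]) (use that in auto)
  have "integral {0..?v} (\<lambda>v. q1 (y v)) = integral {0..?u} (\<lambda>v. q1 (y v)) + integral {?u..?v} (\<lambda>v. q1 (y v))"
    by (rule Henstock_Kurzweil_Integration.integral_combine[symmetric]) (use uv int in auto)
  then have inc: "y ?v = y ?u + sqrt 2 * (b ?v - b ?u) - integral {?u..?v} (\<lambda>v. q1 (y v))"
    using eq[of ?v] eq[of ?u] uv by (simp add: algebra_simps)
  define r where "r = h * q1 (y ?v) - integral {?u..?v} (\<lambda>v. q1 (y v))"
  have "r = integral {?u..?v} (\<lambda>v. q1 (y ?v) - q1 (y v))"
    using uv int[of ?u ?v] unfolding r_def
    by (subst Henstock_Kurzweil_Integration.integral_diff) auto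
  also have "norm \<dots> \<le> \<epsilon> * (?v - ?u)"
    using uv osc[of ?v] by (intro integral_bound continuous_intros continuous_on_subset[OF cont']) auto
  finally have r: "\<bar>r\<bar> \<le> h * \<epsilon>" using uv by (simp add: mult.commute)
  have "y ?v + h * q1 (y ?v) = y ?u + sqrt 2 * (b ?v - b ?u) + r"
    unfolding r_def using inc by simp
  then have y: "y ?v = implicit_step h (y ?u + sqrt 2 * (b ?v - b ?u) + r)"
  proof -
    let ?w = "implicit_step h (y ?v + h * q1 (y ?v))"
    have w: "?w + h * q1 ?w = y ?v + h * q1 (y ?v)" by (rule implicit_step_eq[OF h])
    have "?w = y ?v"
    proof (rule ccontr)
      assume "?w \<noteq> y ?v"
      then consider "?w < y ?v" | "y ?v < ?w" by linarith
      then show False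
      proof cases
        case 1
        then have "0 < (1 - h * K) * (y ?v - ?w)" using h by (intro mult_pos_pos) auto
        then show False using implicit_expand[OF h(1) less_imp_le[OF 1]] w by simp
      next
        case 2
        then have "0 < (1 - h * K) * (?w - y ?v)" using h by (intro mult_pos_pos) auto
        then show False using implicit_expand[OF h(1) less_imp_le[OF 2]] w by simp
      qed
    qed
    then show ?thesis using \<open>y ?v + h * q1 (y ?v) = y ?u + sqrt 2 * (b ?v - b ?u) + r\<close> by simp
  qed
  let ?S = "implicit_scheme h s b (y s) k"
  let ?E = "exp (2 * K * h * real k)"
  have IH: "\<bar>?S - y ?u\<bar> \<le> ?E * (real k * h * \<epsilon>)" using Suc by simp
  have "\<bar>implicit_scheme h s b (y s) (Suc k) - y ?v\<bar>
      \<le> exp (2 * K * h) * \<bar>(?S + sqrt 2 * (b ?v - b ?u)) - (y ?u + sqrt 2 * (b ?v - b ?u) + r)\<bar>"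
    by (subst y) (simp only: implicit_scheme.simps implicit_step_Lipschitz[OF h])
  also have "\<dots> \<le> exp (2 * K * h) * (?E * (real k * h * \<epsilon>) + h * \<epsilon>)"
    using IH r by (intro mult_left_mono) auto
  also have "\<dots> \<le> exp (2 * K * h) * (?E * (real k * h * \<epsilon>) + ?E * (h * \<epsilon>))"
    using h \<epsilon> K_pos mult_right_mono[of 1 ?E "h * \<epsilon>"] by (intro mult_left_mono add_left_mono) auto
  also have "\<dots> = exp (2 * K * h * real (Suc k)) * (real (Suc k) * h * \<epsilon>)"
    by (simp add: algebra_simps exp_add)
  finally show ?case .
qed

text \<open>
  On a bounded time interval \<open>q'\<close> is uniformly continuous along the path, so its oscillation over one
  step vanishes with the step size.
\<close>

lemma implicit_scheme_tendsto:
  assumes s: "0 \<le> s" and t: "0 < t"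
    and cont: "continuous_on {0..} y"
    and eq: "\<And>u. 0 \<le> u \<Longrightarrow> y u = y 0 + sqrt 2 * b u - integral {0..u} (\<lambda>v. q1 (y v))"
  shows "(\<lambda>n. implicit_scheme (t / real n) s b (y s) n) \<longlonglongrightarrow> y (s + t)"
proof (rule metric_LIMSEQ_I)
  fix e :: real assume e: "0 < e"
  define \<epsilon> where "\<epsilon> = e / (2 * exp (2 * K * t) * t)"
  have \<epsilon>: "0 < \<epsilon>" using e t by (simp add: \<epsilon>_def)
  have "uniformly_continuous_on {0..s + t} (\<lambda>v. q1 (y v))"
    by (intro compact_uniformly_continuous continuous_on_compose2[OF continuous_on_q1 continuous_on_subset[OF cont]]) auto
  then obtain \<delta> where \<delta>: "0 < \<delta>" "\<And>u v. u \<in> {0..s + t} \<Longrightarrow> v \<in> {0..s + t} \<Longrightarrow> dist v u < \<delta> \<Longrightarrow> dist (q1 (y v)) (q1 (y u)) < \<epsilon>"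
    using \<epsilon> unfolding uniformly_continuous_on_def by blast
  obtain N :: nat where N: "t / \<delta> + 2 * K * t < real N" using reals_Archimedean2 by blast
  have "dist (implicit_scheme (t / real n) s b (y s) n) (y (s + t)) < e" if n: "N \<le> n" for n
  proof -
    have n': "t / \<delta> + 2 * K * t < real n" using N n by linarith
    have p: "0 \<le> t / \<delta>" "0 \<le> 2 * K * t" using t \<delta> K_pos by auto
    then have n0: "0 < real n" "t / \<delta> < real n" "2 * K * t < real n" using n' by linarith+
    have nh: "real n * (t / real n) = t" using n0 by simp
    have "\<bar>implicit_scheme (t / real n) s b (y s) n - y (s + real n * (t / real n))\<bar>
        \<le> exp (2 * K * (t / real n) * real n) * (real n * (t / real n) * \<epsilon>)"
    proof (rule implicit_scheme_error[OF s])
      show "t / real n * K \<le> 1 / 2" using n0 by (simp add: field_simps)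
      show "continuous_on {0..s + real n * (t / real n)} y" by (rule continuous_on_subset[OF cont]) auto
      show "\<bar>q1 (y u) - q1 (y v)\<bar> \<le> \<epsilon>"
        if "u \<in> {0..s + real n * (t / real n)}" "v \<in> {0..s + real n * (t / real n)}" "\<bar>u - v\<bar> \<le> t / real n" for u v
      proof -
        have "t / real n < \<delta>" using n0 \<delta> by (simp add: field_simps)
        then have "dist v u < \<delta>" using that by (auto simp: dist_real_def)
        then show ?thesis using \<delta>(2)[of u v] that unfolding nh by (auto simp: dist_real_def abs_minus_commute)
      qed
      show "y u = y 0 + sqrt 2 * b u - integral {0..u} (\<lambda>v. q1 (y v))" if "0 \<le> u" for u
        by (rule eq[OF that])
    qed (use t in auto)
    also have "exp (2 * K * (t / real n) * real n) * (real n * (t / real n) * \<epsilon>) = e / 2"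
      unfolding \<epsilon>_def using n0 t by simp
    also have "\<dots> < e" using e by simp
    finally show ?thesis unfolding nh by (simp add: dist_real_def)
  qed
  then show "\<exists>no. \<forall>n\<ge>no. dist (implicit_scheme (t / real n) s b (y s) n) (y (s + t)) < e" by blast
qed

text \<open>
  The transition operator of one step of the scheme.
\<close>

definition Q :: "real \<Rightarrow> (real \<Rightarrow> real) \<Rightarrow> real \<Rightarrow> real" where
  "Q h f z = (LINT w|gauss h. f (implicit_step h (z + sqrt 2 * w)))"

context
  fixes h :: real
  assumes h: "0 < h" "h * K \<le> 1 / 2"
begin

interpretation G: prob_space "gauss h" by (rule prob_space_gauss[OF h(1)])

lemma measurable_step: "implicit_step h \<in> borel_measurable borel"
  using measurable_implicit_step h by simp

lemma integrable_Q:
  fixes f :: "real \<Rightarrow> real"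
  assumes [measurable]: "f \<in> borel_measurable borel" and "\<And>z. \<bar>f z\<bar> \<le> c"
  shows "integrable (gauss h) (\<lambda>w. f (implicit_step h (z + sqrt 2 * w)))"
  supply measurable_step [measurable]
proof (rule G.integrable_const_bound[where B = c])
  show "(\<lambda>w. f (implicit_step h (z + sqrt 2 * w))) \<in> borel_measurable (gauss h)" by measurable
qed (use assms in auto)

lemma Q_measurable:
  assumes [measurable]: "f \<in> borel_measurable borel"
  shows "Q h f \<in> borel_measurable borel"
  supply measurable_step [measurable]
  unfolding Q_def[abs_def] by (rule G.borel_measurable_lebesgue_integral) measurable

lemma Q_bounded:
  assumes "f \<in> borel_measurable borel" and c: "\<And>z. \<bar>f z\<bar> \<le> c"
  shows "\<bar>Q h f z\<bar> \<le> c"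
proof -
  have "\<bar>Q h f z\<bar> \<le> (LINT w|gauss h. \<bar>f (implicit_step h (z + sqrt 2 * w))\<bar>)"
    unfolding Q_def by (rule integral_abs_bound)
  also have "\<dots> \<le> (LINT w|gauss h. c)"
    using integrable_Q[OF assms] c by (intro integral_mono) auto
  finally show ?thesis using G.prob_space by simp
qed

lemma Q_mono:
  assumes "mono f" and "\<And>z. \<bar>f z\<bar> \<le> c"
  shows "mono (Q h f)"
proof (rule monoI)
  fix z z' :: real assume "z \<le> z'"
  have [measurable]: "f \<in> borel_measurable borel" by (rule borel_measurable_mono[OF assms(1)])
  show "Q h f z \<le> Q h f z'"
    unfolding Q_def using h \<open>z \<le> z'\<close>
    by (intro integral_mono integrable_Q[OF _ assms(2)] monoD[OF assms(1)] implicit_step_mono) auto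
qed

lemma Q_Lipschitz:
  assumes f: "\<And>z z'. \<bar>f z - f z'\<bar> \<le> L * \<bar>z - z'\<bar>" and m: "f \<in> borel_measurable borel" and c: "\<And>z. \<bar>f z\<bar> \<le> c"
  shows "\<bar>Q h f z - Q h f z'\<bar> \<le> (exp (2 * K * h) * L) * \<bar>z - z'\<bar>"
proof -
  have L: "0 \<le> L" using f[of 0 1] by simp
  let ?g = "\<lambda>z w. f (implicit_step h (z + sqrt 2 * w))"
  note i = integrable_Q[OF m c]
  have "\<bar>Q h f z - Q h f z'\<bar> = \<bar>LINT w|gauss h. ?g z w - ?g z' w\<bar>"
    unfolding Q_def by (simp add: Bochner_Integration.integral_diff[OF i i])
  also have "\<dots> \<le> (LINT w|gauss h. \<bar>?g z w - ?g z' w\<bar>)" by (rule integral_abs_bound)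
  also have "\<dots> \<le> (LINT w|gauss h. (exp (2 * K * h) * L) * \<bar>z - z'\<bar>)"
  proof (rule integral_mono)
    show "integrable (gauss h) (\<lambda>w. \<bar>?g z w - ?g z' w\<bar>)"
      by (intro integrable_abs Bochner_Integration.integrable_diff i)
    show "\<bar>?g z w - ?g z' w\<bar> \<le> (exp (2 * K * h) * L) * \<bar>z - z'\<bar>" for w
    proof -
      have "\<bar>?g z w - ?g z' w\<bar> \<le> L * \<bar>implicit_step h (z + sqrt 2 * w) - implicit_step h (z' + sqrt 2 * w)\<bar>" by (rule f)
      also have "\<dots> \<le> L * (exp (2 * K * h) * \<bar>(z + sqrt 2 * w) - (z' + sqrt 2 * w)\<bar>)"
        using implicit_step_Lipschitz[of h "z + sqrt 2 * w" "z' + sqrt 2 * w"] h L by (intro mult_left_mono) auto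
      finally show ?thesis by (simp add: ac_simps)
    qed
  qed auto
  finally show ?thesis using G.prob_space by simp
qed

lemma funpow_Q_measurable: "f \<in> borel_measurable borel \<Longrightarrow> (Q h ^^ n) f \<in> borel_measurable borel"
  by (induction n) (auto intro: Q_measurable)

lemma funpow_Q_bounded:
  assumes "f \<in> borel_measurable borel" and "\<And>z. \<bar>f z\<bar> \<le> c"
  shows "\<bar>(Q h ^^ n) f z\<bar> \<le> c"
  by (induction n arbitrary: z) (auto intro!: Q_bounded funpow_Q_measurable assms)

lemma funpow_Q_mono:
  assumes "mono f" and "\<And>z. \<bar>f z\<bar> \<le> c"
  shows "mono ((Q h ^^ n) f)"
  by (induction n) (auto intro!: Q_mono funpow_Q_bounded assms borel_measurable_mono)

lemma funpow_Q_Lipschitz: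
  assumes "\<And>z z'. \<bar>f z - f z'\<bar> \<le> L * \<bar>z - z'\<bar>" "f \<in> borel_measurable borel" "\<And>z. \<bar>f z\<bar> \<le> c"
  shows "\<bar>(Q h ^^ n) f z - (Q h ^^ n) f z'\<bar> \<le> (exp (2 * K * (real n * h)) * L) * \<bar>z - z'\<bar>"
proof (induction n arbitrary: z z')
  case 0
  then show ?case using assms by simp
next
  case (Suc n)
  have "\<bar>Q h ((Q h ^^ n) f) z - Q h ((Q h ^^ n) f) z'\<bar>
      \<le> (exp (2 * K * h) * (exp (2 * K * (real n * h)) * L)) * \<bar>z - z'\<bar>"
    by (rule Q_Lipschitz[OF Suc funpow_Q_measurable[OF assms(2)] funpow_Q_bounded[OF assms(2,3)]])
  also have "exp (2 * K * h) * (exp (2 * K * (real n * h)) * L) = exp (2 * K * (real (Suc n) * h)) * L"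
    by (simp add: algebra_simps exp_add)
  finally show ?case by simp
qed

end

end

context standard_brownian_motion
begin

section \<open>Brownian increments are independent of the past\<close>

lemma measurable_of_F:
  assumes "0 \<le> s" "Y \<in> measurable (F s) N"
  shows "Y \<in> measurable M N"
  using assms subalgebra_F[OF assms(1)] space_F[of s]
  by (auto simp: measurable_def)

lemma measurable_F_mono:
  assumes "s \<le> t" "Y \<in> measurable (F s) N"
  shows "Y \<in> measurable (F t) N"
  using assms sets_F_mono[OF assms(1)] space_F by (auto simp: measurable_def)

lemma measurable_B [measurable]: "0 \<le> t \<Longrightarrow> B t \<in> borel_measurable M"
  using adapted_B measurable_of_F by blast

lemma distr_increment:
  assumes "0 \<le> s" "s < t"
  shows "distr M borel (\<lambda>\<omega>. B t \<omega> - B s \<omega>) = gauss (t - s)"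
proof -
  have "distr M borel (\<lambda>\<omega>. B t \<omega> - B s \<omega>) = distr M lborel (\<lambda>\<omega>. B t \<omega> - B s \<omega>)"
    by (rule distr_cong) auto
  also have "\<dots> = gauss (t - s)"
    unfolding gauss_def by (rule distributed_distr_eq_density) (rule normal_increments[OF assms])
  finally show ?thesis .
qed

text \<open>
  Independence is used in the form of a product law on rectangles, because \<open>Y\<close> may take its values in
  a space different from that of the increments.
\<close>

lemma distr_past_increment:
  assumes st: "0 \<le> s" "s < t" and Y: "Y \<in> measurable (F s) N"
  shows "distr M (N \<Otimes>\<^sub>M borel) (\<lambda>\<omega>. (Y \<omega>, B t \<omega> - B s \<omega>)) = distr M N Y \<Otimes>\<^sub>M gauss (t - s)"
proof -
  let ?D = "\<lambda>\<omega>. B t \<omega> - B s \<omega>"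
  have D: "?D \<in> borel_measurable M" using st by simp
  have YM: "Y \<in> measurable M N" by (rule measurable_of_F[OF st(1) Y])
  have YD: "(\<lambda>\<omega>. (Y \<omega>, ?D \<omega>)) \<in> measurable M (N \<Otimes>\<^sub>M borel)" using YM D by simp
  interpret Y: prob_space "distr M N Y" by (rule prob_space_distr[OF YM])
  interpret G: prob_space "gauss (t - s)" using st by (intro prob_space_gauss) simp
  show ?thesis
  proof (rule pair_measure_eqI[symmetric])
    fix A :: "'b set" and C :: "real set"
    assume "A \<in> sets (distr M N Y)" "C \<in> sets (gauss (t - s))"
    then have A: "A \<in> sets N" and C: "C \<in> sets borel" by auto
    have "Y -` A \<inter> space M \<in> sets (F s)"
      using measurable_sets[OF Y A] by (simp add: space_F)
    moreover have "?D -` C \<inter> space M \<in> sets (vimage_algebra (space M) ?D borel)"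
      using C by (rule in_vimage_algebra)
    ultimately have "prob ((Y -` A \<inter> space M) \<inter> (?D -` C \<inter> space M)) = prob (Y -` A \<inter> space M) * prob (?D -` C \<inter> space M)"
      by (rule indep_setD[OF indep_increments[OF st]])
    moreover have "(\<lambda>\<omega>. (Y \<omega>, ?D \<omega>)) -` (A \<times> C) \<inter> space M = (Y -` A \<inter> space M) \<inter> (?D -` C \<inter> space M)" by auto
    ultimately show "emeasure (distr M N Y) A * emeasure (gauss (t - s)) C
        = emeasure (distr M (N \<Otimes>\<^sub>M borel) (\<lambda>\<omega>. (Y \<omega>, ?D \<omega>))) (A \<times> C)"
      unfolding distr_increment[OF st, symmetric]
      using emeasure_distr[OF YM A] emeasure_distr[OF D C] emeasure_distr[OF YD pair_measureI[OF A C]]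
      by (simp add: emeasure_eq_measure ennreal_mult)
  qed (auto intro: Y.sigma_finite_measure_axioms G.sigma_finite_measure_axioms cong: sets_pair_measure_cong)
qed

text \<open>
  Conditioning on the past at time \<open>s\<close>: the past is frozen and the increment integrated out.
\<close>

lemma freezing:
  assumes st: "0 \<le> s" "s < t" and Y: "Y \<in> measurable (F s) N"
    and \<phi>: "case_prod \<phi> \<in> borel_measurable (N \<Otimes>\<^sub>M borel)"
    and int: "integrable M (\<lambda>\<omega>. \<phi> (Y \<omega>) (B t \<omega> - B s \<omega>) :: real)"
  shows "(LINT \<omega>|M. \<phi> (Y \<omega>) (B t \<omega> - B s \<omega>)) = (LINT \<omega>|M. LINT w|gauss (t - s). \<phi> (Y \<omega>) w)"
proof -
  note YM = measurable_of_F[OF st(1) Y]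
  interpret Y: prob_space "distr M N Y" by (rule prob_space_distr[OF YM])
  interpret G: prob_space "gauss (t - s)" using st by (intro prob_space_gauss) simp
  interpret YG: pair_prob_space "distr M N Y" "gauss (t - s)" ..
  have D: "(\<lambda>\<omega>. (Y \<omega>, B t \<omega> - B s \<omega>)) \<in> measurable M (N \<Otimes>\<^sub>M borel)"
    using YM st by (intro measurable_Pair) simp_all
  have int': "integrable (distr M N Y \<Otimes>\<^sub>M gauss (t - s)) (case_prod \<phi>)"
    unfolding distr_past_increment[OF st Y, symmetric] using int
    by (subst integrable_distr_eq[OF D \<phi>]) simp
  have "(LINT \<omega>|M. \<phi> (Y \<omega>) (B t \<omega> - B s \<omega>)) = (LINT z|(distr M N Y \<Otimes>\<^sub>M gauss (t - s)). case_prod \<phi> z)"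
    unfolding distr_past_increment[OF st Y, symmetric] by (subst integral_distr[OF D \<phi>]) simp
  also have "\<dots> = (LINT y|distr M N Y. LINT w|gauss (t - s). \<phi> y w)"
    using YG.integral_fst'[OF int'] by simp
  also have "\<dots> = (LINT \<omega>|M. LINT w|gauss (t - s). \<phi> (Y \<omega>) w)"
  proof (rule integral_distr[OF YM])
    show "(\<lambda>y. LINT w|gauss (t - s). \<phi> y w) \<in> borel_measurable N"
      using \<phi> by (intro G.borel_measurable_lebesgue_integral) (simp cong: measurable_cong_sets sets_pair_measure_cong)
  qed
  finally show ?thesis .
qed

end

section \<open>Laws of solutions as limits of the scheme\<close>

locale confined_langevin = langevin_solution M F B q x X + confining_potential q
  for M :: "'a measure" and F B q x X
begin

lemma measurable_X [measurable]: "0 \<le> t \<Longrightarrow> X t \<in> borel_measurable M"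
  using adapted_X measurable_of_F by blast

lemma measurable_implicit_scheme:
  assumes "0 \<le> s" "0 < h" "h * K \<le> 1 / 2"
  shows "(\<lambda>\<omega>. implicit_scheme h s (\<lambda>u. B u \<omega>) (X s \<omega>) k) \<in> borel_measurable (F (s + real k * h))"
proof (induction k)
  case 0
  then show ?case using adapted_X[OF assms(1)] by simp
next
  case (Suc k)
  let ?v = "s + real (Suc k) * h"
  have le: "s + real k * h \<le> ?v" "0 \<le> s + real k * h" "0 \<le> ?v" using assms by (auto simp: algebra_simps)
  have [measurable]: "B ?v \<in> borel_measurable (F ?v)" "B (s + real k * h) \<in> borel_measurable (F ?v)"
    "(\<lambda>\<omega>. implicit_scheme h s (\<lambda>u. B u \<omega>) (X s \<omega>) k) \<in> borel_measurable (F ?v)"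
    using adapted_B[OF le(3)] measurable_F_mono[OF le(1) adapted_B[OF le(2)]] measurable_F_mono[OF le(1) Suc] by auto
  have [measurable]: "implicit_step h \<in> borel_measurable borel" using measurable_implicit_step assms by simp
  show ?case unfolding implicit_scheme.simps by measurable
qed

lemma expectation_implicit_scheme:
  assumes s: "0 \<le> s" and h: "0 < h" "h * K \<le> 1 / 2"
    and "f \<in> borel_measurable borel" and "\<And>z. \<bar>f z\<bar> \<le> c"
  shows "(LINT \<omega>|M. f (implicit_scheme h s (\<lambda>u. B u \<omega>) (X s \<omega>) k)) = (LINT \<omega>|M. (Q h ^^ k) f (X s \<omega>))"
  using assms(4,5)
proof (induction k arbitrary: f)
  case 0
  then show ?case by simp
next
  case (Suc k)
  note [measurable] = Suc.prems(1)
  have [measurable]: "implicit_step h \<in> borel_measurable borel" using measurable_implicit_step h by simp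
  let ?S = "\<lambda>\<omega>. implicit_scheme h s (\<lambda>u. B u \<omega>) (X s \<omega>) k"
  let ?u = "s + real k * h" and ?v = "s + real (Suc k) * h"
  have uv: "0 \<le> ?u" "?u < ?v" "?v - ?u = h" "0 \<le> ?v" using s h by (auto simp: algebra_simps)
  have S: "?S \<in> borel_measurable (F ?u)" by (rule measurable_implicit_scheme[OF s h])
  have [measurable]: "?S \<in> borel_measurable M" using measurable_of_F[OF uv(1) S] .
  have [measurable]: "B ?u \<in> borel_measurable M" "B ?v \<in> borel_measurable M" using uv by auto
  have "(LINT \<omega>|M. f (implicit_scheme h s (\<lambda>u. B u \<omega>) (X s \<omega>) (Suc k)))
      = (LINT \<omega>|M. f (implicit_step h (?S \<omega> + sqrt 2 * (B ?v \<omega> - B ?u \<omega>))))" by simp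
  also have "\<dots> = (LINT \<omega>|M. LINT w|gauss (?v - ?u). f (implicit_step h (?S \<omega> + sqrt 2 * w)))"
  proof (rule freezing[OF uv(1,2) S])
    show "integrable M (\<lambda>\<omega>. f (implicit_step h (?S \<omega> + sqrt 2 * (B ?v \<omega> - B ?u \<omega>))))"
      by (rule integrable_const_bound[where B = c]) (use Suc.prems in \<open>auto simp del: of_nat_Suc\<close>)
  qed measurable
  also have "\<dots> = (LINT \<omega>|M. Q h f (?S \<omega>))" unfolding uv(3) Q_def ..
  also have "\<dots> = (LINT \<omega>|M. (Q h ^^ k) (Q h f) (X s \<omega>))"
    by (rule Suc.IH[OF Q_measurable[OF h Suc.prems(1)] Q_bounded[OF h Suc.prems]])
  finally show ?case by (simp add: funpow_swap1)
qed

lemma eventually_small_step: "0 < t \<Longrightarrow> \<forall>\<^sub>F n in sequentially. 0 < t / real n \<and> t / real n * K \<le> 1 / 2"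
proof -
  assume t: "0 < t"
  obtain N :: nat where N: "2 * t * K < real N" using reals_Archimedean2 by blast
  show ?thesis using eventually_ge_at_top[of "Suc N"]
  proof eventually_elim
    case (elim n)
    then have "2 * t * K < real n" "0 < real n" using N by linarith+
    then show ?case using t by (simp add: field_simps)
  qed
qed

text \<open>
  The scheme is started at time \<open>s\<close> from the solution itself.  For \<open>s = 0\<close> this identifies the law of
  the solution, for \<open>s > 0\<close> it is the Markov property.
\<close>

lemma expectation_tendsto:
  assumes s: "0 \<le> s" and t: "0 < t" and f: "continuous_on UNIV f" "\<And>z. \<bar>f z\<bar> \<le> c"
  shows "(\<lambda>n. LINT \<omega>|M. (Q (t / real n) ^^ n) f (X s \<omega>)) \<longlonglongrightarrow> (LINT \<omega>|M. f (X (s + t) \<omega>))"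
proof -
  have [measurable]: "f \<in> borel_measurable borel" by (rule borel_measurable_continuous_onI[OF f(1)])
  let ?S = "\<lambda>n \<omega>. implicit_scheme (t / real n) s (\<lambda>u. B u \<omega>) (X s \<omega>) n"
  obtain N where N: "\<And>n. N \<le> n \<Longrightarrow> 0 < t / real n \<and> t / real n * K \<le> 1 / 2"
    using eventually_small_step[OF t] unfolding eventually_sequentially by blast
  have meas: "?S n \<in> borel_measurable M" if "N \<le> n" for n
    using measurable_of_F[OF _ measurable_implicit_scheme[OF s, of "t / real n" n]] N[OF that] s t by simp
  have "(\<lambda>n. LINT \<omega>|M. f (?S (n + N) \<omega>)) \<longlonglongrightarrow> (LINT \<omega>|M. f (X (s + t) \<omega>))"
  proof (rule integral_dominated_convergence[where w = "\<lambda>_. c"])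
    show "AE \<omega> in M. (\<lambda>n. f (?S (n + N) \<omega>)) \<longlonglongrightarrow> f (X (s + t) \<omega>)"
      using continuous_X X_sde
    proof eventually_elim
      case (elim \<omega>)
      have "(\<lambda>n. ?S n \<omega>) \<longlonglongrightarrow> X (s + t) \<omega>"
      proof (rule implicit_scheme_tendsto[OF s t])
        show "X u \<omega> = X 0 \<omega> + sqrt 2 * B u \<omega> - integral {0..u} (\<lambda>v. q1 (X v \<omega>))" if "0 \<le> u" for u
          using elim(2) that by blast
      qed (rule elim(1))
      then have "(\<lambda>n. f (?S n \<omega>)) \<longlonglongrightarrow> f (X (s + t) \<omega>)"
        by (rule continuous_on_tendsto_compose[OF f(1)]) auto
      then show ?case by (rule LIMSEQ_ignore_initial_segment)
    qed
    show "(\<lambda>\<omega>. f (?S (n + N) \<omega>)) \<in> borel_measurable M" for n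
      using meas[of "n + N"] by (intro measurable_compose[OF meas]) auto
  qed (use s t f in auto)
  also have "(\<lambda>n. LINT \<omega>|M. f (?S (n + N) \<omega>)) = (\<lambda>n. LINT \<omega>|M. (Q (t / real (n + N)) ^^ (n + N)) f (X s \<omega>))"
    proof
    fix n
    show "(LINT \<omega>|M. f (?S (n + N) \<omega>)) = (LINT \<omega>|M. (Q (t / real (n + N)) ^^ (n + N)) f (X s \<omega>))"
      using N[of "n + N"] by (intro expectation_implicit_scheme[OF s _ _ _ f(2)]) simp_all
  qed
  finally show ?thesis by (rule LIMSEQ_offset)
qed

lemma expectation_tendsto_start:
  assumes t: "0 < t" and f: "continuous_on UNIV f" "\<And>z. \<bar>f z\<bar> \<le> c"
  shows "(\<lambda>n. (Q (t / real n) ^^ n) f x) \<longlonglongrightarrow> (LINT \<omega>|M. f (X t \<omega>))"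
proof -
  have [measurable]: "f \<in> borel_measurable borel" by (rule borel_measurable_continuous_onI[OF f(1)])
  have lim: "(\<lambda>n. LINT \<omega>|M. (Q (t / real n) ^^ n) f (X 0 \<omega>)) \<longlonglongrightarrow> (LINT \<omega>|M. f (X t \<omega>))"
    using expectation_tendsto[of 0 t f c] t f by simp
  have "\<forall>\<^sub>F n in sequentially. (LINT \<omega>|M. (Q (t / real n) ^^ n) f (X 0 \<omega>)) = (Q (t / real n) ^^ n) f x"
    using eventually_small_step[OF t]
  proof eventually_elim
    case (elim n)
    have [measurable]: "(Q (t / real n) ^^ n) f \<in> borel_measurable borel"
      using elim by (intro funpow_Q_measurable) auto
    have "(LINT \<omega>|M. (Q (t / real n) ^^ n) f (X 0 \<omega>)) = (LINT \<omega>|M. (Q (t / real n) ^^ n) f x)"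
      using X_0 by (intro integral_cong_AE) (auto elim: eventually_mono)
    then show ?case by (simp add: prob_space)
  qed
  with lim show ?thesis by (rule Lim_transform_eventually)
qed

end

locale langevin_family = confining_potential q
  for q :: "real \<Rightarrow> real" +
  fixes M :: "real \<Rightarrow> 'a measure"
    and F :: "real \<Rightarrow> real \<Rightarrow> 'a measure"
    and B X :: "real \<Rightarrow> real \<Rightarrow> 'a \<Rightarrow> real"
  assumes solution: "\<And>x. langevin_solution (M x) (F x) (B x) q x (X x)"
begin

lemma confined: "confined_langevin (M x) (F x) (B x) q x (X x)"
  by (intro confined_langevin.intro solution) unfold_locales

text \<open>
  Expectations of functions of the solution started at \<open>x\<close>; different starting points may live on
  different probability spaces.
\<close>

definition P :: "real \<Rightarrow> (real \<Rightarrow> real) \<Rightarrow> real \<Rightarrow> real" where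
  "P t f x = (LINT \<omega>|M x. f (X x t \<omega>))"

lemma P_tendsto:
  assumes "0 < t" and "continuous_on UNIV f" "\<And>z. \<bar>f z\<bar> \<le> c"
  shows "(\<lambda>n. (Q (t / real n) ^^ n) f x) \<longlonglongrightarrow> P t f x"
proof -
  interpret confined_langevin "M x" "F x" "B x" q x "X x" by (rule confined)
  show ?thesis unfolding P_def by (rule expectation_tendsto_start[OF assms])
qed

lemma P_0:
  assumes [measurable]: "f \<in> borel_measurable borel"
  shows "P 0 f x = f x"
proof -
  interpret confined_langevin "M x" "F x" "B x" q x "X x" by (rule confined)
  have "P 0 f x = (LINT \<omega>|M x. f x)"
    unfolding P_def using X_0 by (intro integral_cong_AE) (auto elim: eventually_mono)
  then show ?thesis by (simp add: prob_space)
qed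

lemma eventually_small_step':
  "0 < t \<Longrightarrow> \<forall>\<^sub>F n in sequentially. 0 < t / real n \<and> t / real n * K \<le> 1 / 2 \<and> real n * (t / real n) = t"
proof -
  interpret confined_langevin "M 0" "F 0" "B 0" q 0 "X 0" by (rule confined)
  assume "0 < t"
  from eventually_small_step[OF this] show ?thesis by eventually_elim (auto simp: zero_less_divide_iff)
qed

lemma P_bounded:
  assumes "0 \<le> t" "f \<in> borel_measurable borel" "\<And>z. \<bar>f z\<bar> \<le> c"
  shows "\<bar>P t f x\<bar> \<le> c"
proof -
  interpret confined_langevin "M x" "F x" "B x" q x "X x" by (rule confined)
  note [measurable] = assms(2)
  have X: "X x t \<in> borel_measurable (M x)" using measurable_X assms(1) .
  note [measurable] = X
  have i: "integrable (M x) (\<lambda>\<omega>. f (X x t \<omega>))"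
    by (rule integrable_const_bound[where B = c]) (use assms(3) in auto)
  have "\<bar>P t f x\<bar> \<le> (LINT \<omega>|M x. \<bar>f (X x t \<omega>)\<bar>)" unfolding P_def by (rule integral_abs_bound)
  also have "\<dots> \<le> (LINT \<omega>|M x. c)" using i assms(3) by (intro integral_mono) auto
  finally show ?thesis by (simp add: prob_space)
qed

text \<open>
  One step of the scheme is monotone, iterates are too, and the property survives the limit.  This
  replaces a coupling of the solutions started at \<open>x\<close> and \<open>y\<close>.
\<close>

lemma P_mono:
  assumes "0 \<le> t" "continuous_on UNIV f" "mono f" "\<And>z. \<bar>f z\<bar> \<le> c"
  shows "mono (P t f)"
proof (cases "t = 0")
  case True
  have "P 0 f = f" by (intro ext P_0 borel_measurable_mono assms(3))
  then show ?thesis using True assms(3) by simp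
next
  case False
  then have t: "0 < t" using assms(1) by simp
  show ?thesis
  proof (rule monoI)
    fix x y :: real assume "x \<le> y"
    show "P t f x \<le> P t f y"
      using eventually_small_step'[OF t]
      by (intro tendsto_le[OF _ P_tendsto[OF t assms(2,4)] P_tendsto[OF t assms(2,4)]])
         (auto elim!: eventually_mono intro!: monoD[OF funpow_Q_mono[OF _ _ assms(3,4)] \<open>x \<le> y\<close>])
  qed
qed

lemma P_Lipschitz:
  assumes "0 \<le> t" "\<And>z z'. \<bar>f z - f z'\<bar> \<le> L * \<bar>z - z'\<bar>" "continuous_on UNIV f" "\<And>z. \<bar>f z\<bar> \<le> c"
  shows "\<bar>P t f z - P t f z'\<bar> \<le> (exp (2 * K * t) * L) * \<bar>z - z'\<bar>"
proof (cases "t = 0")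
  case True
  have "P 0 f = f" by (intro ext P_0 borel_measurable_continuous_onI assms(3))
  then show ?thesis using True assms(2) by simp
next
  case False
  then have t: "0 < t" using assms(1) by simp
  have [measurable]: "f \<in> borel_measurable borel" by (rule borel_measurable_continuous_onI[OF assms(3)])
  have "(\<lambda>n. \<bar>(Q (t / real n) ^^ n) f z - (Q (t / real n) ^^ n) f z'\<bar>) \<longlonglongrightarrow> \<bar>P t f z - P t f z'\<bar>"
    by (intro tendsto_intros P_tendsto[OF t assms(3,4)])
  then show ?thesis
  proof (rule tendsto_upperbound)
    show "\<forall>\<^sub>F n in sequentially. \<bar>(Q (t / real n) ^^ n) f z - (Q (t / real n) ^^ n) f z'\<bar> \<le> (exp (2 * K * t) * L) * \<bar>z - z'\<bar>"
      using eventually_small_step'[OF t]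
    proof eventually_elim
      case (elim n)
      then show ?case using funpow_Q_Lipschitz[of "t / real n" f L c n z z'] assms by simp
    qed
  qed simp
qed

lemma P_markov:
  assumes "0 \<le> s" "0 \<le> t" "continuous_on UNIV f" "\<And>z. \<bar>f z\<bar> \<le> c"
  shows "P s (P t f) x = P (s + t) f x"
proof (cases "t = 0")
  case True
  have "P 0 f = f" by (intro ext P_0 borel_measurable_continuous_onI assms(3))
  then show ?thesis using True by simp
next
  case False
  then have t: "0 < t" using assms(2) by simp
  interpret confined_langevin "M x" "F x" "B x" q x "X x" by (rule confined)
  have mf [measurable]: "f \<in> borel_measurable borel" by (rule borel_measurable_continuous_onI[OF assms(3)])
  have X: "X x s \<in> borel_measurable (M x)" using measurable_X assms(1) .
  obtain N where N: "\<And>n. N \<le> n \<Longrightarrow> 0 < t / real n \<and> t / real n * K \<le> 1 / 2"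
    using eventually_small_step[OF t] unfolding eventually_sequentially by blast
  let ?f = "\<lambda>n. (Q (t / real (n + N)) ^^ (n + N)) f"
  have m: "?f n \<in> borel_measurable borel" for n using N[of "n + N"] by (intro funpow_Q_measurable mf) auto
  have b: "\<bar>?f n z\<bar> \<le> c" for n z using N[of "n + N"] by (intro funpow_Q_bounded mf assms(4)) auto
  have lim: "(\<lambda>n. ?f n z) \<longlonglongrightarrow> P t f z" for z
    using LIMSEQ_ignore_initial_segment[OF P_tendsto[OF t assms(3,4)], of N] .
  have mP: "P t f \<in> borel_measurable borel"
    by (rule borel_measurable_LIMSEQ_real[OF lim m])
  have "(\<lambda>n. LINT \<omega>|M x. ?f n (X x s \<omega>)) \<longlonglongrightarrow> (LINT \<omega>|M x. P t f (X x s \<omega>))"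
    by (rule integral_dominated_convergence[where w = "\<lambda>_. c"])
       (use lim b in \<open>auto intro!: measurable_compose[OF X m] measurable_compose[OF X mP] simp del: of_nat_add\<close>)
  moreover have "(\<lambda>n. LINT \<omega>|M x. ?f n (X x s \<omega>)) \<longlonglongrightarrow> (LINT \<omega>|M x. f (X x (s + t) \<omega>))"
    using LIMSEQ_ignore_initial_segment[OF expectation_tendsto[OF assms(1) t assms(3,4)], of N] .
  ultimately show ?thesis unfolding P_def[of s] P_def[of "s + t"] by (rule LIMSEQ_unique)
qed

end

section \<open>Test functions and Gaussian smoothing\<close>

text \<open>
  Boundedness in \<open>L\<^sup>2\<close> makes truncation at height \<open>R\<close> cost at most \<open>C / R\<close>, uniformly in \<open>n\<close> and in the
  limit; truncated variables converge by dominated convergence.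
\<close>

lemma (in prob_space) expectation_zero_of_L2_bounded_limit:
  fixes Z :: "nat \<Rightarrow> 'a \<Rightarrow> real" and Y :: "'a \<Rightarrow> real"
  assumes lim: "AE \<omega> in M. (\<lambda>n. Z n \<omega>) \<longlonglongrightarrow> Y \<omega>"
    and [measurable]: "\<And>n. Z n \<in> borel_measurable M" "Y \<in> borel_measurable M"
    and int2: "\<And>n. integrable M (\<lambda>\<omega>. (Z n \<omega>)\<^sup>2)" and le: "\<And>n. expectation (\<lambda>\<omega>. (Z n \<omega>)\<^sup>2) \<le> C"
    and mean: "\<And>n. expectation (Z n) = 0"
  shows "integrable M Y" "expectation Y = 0"
proof -
  have C: "0 \<le> C" by (rule order.trans[OF _ le[of 0]]) simp
  have "(\<integral>\<^sup>+\<omega>. ennreal ((Y \<omega>)\<^sup>2) \<partial>M) = (\<integral>\<^sup>+\<omega>. liminf (\<lambda>n. ennreal ((Z n \<omega>)\<^sup>2)) \<partial>M)"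
    using lim
  proof (intro nn_integral_cong_AE, eventually_elim)
    case (elim \<omega>)
    have "(\<lambda>n. ennreal ((Z n \<omega>)\<^sup>2)) \<longlonglongrightarrow> ennreal ((Y \<omega>)\<^sup>2)"
      using elim by (intro tendsto_intros)
    then show ?case using lim_imp_Liminf[OF sequentially_bot] by metis
  qed
  also have "\<dots> \<le> liminf (\<lambda>n. \<integral>\<^sup>+\<omega>. ennreal ((Z n \<omega>)\<^sup>2) \<partial>M)"
    by (rule nn_integral_liminf) measurable
  also have "\<dots> \<le> ennreal C"
  proof -
    have "(\<integral>\<^sup>+\<omega>. ennreal ((Z n \<omega>)\<^sup>2) \<partial>M) \<le> ennreal C" for n
      using nn_integral_eq_integral[OF int2[of n]] le[of n] by (simp add: ennreal_leI)
    then show ?thesis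
      by (intro Liminf_le) auto
  qed
  finally have fatou: "(\<integral>\<^sup>+\<omega>. ennreal ((Y \<omega>)\<^sup>2) \<partial>M) \<le> ennreal C" .
  have intY2: "integrable M (\<lambda>\<omega>. (Y \<omega>)\<^sup>2)"
    using fatou by (intro integrableI_bounded) (auto intro: le_less_trans)
  have Y2: "expectation (\<lambda>\<omega>. (Y \<omega>)\<^sup>2) \<le> C"
    using fatou nn_integral_eq_integral[OF intY2] C by (simp add: ennreal_le_iff)
  show intY: "integrable M Y" by (rule square_integrable_imp_integrable[OF _ intY2]) simp
  have intZ: "integrable M (Z n)" for n by (rule square_integrable_imp_integrable[OF _ int2]) simp
  define \<tau> where "\<tau> R z = max (- R) (min R z)" for R z :: real
  have [measurable]: "\<tau> R \<in> borel_measurable borel" for R unfolding \<tau>_def[abs_def] by measurable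
  have \<tau>_bd: "\<bar>\<tau> R z\<bar> \<le> R" if "0 < R" for R z using that by (auto simp: \<tau>_def)
  have \<tau>_err: "\<bar>z - \<tau> R z\<bar> \<le> z\<^sup>2 / R" if R: "0 < R" for R z
  proof (cases "\<bar>z\<bar> \<le> R")
    case True
    then show ?thesis using R by (auto simp: \<tau>_def)
  next
    case False
    then have "\<bar>z\<bar> * R \<le> \<bar>z\<bar> * \<bar>z\<bar>" using R by (intro mult_left_mono) auto
    then have "\<bar>z\<bar> \<le> z\<^sup>2 / R" using R by (simp add: field_simps power2_eq_square)
    moreover have "\<bar>z - \<tau> R z\<bar> \<le> \<bar>z\<bar>" using False R by (auto simp: \<tau>_def)
    ultimately show ?thesis by linarith
  qed
  have int\<tau>: "integrable M (\<lambda>\<omega>. \<tau> R (W \<omega>))" if "0 < R" "W \<in> borel_measurable M" for R W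
    by (rule integrable_const_bound[where B = R]) (use that \<tau>_bd in auto)
  have err: "\<bar>expectation W - expectation (\<lambda>\<omega>. \<tau> R (W \<omega>))\<bar> \<le> C / R"
    if R: "0 < R" and W: "W \<in> borel_measurable M" "integrable M W" "integrable M (\<lambda>\<omega>. (W \<omega>)\<^sup>2)"
      "expectation (\<lambda>\<omega>. (W \<omega>)\<^sup>2) \<le> C" for R W
  proof -
    have "\<bar>expectation W - expectation (\<lambda>\<omega>. \<tau> R (W \<omega>))\<bar> = \<bar>expectation (\<lambda>\<omega>. W \<omega> - \<tau> R (W \<omega>))\<bar>"
      by (simp add: Bochner_Integration.integral_diff[OF W(2) int\<tau>[OF R W(1)]])
    also have "\<dots> \<le> expectation (\<lambda>\<omega>. \<bar>W \<omega> - \<tau> R (W \<omega>)\<bar>)" by (rule integral_abs_bound)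
    also have "\<dots> \<le> expectation (\<lambda>\<omega>. (W \<omega>)\<^sup>2 / R)"
      using W(3) \<tau>_err[OF R] by (intro integral_mono integrable_abs Bochner_Integration.integrable_diff W(2) int\<tau>[OF R W(1)]) auto
    also have "\<dots> \<le> C / R" using W(4) R by (simp add: divide_right_mono)
    finally show ?thesis .
  qed
  have bound: "\<bar>expectation Y\<bar> \<le> 2 * C / R" if R: "0 < R" for R
  proof -
    have "(\<lambda>n. \<bar>expectation (\<lambda>\<omega>. \<tau> R (Z n \<omega>))\<bar>) \<longlonglongrightarrow> \<bar>expectation (\<lambda>\<omega>. \<tau> R (Y \<omega>))\<bar>"
    proof (intro tendsto_rabs integral_dominated_convergence[where w = "\<lambda>_. R"])
      show "AE \<omega> in M. (\<lambda>n. \<tau> R (Z n \<omega>)) \<longlonglongrightarrow> \<tau> R (Y \<omega>)"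
        using lim by eventually_elim (auto simp: \<tau>_def intro!: tendsto_intros)
    qed (use \<tau>_bd[OF R] in auto)
    moreover have "\<bar>expectation (\<lambda>\<omega>. \<tau> R (Z n \<omega>))\<bar> \<le> C / R" for n
      using err[OF R, of "Z n"] intZ int2 le mean by simp
    ultimately have "\<bar>expectation (\<lambda>\<omega>. \<tau> R (Y \<omega>))\<bar> \<le> C / R"
      by (intro LIMSEQ_le_const2) auto
    then show ?thesis using err[OF R, of Y] intY intY2 Y2 by simp
  qed
  show "expectation Y = 0"
  proof (rule ccontr)
    assume "expectation Y \<noteq> 0"
    then have pos: "0 < \<bar>expectation Y\<bar>" by simp
    define R where "R = (2 * C + 1) / \<bar>expectation Y\<bar>"
    have "0 < R" using pos C by (simp add: R_def)
    from bound[OF this] have "\<bar>expectation Y\<bar> * R \<le> 2 * C" using \<open>0 < R\<close> by (simp add: field_simps)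
    then show False using pos by (simp add: R_def)
  qed
qed

definition bounded_C2 :: "(real \<Rightarrow> real) \<Rightarrow> (real \<Rightarrow> real) \<Rightarrow> (real \<Rightarrow> real) \<Rightarrow> real \<Rightarrow> bool" where
  "bounded_C2 f f1 f2 b \<longleftrightarrow>
     (\<forall>x. (f has_real_derivative f1 x) (at x)) \<and> (\<forall>x. (f1 has_real_derivative f2 x) (at x)) \<and>
     continuous_on UNIV f2 \<and> (\<forall>x. \<bar>f1 x\<bar> \<le> b) \<and> (\<forall>x. \<bar>f2 x\<bar> \<le> b)"

definition heat :: "real \<Rightarrow> (real \<Rightarrow> real) \<Rightarrow> real \<Rightarrow> real" where
  "heat h f x = (LINT w|gauss h. f (x + sqrt 2 * w))"

context
  fixes f f1 f2 :: "real \<Rightarrow> real" and b :: real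
  assumes C2: "bounded_C2 f f1 f2 b"
begin

lemma C2_DERIV: "(f has_real_derivative f1 x) (at x)" "(f1 has_real_derivative f2 x) (at x)"
  and C2_cont2: "continuous_on UNIV f2"
  and C2_bound: "\<bar>f1 x\<bar> \<le> b" "\<bar>f2 x\<bar> \<le> b"
  using C2 unfolding bounded_C2_def by auto

lemma C2_cont: "continuous_on UNIV f" "continuous_on UNIV f1"
  by (meson C2_DERIV DERIV_isCont continuous_at_imp_continuous_on)+

lemma C2_nonneg: "0 \<le> b" using C2_bound(1)[of 0] by linarith

lemma C2_mean_value:
  "\<exists>\<eta>. \<bar>\<eta> - u\<bar> \<le> \<bar>u - v\<bar> \<and> f u - f v = f1 \<eta> * (u - v)"
proof (cases u v rule: linorder_cases)
  case less
  then obtain z where "u < z" "z < v" "f v - f u = (v - u) * f1 z"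
    using MVT2[OF less C2_DERIV(1)] by blast
  then show ?thesis by (intro exI[of _ z]) (auto simp: algebra_simps)
next
  case equal
  then show ?thesis by auto
next
  case greater
  then obtain z where "v < z" "z < u" "f u - f v = (u - v) * f1 z"
    using MVT2[OF greater C2_DERIV(1)] by blast
  then show ?thesis by (intro exI[of _ z]) (auto simp: algebra_simps)
qed

lemma C2_Lipschitz: "\<bar>f u - f v\<bar> \<le> b * \<bar>u - v\<bar>"
proof -
  obtain \<eta> where "f u - f v = f1 \<eta> * (u - v)" using C2_mean_value by blast
  then show ?thesis using C2_bound(1)[of \<eta>] by (simp add: abs_mult mult_right_mono)
qed

lemma C2_Lipschitz1: "\<bar>f1 u - f1 v\<bar> \<le> b * \<bar>u - v\<bar>"
proof -
  have *: "\<bar>f1 u - f1 v\<bar> \<le> b * \<bar>u - v\<bar>" if lt: "v < u" for u v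
  proof -
    obtain z where "f1 u - f1 v = (u - v) * f2 z"
      using MVT2[OF lt, of f1 f2] C2_DERIV(2) by blast
    then show ?thesis using C2_bound(2)[of z] by (simp add: abs_mult mult_right_mono mult.commute[of b] mult_left_mono)
  qed
  show ?thesis using *[of u v] *[of v u] by (cases u v rule: linorder_cases) (auto simp: abs_minus_commute)
qed

lemma C2_Taylor: "\<exists>\<xi>. \<bar>\<xi> - x\<bar> \<le> \<bar>z\<bar> \<and> f (x + z) = f x + f1 x * z + f2 \<xi> * z\<^sup>2 / 2"
proof -
  define d :: "nat \<Rightarrow> real \<Rightarrow> real" where
    "d m = (if m = 0 then (\<lambda>z. f (x + z)) else if m = 1 then (\<lambda>z. f1 (x + z)) else (\<lambda>z. f2 (x + z)))" for m
  have shift: "((\<lambda>z. g (x + z)) has_real_derivative g') (at t)" if "(g has_real_derivative g') (at (x + t))" for g g' t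
    using that DERIV_at_within_shift[of g g' x t UNIV] by simp
  have "\<exists>t. \<bar>t\<bar> \<le> \<bar>z\<bar> \<and> f (x + z) = (\<Sum>m<2. d m 0 / fact m * z ^ m) + d 2 t / fact 2 * z ^ 2"
  proof (rule Maclaurin_bi_le)
    show "d 0 = (\<lambda>z. f (x + z))" by (simp add: d_def)
    show "\<forall>m t. m < 2 \<and> \<bar>t\<bar> \<le> \<bar>z\<bar> \<longrightarrow> (d m has_real_derivative d (Suc m) t) (at t)"
      by (auto simp: d_def less_2_cases_iff intro!: shift C2_DERIV)
  qed
  then obtain t where "\<bar>t\<bar> \<le> \<bar>z\<bar>" "f (x + z) = (\<Sum>m<2. d m 0 / fact m * z ^ m) + d 2 t / fact 2 * z ^ 2" by blast
  then show ?thesis by (intro exI[of _ "x + t"]) (auto simp: d_def numeral_2_eq_2)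
qed

text \<open>
  A second-order Taylor expansion.  Where the noise exceeds \<open>\<delta>\<close> the continuity of \<open>f''\<close> is of no use,
  but there \<open>1 \<le> 2 w\<^sup>2 / \<delta>\<^sup>2\<close>, and the fourth moment supplies a factor \<open>h\<^sup>2\<close>.
\<close>

lemma heat_expansion:
  assumes h: "0 < h" and \<delta>: "0 < \<delta>" and osc: "\<And>\<xi>. \<bar>\<xi> - x\<bar> \<le> \<delta> \<Longrightarrow> \<bar>f2 \<xi> - f2 x\<bar> \<le> \<epsilon>"
  shows "\<bar>heat h f x - f x - h * f2 x\<bar> \<le> h * (\<epsilon> + 12 * b * h / \<delta>\<^sup>2)"
proof -
  interpret G: prob_space "gauss h" by (rule prob_space_gauss[OF h])
  have [measurable]: "f \<in> borel_measurable borel" by (rule borel_measurable_continuous_onI[OF C2_cont(1)])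
  have \<epsilon>: "0 \<le> \<epsilon>" using osc[of x] \<delta> by simp
  define r where "r w = f (x + sqrt 2 * w) - (f x + (sqrt 2 * f1 x) * w + f2 x * w\<^sup>2)" for w
  have [measurable]: "r \<in> borel_measurable borel" unfolding r_def[abs_def] by measurable
  have r_le: "\<bar>r w\<bar> \<le> \<epsilon> * w\<^sup>2 + 4 * b / \<delta>\<^sup>2 * w ^ 4" for w
  proof -
    obtain \<xi> where \<xi>: "\<bar>\<xi> - x\<bar> \<le> \<bar>sqrt 2 * w\<bar>" "f (x + sqrt 2 * w) = f x + f1 x * (sqrt 2 * w) + f2 \<xi> * (sqrt 2 * w)\<^sup>2 / 2"
      using C2_Taylor by blast
    have r: "\<bar>r w\<bar> = \<bar>f2 \<xi> - f2 x\<bar> * w\<^sup>2"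
    proof -
      have "r w = (f2 \<xi> - f2 x) * w\<^sup>2"
        by (simp add: r_def \<xi>(2) power_mult_distrib left_diff_distrib)
      then show ?thesis by (simp add: abs_mult)
    qed
    show ?thesis
    proof (cases "\<bar>\<xi> - x\<bar> \<le> \<delta>")
      case True
      have "\<bar>r w\<bar> \<le> \<epsilon> * w\<^sup>2" unfolding r by (intro mult_right_mono osc True) auto
      moreover have "0 \<le> 4 * b / \<delta>\<^sup>2 * w ^ 4" using C2_nonneg by simp
      ultimately show ?thesis by linarith
    next
      case False
      have "\<delta>\<^sup>2 \<le> (\<bar>sqrt 2 * w\<bar>)\<^sup>2" using False \<xi>(1) \<delta> by (intro power_mono) auto
      then have "1 \<le> 2 * w\<^sup>2 / \<delta>\<^sup>2" using \<delta> by (simp add: power_mult_distrib)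
      moreover have "\<bar>f2 \<xi> - f2 x\<bar> \<le> 2 * b" using C2_bound(2)[of \<xi>] C2_bound(2)[of x] by linarith
      ultimately have "\<bar>f2 \<xi> - f2 x\<bar> * 1 \<le> (2 * b) * (2 * w\<^sup>2 / \<delta>\<^sup>2)" using C2_nonneg by (intro mult_mono) auto
      then have "\<bar>r w\<bar> \<le> ((2 * b) * (2 * w\<^sup>2 / \<delta>\<^sup>2)) * w\<^sup>2" unfolding r by (intro mult_right_mono) auto
      also have "\<dots> = 4 * b / \<delta>\<^sup>2 * w ^ 4" by (simp add: power2_eq_square power4_eq_xxxx)
      finally show ?thesis using \<epsilon> by (simp add: add_increasing)
    qed
  qed
  note i = integrable_gauss_power[OF h]
  have i1: "integrable (gauss h) (\<lambda>w. w)" using i[of 1] by simp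
  have ib: "integrable (gauss h) (\<lambda>w. \<epsilon> * w\<^sup>2 + 4 * b / \<delta>\<^sup>2 * w ^ 4)" by (intro Bochner_Integration.integrable_add integrable_mult_right i)
  have ir: "integrable (gauss h) r"
    by (rule Bochner_Integration.integrable_bound[OF ib]) (use r_le order.trans[OF r_le abs_ge_self] in \<open>auto\<close>)
  have "heat h f x = (LINT w|gauss h. (f x + (sqrt 2 * f1 x) * w + f2 x * w\<^sup>2) + r w)"
    unfolding heat_def r_def by simp
  also have "\<dots> = (f x + f2 x * h) + (LINT w|gauss h. r w)"
    using i1 i[of 2] ir integral_gauss[OF h] G.prob_space
    by (simp add: Bochner_Integration.integral_add)
  finally have "\<bar>heat h f x - f x - h * f2 x\<bar> = \<bar>LINT w|gauss h. r w\<bar>" by (simp add: algebra_simps)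
  also have "\<dots> \<le> (LINT w|gauss h. \<bar>r w\<bar>)" by (rule integral_abs_bound)
  also have "\<dots> \<le> (LINT w|gauss h. \<epsilon> * w\<^sup>2 + 4 * b / \<delta>\<^sup>2 * w ^ 4)"
    by (intro integral_mono integrable_abs ir ib r_le)
  also have "\<dots> = \<epsilon> * h + 4 * b / \<delta>\<^sup>2 * (3 * h\<^sup>2)"
    using i[of 2] i[of 4] integral_gauss[OF h] by (simp add: Bochner_Integration.integral_add)
  also have "\<dots> = h * (\<epsilon> + 12 * b * h / \<delta>\<^sup>2)" by (simp add: algebra_simps power2_eq_square)
  finally show ?thesis .
qed

lemma integrable_gauss_shift:
  assumes h: "0 < h"
  shows "integrable (gauss h) (\<lambda>w. f (x + sqrt 2 * w))"
proof -
  interpret G: prob_space "gauss h" by (rule prob_space_gauss[OF h])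
  have [measurable]: "f \<in> borel_measurable borel" by (rule borel_measurable_continuous_onI[OF C2_cont(1)])
  have i: "integrable (gauss h) (\<lambda>w. \<bar>f x\<bar> + b * sqrt 2 * \<bar>w\<bar>)"
    using integrable_abs[OF integrable_gauss_power[OF h, of 1]] by simp
  show ?thesis
  proof (rule Bochner_Integration.integrable_bound[OF i])
    show "AE w in gauss h. norm (f (x + sqrt 2 * w)) \<le> norm (\<bar>f x\<bar> + b * sqrt 2 * \<bar>w\<bar>)"
    proof (rule AE_I2)
      fix w
      have "\<bar>f (x + sqrt 2 * w) - f x\<bar> \<le> b * sqrt 2 * \<bar>w\<bar>"
        using C2_Lipschitz[of "x + sqrt 2 * w" x] by (simp add: abs_mult mult.assoc)
      then show "norm (f (x + sqrt 2 * w)) \<le> norm (\<bar>f x\<bar> + b * sqrt 2 * \<bar>w\<bar>)"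
        unfolding real_norm_def by linarith
    qed
  qed measurable
qed

text \<open>
  A pointwise bound with mean of order \<open>h\<close>, so that about \<open>t / h\<close> uncorrelated terms of this kind have
  a sum bounded in \<open>L\<^sup>2\<close>.
\<close>

lemma heat_noise_bound:
  assumes h: "0 < h"
  shows "(f (x + sqrt 2 * w) - heat h f x)\<^sup>2 \<le> 4 * b\<^sup>2 * (w\<^sup>2 + h)"
proof -
  interpret G: prob_space "gauss h" by (rule prob_space_gauss[OF h])
  note i = integrable_gauss_power[OF h]
  have sq: "\<bar>v\<bar> \<le> (v\<^sup>2 / sqrt h + sqrt h) / 2" for v
  proof -
    have "0 \<le> (\<bar>v\<bar> - sqrt h)\<^sup>2" by simp
    then have "2 * \<bar>v\<bar> * sqrt h \<le> v\<^sup>2 + h" using h by (simp add: power2_diff)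
    then have "\<bar>v\<bar> \<le> (v\<^sup>2 + h) / (2 * sqrt h)" using h by (simp add: field_simps)
    also have "\<dots> = (v\<^sup>2 / sqrt h + sqrt h) / 2" using h by (simp add: field_simps)
    finally show ?thesis .
  qed
  have "\<bar>heat h f x - f x\<bar> = \<bar>LINT v|gauss h. f (x + sqrt 2 * v) - f x\<bar>"
    unfolding heat_def using integrable_gauss_shift[OF h] G.prob_space
    by (simp add: Bochner_Integration.integral_diff)
  also have "\<dots> \<le> (LINT v|gauss h. \<bar>f (x + sqrt 2 * v) - f x\<bar>)" by (rule integral_abs_bound)
  also have "\<dots> \<le> (LINT v|gauss h. b * sqrt 2 * ((v\<^sup>2 / sqrt h + sqrt h) / 2))"
  proof (rule integral_mono)
    show "integrable (gauss h) (\<lambda>v. \<bar>f (x + sqrt 2 * v) - f x\<bar>)"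
      using integrable_gauss_shift[OF h] by simp
    show "integrable (gauss h) (\<lambda>v. b * sqrt 2 * ((v\<^sup>2 / sqrt h + sqrt h) / 2))"
      using i[of 2] by simp
    show "\<bar>f (x + sqrt 2 * v) - f x\<bar> \<le> b * sqrt 2 * ((v\<^sup>2 / sqrt h + sqrt h) / 2)" for v
    proof -
      have "\<bar>f (x + sqrt 2 * v) - f x\<bar> \<le> (b * sqrt 2) * \<bar>v\<bar>"
        using C2_Lipschitz[of "x + sqrt 2 * v" x] by (simp add: abs_mult mult.assoc)
      also have "\<dots> \<le> (b * sqrt 2) * ((v\<^sup>2 / sqrt h + sqrt h) / 2)"
        using C2_nonneg sq by (intro mult_left_mono) auto
      finally show ?thesis .
    qed
  qed
  also have "\<dots> = b * sqrt 2 * sqrt h"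
    using i[of 2] integral_gauss[OF h] G.prob_space h
    by (simp add: Bochner_Integration.integral_add real_div_sqrt)
  finally have 1: "\<bar>heat h f x - f x\<bar> \<le> b * sqrt 2 * sqrt h" .
  have 2: "\<bar>f (x + sqrt 2 * w) - f x\<bar> \<le> b * sqrt 2 * \<bar>w\<bar>"
    using C2_Lipschitz[of "x + sqrt 2 * w" x] by (simp add: abs_mult mult.assoc)
  have "\<bar>f (x + sqrt 2 * w) - heat h f x\<bar> \<le> b * sqrt 2 * (\<bar>w\<bar> + sqrt h)"
    using 1 2 by (simp add: distrib_left)
  then have "(\<bar>f (x + sqrt 2 * w) - heat h f x\<bar>)\<^sup>2 \<le> (b * sqrt 2 * (\<bar>w\<bar> + sqrt h))\<^sup>2" by (rule power_mono) simp
  also have "\<dots> = 2 * b\<^sup>2 * (\<bar>w\<bar> + sqrt h)\<^sup>2" by (simp add: power_mult_distrib)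
  also have "\<dots> \<le> 2 * b\<^sup>2 * (2 * (w\<^sup>2 + h))"
  proof (rule mult_left_mono)
    have "0 \<le> (\<bar>w\<bar> - sqrt h)\<^sup>2" by simp
    then show "(\<bar>w\<bar> + sqrt h)\<^sup>2 \<le> 2 * (w\<^sup>2 + h)" using h by (simp add: power2_diff power2_sum)
  qed simp
  also have "\<dots> = 4 * b\<^sup>2 * (w\<^sup>2 + h)" by simp
  finally show ?thesis by simp
qed

end

context confining_potential
begin

section \<open>Dynkin's formula\<close>

text \<open>
  The arguments are the first and second derivatives of the test function.
\<close>

definition generator :: "(real \<Rightarrow> real) \<Rightarrow> (real \<Rightarrow> real) \<Rightarrow> real \<Rightarrow> real" where
  "generator f1 f2 x = f2 x - q1 x * f1 x"

text \<open>
  Over one step of the grid let \<open>z\<close> be the old position plus the noise alone.  Then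
  \<open>f (new) - f (old) = (f (new) - f z) + (f z - heat f (old)) + (heat f (old) - f (old))\<close>.  The first
  bracket is the effect of the drift, about \<open>- \<integral> q' f'\<close>; the last one is about \<open>h f''\<close>.  Both
  hold up to \<open>o(h)\<close> along a fixed continuous path, so the sum of the middle terms converges.
\<close>

lemma noise_sum_tendsto:
  assumes C2: "bounded_C2 f f1 f2 b" and t: "0 < t"
    and cont: "continuous_on {0..} y"
    and eq: "\<And>u. 0 \<le> u \<Longrightarrow> y u = y 0 + sqrt 2 * w u - integral {0..u} (\<lambda>v. q1 (y v))"
  shows "(\<lambda>n. \<Sum>i<n. f (y (real i * (t / real n)) + sqrt 2 * (w (real (Suc i) * (t / real n)) - w (real i * (t / real n))))
               - heat (t / real n) f (y (real i * (t / real n))))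
          \<longlonglongrightarrow> f (y t) - f (y 0) - integral {0..t} (\<lambda>v. generator f1 f2 (y v))" (is "?S \<longlonglongrightarrow> ?lim")
proof (rule metric_LIMSEQ_I)
  fix e :: real assume e: "0 < e"
  note bd = C2_bound[OF C2] and b0 = C2_nonneg[OF C2]
  have cy: "continuous_on {0..t} y" by (rule continuous_on_subset[OF cont]) auto
  have cq: "continuous_on {0..t} (\<lambda>v. q1 (y v))"
    by (rule continuous_on_compose2[OF continuous_on_q1 cy]) auto
  have c1: "continuous_on {0..t} (\<lambda>v. f1 (y v))"
    by (rule continuous_on_compose2[OF C2_cont(2)[OF C2] cy]) auto
  have c2: "continuous_on {0..t} (\<lambda>v. f2 (y v))"
    by (rule continuous_on_compose2[OF C2_cont2[OF C2] cy]) auto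
  have "bounded (y ` {0..t})" "bounded ((\<lambda>v. q1 (y v)) ` {0..t})"
    by (auto intro!: compact_imp_bounded compact_continuous_image cy cq)
  then obtain a C0 where aC: "\<And>u. u \<in> {0..t} \<Longrightarrow> \<bar>y u\<bar> \<le> a" "\<And>u. u \<in> {0..t} \<Longrightarrow> \<bar>q1 (y u)\<bar> \<le> C0"
    unfolding bounded_iff by (metis imageI real_norm_def)
  define C where "C = C0 + 1"
  have C: "0 < C" "\<And>u. u \<in> {0..t} \<Longrightarrow> \<bar>q1 (y u)\<bar> \<le> C"
    using aC(2)[of 0] aC(2) t by (force simp: C_def)+
  define \<epsilon> where "\<epsilon> = e / (8 * t)"
  have \<epsilon>: "0 < \<epsilon>" using e t by (simp add: \<epsilon>_def)
  have bC: "0 < 2 * (b + 1) * C" using b0 C by simp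
  obtain d1 where d1: "0 < d1" "\<And>u v. u \<in> {0..t} \<Longrightarrow> v \<in> {0..t} \<Longrightarrow> dist v u < d1 \<Longrightarrow> dist (y v) (y u) < \<epsilon> / (2 * (b + 1) * C)"
    using compact_uniformly_continuous[OF cy compact_Icc] divide_pos_pos[OF \<epsilon> bC] unfolding uniformly_continuous_on_def by meson
  obtain d2 where d2: "0 < d2" "\<And>u v. u \<in> {0..t} \<Longrightarrow> v \<in> {0..t} \<Longrightarrow> dist v u < d2 \<Longrightarrow> dist (f2 (y v)) (f2 (y u)) < \<epsilon>"
    using compact_uniformly_continuous[OF c2 compact_Icc] \<epsilon> unfolding uniformly_continuous_on_def by meson
  have "uniformly_continuous_on {- a - 1..a + 1} f2"
    by (intro compact_uniformly_continuous continuous_on_subset[OF C2_cont2[OF C2]]) auto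
  then obtain d3 where d3: "0 < d3" "\<And>u v. u \<in> {- a - 1..a + 1} \<Longrightarrow> v \<in> {- a - 1..a + 1} \<Longrightarrow> dist v u < d3 \<Longrightarrow> dist (f2 v) (f2 u) < \<epsilon>"
    using \<epsilon> unfolding uniformly_continuous_on_def by meson
  define \<delta> where "\<delta> = min (d3 / 2) 1"
  have \<delta>: "0 < \<delta>" "\<delta> < d3" "\<delta> \<le> 1" using d3 by (auto simp: \<delta>_def)
  have osc: "\<bar>f2 \<xi> - f2 (y u)\<bar> \<le> \<epsilon>" if "u \<in> {0..t}" "\<bar>\<xi> - y u\<bar> \<le> \<delta>" for u \<xi>
  proof -
    have "y u \<in> {- a - 1..a + 1}" "\<xi> \<in> {- a - 1..a + 1}" "dist \<xi> (y u) < d3"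
      using aC(1)[OF that(1)] that(2) \<delta> unfolding atLeastAtMost_iff dist_real_def by linarith+
    then show ?thesis using d3(2)[of "y u" \<xi>] by (simp add: dist_real_def)
  qed
  define T where "T = 1 / d1 + 1 / d2 + 2 * (b + 1) * C\<^sup>2 / \<epsilon> + 12 * (b + 1) / (\<delta>\<^sup>2 * \<epsilon>)"
  have T: "0 \<le> 1 / d1" "0 \<le> 1 / d2" "0 \<le> 2 * (b + 1) * C\<^sup>2 / \<epsilon>" "0 \<le> 12 * (b + 1) / (\<delta>\<^sup>2 * \<epsilon>)"
    using d1 d2 b0 C \<epsilon> \<delta> by auto
  obtain N :: nat where N: "t * T < real N" using reals_Archimedean2 by blast
  have "dist (?S n) ?lim < e" if n: "N \<le> n" for n
  proof -
    have tT: "t * T < real n" using N n by linarith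
    moreover have "0 \<le> t * T" using t T by (simp add: T_def)
    ultimately have n0: "0 < real n" by linarith
    define h where "h = t / real n"
    have h: "0 < h" "real n * h = t" using n0 t by (auto simp: h_def)
    have hT: "h * T < 1" using tT n0 by (simp add: h_def field_simps)
    have hterm: "h * s < 1" if "s \<le> T" for s
      using mult_left_mono[OF that less_imp_le[OF h(1)]] hT by linarith
    have "h * (1 / d1) < 1" by (rule hterm) (use T in \<open>simp add: T_def\<close>)
    then have h1: "h < d1" using d1(1) by (simp add: field_simps)
    have "h * (1 / d2) < 1" by (rule hterm) (use T in \<open>simp add: T_def\<close>)
    then have h2: "h < d2" using d2(1) by (simp add: field_simps)
    have "h * (2 * (b + 1) * C\<^sup>2 / \<epsilon>) < 1" by (rule hterm) (use T in \<open>simp add: T_def\<close>)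
    then have "(h * (2 * (b + 1) * C\<^sup>2)) / \<epsilon> < 1" by simp
    then have h3: "h * (2 * (b + 1) * C\<^sup>2) \<le> \<epsilon>" using \<epsilon> by (simp only: divide_less_eq) simp
    have h4: "12 * (b + 1) * h / \<delta>\<^sup>2 \<le> \<epsilon>"
    proof -
      have "h * (12 * (b + 1) / (\<delta>\<^sup>2 * \<epsilon>)) < 1" using T by (intro hterm) (simp add: T_def)
      then have "(12 * (b + 1) * h / \<delta>\<^sup>2) / \<epsilon> < 1" by (simp add: ac_simps)
      from pos_divide_less_eq[THEN iffD1, OF \<epsilon> this] show ?thesis by simp
    qed
    let ?g = "\<lambda>i. real i * h"
    let ?z = "\<lambda>i. y (?g i) + sqrt 2 * (w (?g (Suc i)) - w (?g i))"
    let ?m = "\<lambda>i. f (?z i) - heat h f (y (?g i))"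
    let ?I = "\<lambda>i. integral {?g i..?g (Suc i)} (\<lambda>v. generator f1 f2 (y v))"
    have grid: "0 \<le> ?g i" "?g i \<le> ?g (Suc i)" "?g (Suc i) \<le> t" "?g (Suc i) - ?g i = h" if "i < n" for i
    proof -
      have "real (Suc i) * h \<le> real n * h" using that h by (intro mult_right_mono) auto
      then show "?g (Suc i) \<le> t" using h by simp
    qed (use h in \<open>auto simp: algebra_simps\<close>)
    have cg: "continuous_on {0..t} (\<lambda>v. generator f1 f2 (y v))"
      unfolding generator_def by (intro continuous_intros c1 c2 cq)
    have intg: "k integrable_on {u..v}" if "0 \<le> u" "v \<le> t" "continuous_on {0..t} k" for u v and k :: "real \<Rightarrow> real"
      by (rule integrable_continuous_real[OF continuous_on_subset[OF that(3)]]) (use that in auto)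
    \<comment> \<open>One \<open>\<epsilon>\<close> each comes from the drift (\<open>e1\<close>) and from freezing \<open>f''\<close> (\<open>e3\<close>), two from the heat
      expansion (\<open>e2\<close>).\<close>
    have step: "\<bar>f (y (?g (Suc i))) - f (y (?g i)) - ?m i - ?I i\<bar> \<le> h * (4 * \<epsilon>)" if i: "i < n" for i
    proof -
      let ?u = "?g i" and ?v = "?g (Suc i)"
      note g = grid[OF i]
      have inI: "r \<in> {0..t}" if "r \<in> {?u..?v}" for r
        using that g(1,3) unfolding atLeastAtMost_iff by linarith
      have vT: "?v \<in> {0..t}" "?u \<in> {0..t}" using g by auto
      have "integral {0..?v} (\<lambda>r. q1 (y r)) = integral {0..?u} (\<lambda>r. q1 (y r)) + integral {?u..?v} (\<lambda>r. q1 (y r))"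
        by (rule Henstock_Kurzweil_Integration.integral_combine[symmetric]) (use g intg[OF _ _ cq] in auto)
      then have inc: "y ?v - ?z i = - integral {?u..?v} (\<lambda>r. q1 (y r))"
        using eq[of ?v] eq[of ?u] g by (simp add: algebra_simps)
      have drift: "\<bar>integral {?u..?v} (\<lambda>r. q1 (y r))\<bar> \<le> C * h"
        using integral_bound[of ?u ?v "\<lambda>r. q1 (y r)" C] g C(2) inI continuous_on_subset[OF cq, of "{?u..?v}"] by auto
      obtain \<eta> where \<eta>: "\<bar>\<eta> - y ?v\<bar> \<le> \<bar>y ?v - ?z i\<bar>" "f (y ?v) - f (?z i) = f1 \<eta> * (y ?v - ?z i)"
        using C2_mean_value[OF C2] by blast
      have i1: "(\<lambda>r. q1 (y r)) integrable_on {?u..?v}" "(\<lambda>r. q1 (y r) * f1 (y r)) integrable_on {?u..?v}" "(\<lambda>r. f2 (y r)) integrable_on {?u..?v}"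
        using g by (auto intro!: intg continuous_intros cq c1 c2)
      have "f (y ?v) - f (?z i) + integral {?u..?v} (\<lambda>r. q1 (y r) * f1 (y r)) = integral {?u..?v} (\<lambda>r. q1 (y r) * (f1 (y r) - f1 \<eta>))"
      proof -
        have "integral {?u..?v} (\<lambda>r. q1 (y r) * (f1 (y r) - f1 \<eta>)) = integral {?u..?v} (\<lambda>r. q1 (y r) * f1 (y r) - f1 \<eta> * q1 (y r))"
          by (simp add: algebra_simps)
        also have "\<dots> = integral {?u..?v} (\<lambda>r. q1 (y r) * f1 (y r)) - f1 \<eta> * integral {?u..?v} (\<lambda>r. q1 (y r))"
          using i1 by (subst Henstock_Kurzweil_Integration.integral_diff) (auto intro: integrable_on_mult_right)
        finally show ?thesis using \<eta>(2) inc by simp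
      qed
      also have "\<bar>\<dots>\<bar> \<le> \<epsilon> * (?v - ?u)"
        unfolding real_norm_def[symmetric]
      proof (rule integral_bound)
        show "continuous_on {?u..?v} (\<lambda>r. q1 (y r) * (f1 (y r) - f1 \<eta>))"
          using inI by (intro continuous_intros continuous_on_subset[OF cq] continuous_on_subset[OF c1]) auto
        fix r assume r: "r \<in> {?u..?v}"
        have "\<bar>?v - r\<bar> \<le> h" using r g by (auto simp: abs_le_iff)
        then have "\<bar>y ?v - y r\<bar> < \<epsilon> / (2 * (b + 1) * C)" using d1(2)[of r ?v] inI[OF r] vT h1 by (auto simp: dist_real_def)
        then have "\<bar>y r - \<eta>\<bar> \<le> \<epsilon> / (2 * (b + 1) * C) + C * h" using \<eta>(1) drift inc by linarith
        then have "\<bar>f1 (y r) - f1 \<eta>\<bar> \<le> b * (\<epsilon> / (2 * (b + 1) * C) + C * h)"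
          using C2_Lipschitz1[OF C2, of "y r" \<eta>] b0 by (meson mult_left_mono order.trans)
        also have "\<dots> \<le> (b + 1) * (\<epsilon> / (2 * (b + 1) * C) + C * h)"
          using \<epsilon> bC C h by (intro mult_right_mono add_nonneg_nonneg) auto
        finally have "\<bar>q1 (y r)\<bar> * \<bar>f1 (y r) - f1 \<eta>\<bar> \<le> C * ((b + 1) * (\<epsilon> / (2 * (b + 1) * C) + C * h))"
          using C(2)[OF inI[OF r]] C(1) by (intro mult_mono) auto
        also have "\<dots> = \<epsilon> / 2 + h * (2 * (b + 1) * C\<^sup>2) / 2"
        proof -
          have "C * (\<beta> * (\<epsilon> / (2 * \<beta> * C) + C * h)) = \<epsilon> / 2 + h * (2 * \<beta> * C\<^sup>2) / 2" if "0 < \<beta>" for \<beta>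
            using that C(1) by (simp add: field_simps power2_eq_square)
          from this[of "b + 1"] show ?thesis using b0 by simp
        qed
        also have "\<dots> \<le> \<epsilon>" using h3 by simp
        finally show "norm (q1 (y r) * (f1 (y r) - f1 \<eta>)) \<le> \<epsilon>" by (simp add: abs_mult)
      qed (use g in auto)
      finally have e1: "\<bar>f (y ?v) - f (?z i) + integral {?u..?v} (\<lambda>r. q1 (y r) * f1 (y r))\<bar> \<le> h * \<epsilon>"
        using g by (simp add: mult.commute)
      have "\<bar>heat h f (y ?u) - f (y ?u) - h * f2 (y ?u)\<bar> \<le> h * (\<epsilon> + 12 * b * h / \<delta>\<^sup>2)"
        by (rule heat_expansion[OF C2 h(1) \<delta>(1) osc[OF vT(2)]])
      also have "\<dots> \<le> h * (\<epsilon> + 12 * (b + 1) * h / \<delta>\<^sup>2)"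
        using h \<delta> by (intro mult_left_mono add_left_mono divide_right_mono mult_right_mono) auto
      also have "\<dots> \<le> h * (\<epsilon> + \<epsilon>)" using h h4 by (intro mult_left_mono add_left_mono) auto
      finally have e2: "\<bar>heat h f (y ?u) - f (y ?u) - h * f2 (y ?u)\<bar> \<le> h * (\<epsilon> + \<epsilon>)" .
      have "integral {?u..?v} (\<lambda>r. f2 (y r)) - h * f2 (y ?u) = integral {?u..?v} (\<lambda>r. f2 (y r) - f2 (y ?u))"
        using i1(3) g by (subst Henstock_Kurzweil_Integration.integral_diff) auto
      also have "\<bar>\<dots>\<bar> \<le> \<epsilon> * (?v - ?u)"
        unfolding real_norm_def[symmetric]
      proof (rule integral_bound)
        show "continuous_on {?u..?v} (\<lambda>r. f2 (y r) - f2 (y ?u))"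
          using inI by (intro continuous_intros continuous_on_subset[OF c2]) auto
        fix r assume r: "r \<in> {?u..?v}"
        have "\<bar>r - ?u\<bar> \<le> h" using r g by (auto simp: abs_le_iff)
        then show "norm (f2 (y r) - f2 (y ?u)) \<le> \<epsilon>"
          using d2(2)[of ?u r] inI[OF r] vT h2 by (auto simp: dist_real_def)
      qed (use g in auto)
      finally have e3: "\<bar>integral {?u..?v} (\<lambda>r. f2 (y r)) - h * f2 (y ?u)\<bar> \<le> h * \<epsilon>"
        using g by (simp add: mult.commute)
      have "?I i = integral {?u..?v} (\<lambda>r. f2 (y r)) - integral {?u..?v} (\<lambda>r. q1 (y r) * f1 (y r))"
        unfolding generator_def using i1 by (subst Henstock_Kurzweil_Integration.integral_diff) auto
      then have "f (y ?v) - f (y ?u) - ?m i - ?I i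
          = (f (y ?v) - f (?z i) + integral {?u..?v} (\<lambda>r. q1 (y r) * f1 (y r)))
            + (heat h f (y ?u) - f (y ?u) - h * f2 (y ?u)) - (integral {?u..?v} (\<lambda>r. f2 (y r)) - h * f2 (y ?u))"
        by simp
      also have "\<bar>\<dots>\<bar> \<le> h * \<epsilon> + h * (\<epsilon> + \<epsilon>) + h * \<epsilon>" using e1 e2 e3 by linarith
      also have "\<dots> = h * (4 * \<epsilon>)" by (simp add: algebra_simps)
      finally show ?thesis .
    qed
    have tele: "(\<Sum>i<k. f (y (?g (Suc i))) - f (y (?g i))) = f (y (?g k)) - f (y 0)" for k
      by (subst sum_lessThan_telescope) simp
    have teleI: "(\<Sum>i<k. ?I i) = integral {0..?g k} (\<lambda>v. generator f1 f2 (y v))" if "k \<le> n" for k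
      using that
    proof (induction k)
      case (Suc k)
      then show ?case
        using grid[of k] intg[OF _ _ cg] by (simp del: of_nat_Suc add: Henstock_Kurzweil_Integration.integral_combine)
    qed simp
    have "\<bar>(f (y t) - f (y 0) - integral {0..t} (\<lambda>v. generator f1 f2 (y v))) - (\<Sum>i<n. ?m i)\<bar>
        = \<bar>\<Sum>i<n. f (y (?g (Suc i))) - f (y (?g i)) - ?m i - ?I i\<bar>"
      using tele[of n] teleI[of n] h(2) by (simp add: sum_subtractf del: of_nat_Suc)
    also have "\<dots> \<le> (\<Sum>i<n. h * (4 * \<epsilon>))"
      by (rule order.trans[OF sum_abs sum_mono]) (use step in auto)
    also have "\<dots> = t * (4 * \<epsilon>)" using h(2) by (simp flip: mult.assoc)
    also have "\<dots> < e" using e t by (simp add: \<epsilon>_def)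
    finally show ?thesis by (simp add: dist_real_def abs_minus_commute h_def)
  qed
  then show "\<exists>no. \<forall>n\<ge>no. dist (?S n) ?lim < e" by blast
qed

end

context confining_potential
begin

text \<open>
  Far out the drift points inwards, so \<open>L f\<close> for \<open>f = sqrt (1 + x\<^sup>2)\<close> lies below a constant minus \<open>f\<close> and
  below a constant minus \<open>\<bar>q'\<bar> / 2\<close>.  It thus controls both first moments and \<open>q'\<close> along the path.
\<close>

lemma lyapunov:
  "\<exists>C\<ge>0. \<exists>f1 f2. bounded_C2 (\<lambda>x. sqrt (1 + x\<^sup>2)) f1 f2 1 \<and>
     (\<forall>x. sqrt (1 + x\<^sup>2) \<le> C - generator f1 f2 x \<and> \<bar>q1 x\<bar> \<le> 2 * (C - generator f1 f2 x))"
proof -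
  define f1 where "f1 x = x / sqrt (1 + x\<^sup>2)" for x :: real
  define f2 where "f2 x = 1 / (sqrt (1 + x\<^sup>2) * (1 + x\<^sup>2))" for x :: real
  have pos: "0 < 1 + x\<^sup>2" "sqrt (1 + x\<^sup>2) * sqrt (1 + x\<^sup>2) = 1 + x\<^sup>2" "1 \<le> sqrt (1 + x\<^sup>2)" for x :: real
    by (auto intro: add_pos_nonneg)
  have abs_le: "\<bar>x\<bar> \<le> sqrt (1 + x\<^sup>2)" for x :: real
    by (rule real_le_rsqrt) simp
  have f1_le: "\<bar>f1 x\<bar> \<le> 1" for x
    using abs_le[of x] pos(3)[of x] by (simp add: f1_def abs_divide divide_le_eq_1 add_pos_nonneg)
  have f2_bd: "0 \<le> f2 x" "f2 x \<le> 1" for x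
  proof -
    have "1 * 1 \<le> sqrt (1 + x\<^sup>2) * (1 + x\<^sup>2)" using pos[of x] by (intro mult_mono) auto
    then show "0 \<le> f2 x" "f2 x \<le> 1" by (auto simp: f2_def)
  qed
  have d0: "((\<lambda>x. sqrt (1 + x\<^sup>2)) has_real_derivative f1 x) (at x)" for x
    unfolding f1_def using pos(1)[of x] by (auto intro!: derivative_eq_intros simp: field_simps)
  have d1: "(f1 has_real_derivative f2 x) (at x)" for x
  proof -
    have "((\<lambda>x. x / sqrt (1 + x\<^sup>2)) has_real_derivative (1 * sqrt (1 + x\<^sup>2) - x * f1 x) / (sqrt (1 + x\<^sup>2) * sqrt (1 + x\<^sup>2))) (at x)"
      using pos(1)[of x] pos(3)[of x] by (intro DERIV_divide DERIV_ident d0) auto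
    also have "(1 * sqrt (1 + x\<^sup>2) - x * f1 x) / (sqrt (1 + x\<^sup>2) * sqrt (1 + x\<^sup>2)) = f2 x"
    proof -
      have "1 * sqrt (1 + x\<^sup>2) - x * f1 x = 1 / sqrt (1 + x\<^sup>2)"
        using pos[of x] by (simp add: f1_def field_simps power2_eq_square)
      then show ?thesis by (simp add: f2_def pos(2))
    qed
    finally show ?thesis by (simp add: f1_def[abs_def])
  qed
  have c2: "continuous_on UNIV f2"
    unfolding f2_def using pos by (intro continuous_intros) (auto simp: less_imp_neq[symmetric])
  have C2: "bounded_C2 (\<lambda>x. sqrt (1 + x\<^sup>2)) f1 f2 1"
    unfolding bounded_C2_def using d0 d1 c2 f1_le f2_bd by auto
  obtain c where c: "0 \<le> c" "\<And>x. \<bar>x\<bar> \<le> R \<Longrightarrow> \<bar>q1 x\<bar> \<le> c"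
    using bounded_on_core[OF continuous_on_q1] by blast
  define C where "C = 2 + 2 * c + R"
  have "sqrt (1 + x\<^sup>2) \<le> C - generator f1 f2 x \<and> \<bar>q1 x\<bar> \<le> 2 * (C - generator f1 f2 x)" for x
  proof (cases "\<bar>x\<bar> \<le> R")
    case True
    have "\<bar>q1 x * f1 x\<bar> \<le> c * 1"
      unfolding abs_mult using c True f1_le by (intro mult_mono) auto
    then have g: "generator f1 f2 x \<le> 1 + c" using f2_bd(2)[of x] unfolding generator_def by linarith
    have "x\<^sup>2 \<le> R\<^sup>2" using R_ge True by (auto intro: abs_le_square_iff[THEN iffD1])
    then have "sqrt (1 + x\<^sup>2) \<le> sqrt ((1 + R)\<^sup>2)"
      using R_ge by (intro real_sqrt_le_mono) (simp add: power2_eq_square algebra_simps)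
    then have "sqrt (1 + x\<^sup>2) \<le> 1 + R" using R_ge by simp
    have "sqrt (1 + x\<^sup>2) \<le> C - generator f1 f2 x"
      using \<open>sqrt (1 + x\<^sup>2) \<le> 1 + R\<close> g c(1) unfolding C_def by linarith
    moreover have "\<bar>q1 x\<bar> \<le> 2 * (C - generator f1 f2 x)"
    proof -
      have "a \<le> 2 * (C - v)" if "a \<le> c" "v \<le> 1 + c" for a v
      proof -
        have "c \<le> C - (1 + c)" using c(1) R_ge unfolding C_def by linarith
        moreover have "C - (1 + c) \<le> C - v" using that(2) by simp
        ultimately have "a \<le> C - v" "0 \<le> C - v" using that(1) c(1) by linarith+
        then show ?thesis by simp
      qed
      from this[OF c(2)[OF True] g] show ?thesis .
    qed
    ultimately show ?thesis ..
  next
    case False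
    have x1: "1 \<le> \<bar>x\<bar>" using False R_ge by linarith
    have p: "0 < sqrt (1 + x\<^sup>2)" using pos(3)[of x] by linarith
    have sgn: "q1 x * x = \<bar>q1 x\<bar> * \<bar>x\<bar>" "\<bar>x\<bar> \<le> \<bar>q1 x\<bar>"
      using False q1_right[of x] q1_left[of x] R_ge by (auto simp: abs_if zero_le_mult_iff)
    have q1f1: "q1 x * f1 x = \<bar>q1 x\<bar> * \<bar>f1 x\<bar>"
      using sgn(1) pos(3)[of x] by (simp add: f1_def)
    have "sqrt (1 + x\<^sup>2) - 1 \<le> \<bar>x\<bar> * \<bar>f1 x\<bar>"
    proof -
      have "\<bar>x\<bar> * \<bar>f1 x\<bar> = x\<^sup>2 / sqrt (1 + x\<^sup>2)" using pos(3)[of x] by (simp add: f1_def power2_eq_square flip: abs_mult)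
      also have "\<dots> = (sqrt (1 + x\<^sup>2) * sqrt (1 + x\<^sup>2) - 1) / sqrt (1 + x\<^sup>2)" unfolding pos(2) by simp
      also have "\<dots> = sqrt (1 + x\<^sup>2) - 1 / sqrt (1 + x\<^sup>2)"
      proof -
        have "(a * a - 1) / a = a - 1 / a" if "1 \<le> a" for a :: real
          using that by (simp add: diff_divide_distrib)
        from this[OF pos(3)] show ?thesis .
      qed
      also have "\<dots> \<ge> sqrt (1 + x\<^sup>2) - 1"
        using p pos(3)[of x] divide_le_eq_1_pos[OF p, of 1] by linarith
      finally show ?thesis .
    qed
    also have "\<dots> \<le> q1 x * f1 x" unfolding q1f1 using sgn(2) by (intro mult_right_mono) auto
    finally have 1: "sqrt (1 + x\<^sup>2) - 1 \<le> q1 x * f1 x" .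
    have "1 \<le> \<bar>x\<bar>\<^sup>2" using x1 by (rule one_le_power)
    then have "1 + x\<^sup>2 \<le> (2 * \<bar>x\<bar>)\<^sup>2" by (simp add: power_mult_distrib)
    then have "sqrt (1 + x\<^sup>2) \<le> 2 * \<bar>x\<bar>" by (rule real_le_lsqrt[rotated]) simp
    then have "1 / 2 * sqrt (1 + x\<^sup>2) \<le> \<bar>x\<bar>" by simp
    then have "1 / 2 \<le> \<bar>x\<bar> / sqrt (1 + x\<^sup>2)" by (simp only: pos_le_divide_eq[OF p])
    then have "1 / 2 \<le> \<bar>f1 x\<bar>" using p by (simp add: f1_def abs_divide)
    then have "\<bar>q1 x\<bar> * (1 / 2) \<le> q1 x * f1 x" unfolding q1f1 by (intro mult_left_mono) auto
    then show ?thesis using 1 f2_bd(2)[of x] c(1) R_ge unfolding generator_def C_def by (auto simp: field_simps)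
  qed
  moreover have "0 \<le> C" using c R_ge by (simp add: C_def)
  ultimately show ?thesis using C2 by blast
qed

end

context confined_langevin
begin

text \<open>
  A measurable set of full measure on which the path is continuous and solves the equation; it is
  needed to obtain jointly measurable paths.
\<close>

definition good :: "'a set" where
  "good = (SOME G. G \<in> sets M \<and> (AE \<omega> in M. \<omega> \<in> G) \<and>
     (\<forall>\<omega>\<in>G. continuous_on {0..} (\<lambda>t. X t \<omega>) \<and> X 0 \<omega> = x \<and>
        (\<forall>t\<ge>0. X t \<omega> = X 0 \<omega> + sqrt 2 * B t \<omega> - integral {0..t} (\<lambda>s. q1 (X s \<omega>)))))"

lemma good_props:
  "good \<in> sets M" "AE \<omega> in M. \<omega> \<in> good"
  "\<omega> \<in> good \<Longrightarrow> continuous_on {0..} (\<lambda>t. X t \<omega>)" "\<omega> \<in> good \<Longrightarrow> X 0 \<omega> = x"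
  "\<omega> \<in> good \<Longrightarrow> 0 \<le> t \<Longrightarrow> X t \<omega> = X 0 \<omega> + sqrt 2 * B t \<omega> - integral {0..t} (\<lambda>s. q1 (X s \<omega>))"
proof -
  let ?P = "\<lambda>\<omega>. continuous_on {0..} (\<lambda>t. X t \<omega>) \<and> X 0 \<omega> = x \<and>
        (\<forall>t\<ge>0. X t \<omega> = X 0 \<omega> + sqrt 2 * B t \<omega> - integral {0..t} (\<lambda>s. q1 (X s \<omega>)))"
  have "AE \<omega> in M. ?P \<omega>" using continuous_X X_0 X_sde by eventually_elim blast
  then obtain N where N: "{\<omega>\<in>space M. \<not> ?P \<omega>} \<subseteq> N" "emeasure M N = 0" "N \<in> sets M" by (rule AE_E)
  have "\<exists>G. G \<in> sets M \<and> (AE \<omega> in M. \<omega> \<in> G) \<and> (\<forall>\<omega>\<in>G. ?P \<omega>)"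
  proof (intro exI[of _ "space M - N"] conjI)
    show "AE \<omega> in M. \<omega> \<in> space M - N"
      using AE_not_in[of N M] N by (auto simp: null_sets_def)
  qed (use N in auto)
  from someI_ex[OF this, folded good_def]
  show "good \<in> sets M" "AE \<omega> in M. \<omega> \<in> good"
    "\<omega> \<in> good \<Longrightarrow> continuous_on {0..} (\<lambda>t. X t \<omega>)" "\<omega> \<in> good \<Longrightarrow> X 0 \<omega> = x"
    "\<omega> \<in> good \<Longrightarrow> 0 \<le> t \<Longrightarrow> X t \<omega> = X 0 \<omega> + sqrt 2 * B t \<omega> - integral {0..t} (\<lambda>s. q1 (X s \<omega>))"
    by blast+
qed

text \<open>
  The solution with its paths made continuous everywhere.  It need not be adapted, so adaptedness
  arguments use \<open>X\<close> and integrals over time use \<open>Y\<close>.  Negative times are frozen at time \<open>0\<close>.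
\<close>

definition Y :: "real \<Rightarrow> 'a \<Rightarrow> real" where
  "Y t \<omega> = (if \<omega> \<in> good then X (max 0 t) \<omega> else x)"

lemma Y_good: "\<omega> \<in> good \<Longrightarrow> 0 \<le> t \<Longrightarrow> Y t \<omega> = X t \<omega>"
  by (simp add: Y_def)

lemma AE_Y: "0 \<le> t \<Longrightarrow> AE \<omega> in M. Y t \<omega> = X t \<omega>"
  using good_props(2) by eventually_elim (rule Y_good)

lemma measurable_Y [measurable]: "Y t \<in> borel_measurable M"
proof -
  note [measurable] = good_props(1)
  show ?thesis unfolding Y_def[abs_def] by measurable
qed

lemma continuous_Y: "continuous_on UNIV (\<lambda>t. Y t \<omega>)"
proof (cases "\<omega> \<in> good")
  case True
  have "continuous_on UNIV (\<lambda>t. X (max 0 t) \<omega>)"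
    by (rule continuous_on_compose2[OF good_props(3)[OF True]]) (auto intro!: continuous_intros)
  then show ?thesis using True by (simp add: Y_def)
qed (simp add: Y_def)

lemma measurable_Y_pair [measurable]: "(\<lambda>p. Y (fst p) (snd p)) \<in> borel_measurable (borel \<Otimes>\<^sub>M M)"
proof (rule borel_measurable_LIMSEQ_real)
  let ?f = "\<lambda>n (p :: real \<times> 'a). Y (real_of_int \<lfloor>real (Suc n) * fst p\<rfloor> / real (Suc n)) (snd p)"
  show "?f n \<in> borel_measurable (borel \<Otimes>\<^sub>M M)" for n
  proof (rule measurable_compose_countable[where f = "\<lambda>i p. Y (real_of_int i / real (Suc n)) (snd p)" and g = "\<lambda>p. \<lfloor>real (Suc n) * fst p\<rfloor>"])
    show "(\<lambda>p. Y (real_of_int i / real (Suc n)) (snd p)) \<in> borel_measurable (borel \<Otimes>\<^sub>M M)" for i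
      by measurable
  qed measurable
  show "(\<lambda>n. ?f n p) \<longlonglongrightarrow> Y (fst p) (snd p)" for p
  proof -
    have "(\<lambda>n. real_of_int \<lfloor>real (Suc n) * fst p\<rfloor> / real (Suc n)) \<longlonglongrightarrow> fst p"
    proof (rule tendsto_sandwich[where f = "\<lambda>n. fst p - 1 / real (Suc n)" and h = "\<lambda>_. fst p"])
      have lim: "(\<lambda>n. 1 / real (Suc n)) \<longlonglongrightarrow> 0" by (rule LIMSEQ_Suc[OF lim_1_over_n])
      show "(\<lambda>n. fst p - 1 / real (Suc n)) \<longlonglongrightarrow> fst p" using tendsto_diff[OF tendsto_const lim, of "fst p"] by simp
      have fl: "real (Suc n) * fst p - 1 \<le> real_of_int \<lfloor>real (Suc n) * fst p\<rfloor>" "real_of_int \<lfloor>real (Suc n) * fst p\<rfloor> \<le> real (Suc n) * fst p" for n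
        by linarith+
      have pos: "0 < real (Suc n)" for n by simp
      show "\<forall>\<^sub>F n in sequentially. fst p - 1 / real (Suc n) \<le> real_of_int \<lfloor>real (Suc n) * fst p\<rfloor> / real (Suc n)"
      proof (rule always_eventually, rule allI)
        fix n
        have "(real (Suc n) * fst p - 1) / real (Suc n) \<le> real_of_int \<lfloor>real (Suc n) * fst p\<rfloor> / real (Suc n)"
          using fl(1) pos by (intro divide_right_mono) auto
        then show "fst p - 1 / real (Suc n) \<le> real_of_int \<lfloor>real (Suc n) * fst p\<rfloor> / real (Suc n)"
          by (simp add: diff_divide_distrib del: of_nat_Suc)
      qed
      show "\<forall>\<^sub>F n in sequentially. real_of_int \<lfloor>real (Suc n) * fst p\<rfloor> / real (Suc n) \<le> fst p"
      proof (rule always_eventually, rule allI)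
        fix n
        have "real_of_int \<lfloor>real (Suc n) * fst p\<rfloor> / real (Suc n) \<le> (real (Suc n) * fst p) / real (Suc n)"
          using fl(2) pos by (intro divide_right_mono) auto
        then show "real_of_int \<lfloor>real (Suc n) * fst p\<rfloor> / real (Suc n) \<le> fst p" by (simp del: of_nat_Suc)
      qed
    qed simp
    then show ?thesis by (rule continuous_on_tendsto_compose[OF continuous_Y]) auto
  qed
qed

lemma expectation_Y:
  assumes "0 \<le> t" and [measurable]: "g \<in> borel_measurable borel"
  shows "(LINT \<omega>|M. g (Y t \<omega>)) = (LINT \<omega>|M. g (X t \<omega>) :: real)"
    and "integrable M (\<lambda>\<omega>. g (Y t \<omega>)) \<longleftrightarrow> integrable M (\<lambda>\<omega>. g (X t \<omega>))"
proof -
  have [measurable]: "X t \<in> borel_measurable M" using assms(1) by simp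
  have ae: "AE \<omega> in M. g (Y t \<omega>) = g (X t \<omega>)" using AE_Y[OF assms(1)] by eventually_elim simp
  show "(LINT \<omega>|M. g (Y t \<omega>)) = (LINT \<omega>|M. g (X t \<omega>))" by (rule integral_cong_AE) (use ae in auto)
  show "integrable M (\<lambda>\<omega>. g (Y t \<omega>)) \<longleftrightarrow> integrable M (\<lambda>\<omega>. g (X t \<omega>))" by (rule integrable_cong_AE) (use ae in auto)
qed

definition noise_sum :: "real \<Rightarrow> (real \<Rightarrow> real) \<Rightarrow> nat \<Rightarrow> 'a \<Rightarrow> real" where
  "noise_sum h f k \<omega> = (\<Sum>i<k. f (X (real i * h) \<omega> + sqrt 2 * (B (real (Suc i) * h) \<omega> - B (real i * h) \<omega>))
      - heat h f (X (real i * h) \<omega>))"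

text \<open>
  The summands have conditional mean zero given the past, so they are uncorrelated and the second
  moments add up.
\<close>

lemma noise_sum_props:
  assumes C2: "bounded_C2 f f1 f2 b" and h: "0 < h"
  shows "noise_sum h f k \<in> borel_measurable (F (real k * h))
    \<and> integrable M (\<lambda>\<omega>. (noise_sum h f k \<omega>)\<^sup>2)
    \<and> (LINT \<omega>|M. (noise_sum h f k \<omega>)\<^sup>2) \<le> 8 * b\<^sup>2 * h * real k
    \<and> (LINT \<omega>|M. noise_sum h f k \<omega>) = 0"
proof (induction k)
  case 0
  then show ?case by (simp add: noise_sum_def[abs_def])
next
  case (Suc k)
  interpret G: prob_space "gauss h" by (rule prob_space_gauss[OF h])
  have f [measurable]: "f \<in> borel_measurable borel" by (rule borel_measurable_continuous_onI[OF C2_cont(1)[OF C2]])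
  have [measurable]: "heat h f \<in> borel_measurable borel"
    unfolding heat_def[abs_def] by (rule G.borel_measurable_lebesgue_integral) measurable
  let ?u = "real k * h" and ?v = "real (Suc k) * h"
  let ?S = "noise_sum h f k"
  let ?k = "\<lambda>z w. f (z + sqrt 2 * w) - heat h f z"
  let ?m = "\<lambda>\<omega>. ?k (X ?u \<omega>) (B ?v \<omega> - B ?u \<omega>)"
  have uv: "0 \<le> ?u" "?u < ?v" "?v - ?u = h" "0 \<le> ?v" "?u \<le> ?v" using h by (auto simp: algebra_simps)
  note XF = adapted_X[OF uv(1)] and BF = adapted_B[OF uv(1)] and BF' = adapted_B[OF uv(4)]
  have SF: "?S \<in> borel_measurable (F ?u)" using Suc by simp
  have S2: "integrable M (\<lambda>\<omega>. (?S \<omega>)\<^sup>2)" using Suc by simp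
  have rec: "noise_sum h f (Suc k) = (\<lambda>\<omega>. ?S \<omega> + ?m \<omega>)" by (rule ext) (simp add: noise_sum_def)
  have mF: "noise_sum h f (Suc k) \<in> borel_measurable (F ?v)"
  proof -
    note [measurable] = measurable_F_mono[OF uv(5) SF] measurable_F_mono[OF uv(5) XF] measurable_F_mono[OF uv(5) BF] BF'
    show ?thesis unfolding rec by measurable
  qed
  have [measurable]: "?S \<in> borel_measurable M" by (rule measurable_of_F[OF uv(1) SF])
  have [measurable]: "X ?u \<in> borel_measurable M" "B ?u \<in> borel_measurable M" "B ?v \<in> borel_measurable M"
    using uv by auto
  have D: "(\<lambda>\<omega>. B ?v \<omega> - B ?u \<omega>) \<in> borel_measurable M" by measurable
  have D2: "integrable M (\<lambda>\<omega>. (B ?v \<omega> - B ?u \<omega>)\<^sup>2)" "(LINT \<omega>|M. (B ?v \<omega> - B ?u \<omega>)\<^sup>2) = h"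
    using integrable_distr_eq[OF D, of "\<lambda>w. w\<^sup>2"] integral_distr[OF D, of "\<lambda>w. w\<^sup>2"]
      integrable_gauss_power[OF h, of 2] integral_gauss(2)[OF h]
    unfolding distr_increment[OF uv(1,2)] uv(3) by auto
  have m_le: "(?m \<omega>)\<^sup>2 \<le> 4 * b\<^sup>2 * ((B ?v \<omega> - B ?u \<omega>)\<^sup>2 + h)" for \<omega>
    by (rule heat_noise_bound[OF C2 h])
  have m2: "integrable M (\<lambda>\<omega>. (?m \<omega>)\<^sup>2)"
    by (rule Bochner_Integration.integrable_bound[where f = "\<lambda>\<omega>. 4 * b\<^sup>2 * ((B ?v \<omega> - B ?u \<omega>)\<^sup>2 + h)"])
       (use D2 m_le order.trans[OF m_le abs_ge_self] in \<open>auto simp del: of_nat_Suc\<close>)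
  have Em2: "(LINT \<omega>|M. (?m \<omega>)\<^sup>2) \<le> 8 * b\<^sup>2 * h"
  proof -
    have "(LINT \<omega>|M. (?m \<omega>)\<^sup>2) \<le> (LINT \<omega>|M. 4 * b\<^sup>2 * ((B ?v \<omega> - B ?u \<omega>)\<^sup>2 + h))"
      by (rule integral_mono[OF m2 _ m_le]) (use D2 in auto)
    also have "\<dots> = 8 * b\<^sup>2 * h" using D2 prob_space by simp
    finally show ?thesis .
  qed
  have centred: "(LINT w|gauss (?v - ?u). ?k z w) = 0" for z
    unfolding uv(3) using integrable_gauss_shift[OF C2 h, of z] G.prob_space
    by (simp add: Bochner_Integration.integral_diff heat_def[symmetric])
  have im: "integrable M ?m" by (rule square_integrable_imp_integrable[OF _ m2]) measurable
  have Em: "(LINT \<omega>|M. ?m \<omega>) = 0"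
    using freezing[OF uv(1,2) XF, of ?k] im unfolding centred by simp
  have iSm: "integrable M (\<lambda>\<omega>. ?S \<omega> * ?m \<omega>)"
  proof (rule Bochner_Integration.integrable_bound)
    show "integrable M (\<lambda>\<omega>. (?S \<omega>)\<^sup>2 + (?m \<omega>)\<^sup>2)" using S2 m2 by (rule Bochner_Integration.integrable_add)
    show "(\<lambda>\<omega>. ?S \<omega> * ?m \<omega>) \<in> borel_measurable M" by measurable
    show "AE \<omega> in M. norm (?S \<omega> * ?m \<omega>) \<le> norm ((?S \<omega>)\<^sup>2 + (?m \<omega>)\<^sup>2)"
    proof (rule AE_I2)
      fix \<omega>
      have "\<bar>a * c\<bar> \<le> \<bar>a\<^sup>2 + c\<^sup>2\<bar>" for a c :: real
      proof -
        have "0 \<le> (\<bar>a\<bar> - \<bar>c\<bar>)\<^sup>2" by simp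
        then have "2 * \<bar>a * c\<bar> \<le> a\<^sup>2 + c\<^sup>2" by (simp add: power2_diff abs_mult)
        then show ?thesis by linarith
      qed
      then show "norm (?S \<omega> * ?m \<omega>) \<le> norm ((?S \<omega>)\<^sup>2 + (?m \<omega>)\<^sup>2)" unfolding real_norm_def .
    qed
  qed
  have ESm: "(LINT \<omega>|M. ?S \<omega> * ?m \<omega>) = 0"
  proof -
    have "(\<lambda>\<omega>. (?S \<omega>, X ?u \<omega>)) \<in> measurable (F ?u) (borel \<Otimes>\<^sub>M borel)"
      using SF XF by simp
    from freezing[OF uv(1,2) this, of "\<lambda>p w. fst p * ?k (snd p) w"] iSm
    have "(LINT \<omega>|M. ?S \<omega> * ?m \<omega>) = (LINT \<omega>|M. LINT w|gauss (?v - ?u). ?S \<omega> * ?k (X ?u \<omega>) w)" by simp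
    also have "\<dots> = 0" using centred by simp
    finally show ?thesis .
  qed
  have sq: "(noise_sum h f (Suc k) \<omega>)\<^sup>2 = (?S \<omega>)\<^sup>2 + 2 * (?S \<omega> * ?m \<omega>) + (?m \<omega>)\<^sup>2" for \<omega>
    unfolding rec power2_sum by simp
  have int: "integrable M (\<lambda>\<omega>. (noise_sum h f (Suc k) \<omega>)\<^sup>2)"
    unfolding sq using S2 iSm m2 by (intro Bochner_Integration.integrable_add integrable_mult_right)
  have E2: "(LINT \<omega>|M. (noise_sum h f (Suc k) \<omega>)\<^sup>2) = (LINT \<omega>|M. (?S \<omega>)\<^sup>2) + 2 * (LINT \<omega>|M. ?S \<omega> * ?m \<omega>) + (LINT \<omega>|M. (?m \<omega>)\<^sup>2)"
    unfolding sq using S2 iSm m2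
    by (subst Bochner_Integration.integral_add, force, force, subst Bochner_Integration.integral_add, force, force) simp
  have "integrable M ?S" by (rule square_integrable_imp_integrable[OF _ S2]) simp
  then have E1: "(LINT \<omega>|M. noise_sum h f (Suc k) \<omega>) = 0"
    unfolding rec using im Em Suc by (subst Bochner_Integration.integral_add) auto
  show ?case
    using mF int E2 ESm Em2 Suc E1 by (simp add: algebra_simps)
qed

lemma integral_Y:
  fixes g :: "real \<Rightarrow> real"
  assumes "continuous_on UNIV g" "0 \<le> t"
  shows "integral {0..t} (\<lambda>s. g (Y s \<omega>)) = (LINT s|lborel. indicator {0..t} s * g (Y s \<omega>))"
    and "integrable lborel (\<lambda>s. indicator {0..t} s * g (Y s \<omega>))"
proof -
  have "continuous_on {0..t} (\<lambda>s. g (Y s \<omega>))"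
    by (rule continuous_on_compose2[OF assms(1) continuous_on_subset[OF continuous_Y]]) auto
  then have i: "set_integrable lborel {0..t} (\<lambda>s. g (Y s \<omega>))" by (rule borel_integrable_atLeastAtMost')
  then show "integrable lborel (\<lambda>s. indicator {0..t} s * g (Y s \<omega>))" by (simp add: set_integrable_def)
  show "integral {0..t} (\<lambda>s. g (Y s \<omega>)) = (LINT s|lborel. indicator {0..t} s * g (Y s \<omega>))"
    using set_borel_integral_eq_integral(2)[OF i] by (simp add: set_lebesgue_integral_def)
qed

lemma measurable_occupation [measurable]:
  assumes [measurable]: "g \<in> borel_measurable borel"
  shows "(\<lambda>p. indicator {0..t} (snd p) * (g (Y (snd p) (fst p)) :: real)) \<in> borel_measurable (M \<Otimes>\<^sub>M lborel)"
proof -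
  have [measurable]: "(\<lambda>p. Y (snd p) (fst p)) \<in> borel_measurable (M \<Otimes>\<^sub>M lborel)"
    using measurable_compose[OF _ measurable_Y_pair, of "\<lambda>p. (snd p, fst p)" "M \<Otimes>\<^sub>M lborel"] by simp
  show ?thesis by measurable
qed

lemma continuous_generator:
  assumes "bounded_C2 f f1 f2 b"
  shows "continuous_on UNIV (generator f1 f2)"
  unfolding generator_def[abs_def]
  by (intro continuous_intros C2_cont2[OF assms] C2_cont(2)[OF assms] continuous_on_q1)

text \<open>
  The limit of centred sums bounded in \<open>L\<^sup>2\<close>.  Only the difference of \<open>f (Y t)\<close> and the time integral
  is claimed to be integrable, so the identity can itself be used to derive moment bounds.
\<close>

lemma Dynkin_martingale:
  assumes C2: "bounded_C2 f f1 f2 b" and t: "0 < t"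
  defines "\<Delta> \<equiv> \<lambda>\<omega>. f (Y t \<omega>) - f x - (LINT s|lborel. indicator {0..t} s * generator f1 f2 (Y s \<omega>))"
  shows "integrable M \<Delta>" "(LINT \<omega>|M. \<Delta> \<omega>) = 0"
proof -
  note cg = continuous_generator[OF C2]
  have f [measurable]: "f \<in> borel_measurable borel" by (rule borel_measurable_continuous_onI[OF C2_cont(1)[OF C2]])
  have [measurable]: "generator f1 f2 \<in> borel_measurable borel" by (rule borel_measurable_continuous_onI[OF cg])
  have \<Delta>m: "\<Delta> \<in> borel_measurable M"
  proof -
    have "(\<lambda>\<omega>. LINT s|lborel. indicator {0..t} s * generator f1 f2 (Y s \<omega>)) \<in> borel_measurable M"
      using measurable_occupation[of "generator f1 f2" t]
      by (intro lborel.borel_measurable_lebesgue_integral) (simp add: case_prod_beta)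
    note [measurable] = this
    show ?thesis unfolding \<Delta>_def by measurable
  qed
  let ?W = "\<lambda>n. noise_sum (t / real (Suc n)) f (Suc n)"
  have h: "0 < t / real (Suc n)" for n using t by simp
  note props = noise_sum_props[OF C2 h]
  have lim: "AE \<omega> in M. (\<lambda>n. ?W n \<omega>) \<longlonglongrightarrow> \<Delta> \<omega>"
    using good_props(2)
  proof eventually_elim
    case (elim \<omega>)
    have "(\<lambda>n. \<Sum>i<n. f (X (real i * (t / real n)) \<omega> + sqrt 2 * (B (real (Suc i) * (t / real n)) \<omega> - B (real i * (t / real n)) \<omega>))
               - heat (t / real n) f (X (real i * (t / real n)) \<omega>))
          \<longlonglongrightarrow> f (X t \<omega>) - f (X 0 \<omega>) - integral {0..t} (\<lambda>v. generator f1 f2 (X v \<omega>))"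
      by (rule noise_sum_tendsto[OF C2 t good_props(3)[OF elim] good_props(5)[OF elim]])
    moreover have "integral {0..t} (\<lambda>v. generator f1 f2 (X v \<omega>)) = integral {0..t} (\<lambda>v. generator f1 f2 (Y v \<omega>))"
      by (rule Henstock_Kurzweil_Integration.integral_cong) (simp add: Y_good[OF elim])
    ultimately have "(\<lambda>n. noise_sum (t / real n) f n \<omega>) \<longlonglongrightarrow> \<Delta> \<omega>"
      using t good_props(4)[OF elim] integral_Y(1)[OF cg, of t \<omega>] Y_good[OF elim, of t]
      by (simp add: noise_sum_def \<Delta>_def)
    then show ?case by (rule LIMSEQ_Suc)
  qed
  have meas: "?W n \<in> borel_measurable M" for n
  proof -
    have "0 \<le> real (Suc n) * (t / real (Suc n))" using t by simp
    then show ?thesis using props[of n "Suc n"] measurable_of_F by blast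
  qed
  have le: "(LINT \<omega>|M. (?W n \<omega>)\<^sup>2) \<le> 8 * b\<^sup>2 * t" for n
    using props[of n "Suc n"] by (simp del: of_nat_Suc)
  have "integrable M \<Delta> \<and> (LINT \<omega>|M. \<Delta> \<omega>) = 0"
    using expectation_zero_of_L2_bounded_limit[OF lim meas \<Delta>m _ le] props by blast
  then show "integrable M \<Delta>" "(LINT \<omega>|M. \<Delta> \<omega>) = 0" by auto
qed

end

context confining_potential
begin

section \<open>Moments along the path\<close>

definition lyap_const :: real where
  "lyap_const = (SOME C. 0 \<le> C \<and> (\<exists>f1 f2. bounded_C2 (\<lambda>x. sqrt (1 + x\<^sup>2)) f1 f2 1 \<and>
     (\<forall>x. sqrt (1 + x\<^sup>2) \<le> C - generator f1 f2 x \<and> \<bar>q1 x\<bar> \<le> 2 * (C - generator f1 f2 x))))"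

lemma lyap_const:
  obtains f1 f2 where "0 \<le> lyap_const" "bounded_C2 (\<lambda>x. sqrt (1 + x\<^sup>2)) f1 f2 1"
    "\<And>x. sqrt (1 + x\<^sup>2) \<le> lyap_const - generator f1 f2 x" "\<And>x. \<bar>q1 x\<bar> \<le> 2 * (lyap_const - generator f1 f2 x)"
proof -
  have "\<exists>C. 0 \<le> C \<and> (\<exists>f1 f2. bounded_C2 (\<lambda>x. sqrt (1 + x\<^sup>2)) f1 f2 1 \<and>
     (\<forall>x. sqrt (1 + x\<^sup>2) \<le> C - generator f1 f2 x \<and> \<bar>q1 x\<bar> \<le> 2 * (C - generator f1 f2 x)))"
    using lyapunov by blast
  from someI_ex[OF this, folded lyap_const_def] show thesis using that by blast
qed

end

context confined_langevin
begin

interpretation MT: pair_sigma_finite M lborel ..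

text \<open>
  In Dynkin's identity for \<open>f = sqrt (1 + x\<^sup>2)\<close> the term \<open>C t - \<integral> L f\<close> is nonnegative and at most
  \<open>C t + f x\<close> plus a centred variable, hence integrable.
\<close>

lemma lyapunov_occupation:
  assumes C2: "bounded_C2 (\<lambda>x. sqrt (1 + x\<^sup>2)) f1 f2 1" and t: "0 < t" and C: "0 \<le> C"
    and le: "\<And>x. sqrt (1 + x\<^sup>2) \<le> C - generator f1 f2 x"
  defines "g \<equiv> \<lambda>\<omega> s. indicator {0..t} s * (C - generator f1 f2 (Y s \<omega>))"
  shows "integrable (M \<Otimes>\<^sub>M lborel) (case_prod g)"
    and "(LINT p|(M \<Otimes>\<^sub>M lborel). case_prod g p) \<le> C * t + sqrt (1 + x\<^sup>2)"
    and "integrable M (\<lambda>\<omega>. sqrt (1 + (X t \<omega>)\<^sup>2))"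
proof -
  let ?L = "generator f1 f2" and ?f = "\<lambda>x::real. sqrt (1 + x\<^sup>2)"
  let ?\<Delta> = "\<lambda>\<omega>. ?f (Y t \<omega>) - ?f x - (LINT s|lborel. indicator {0..t} s * ?L (Y s \<omega>))"
  have \<Delta>: "integrable M ?\<Delta>" "(LINT \<omega>|M. ?\<Delta> \<omega>) = 0" using Dynkin_martingale[OF C2 t] by auto
  have cL: "continuous_on UNIV (\<lambda>x. C - ?L x)" by (intro continuous_intros continuous_generator[OF C2])
  note [measurable] = borel_measurable_continuous_onI[OF cL]
  have t0: "0 \<le> t" using t by simp
  have g0: "0 \<le> g \<omega> s" for \<omega> s
  proof -
    have "0 \<le> C - ?L (Y s \<omega>)" by (rule order.trans[OF _ le]) (simp add: add_nonneg_nonneg)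
    then show ?thesis unfolding g_def by simp
  qed
  have gm: "case_prod g \<in> borel_measurable (M \<Otimes>\<^sub>M lborel)"
    using measurable_occupation[of "\<lambda>x. C - ?L x" t] unfolding g_def by (simp add: case_prod_beta')
  have gi: "integrable lborel (g \<omega>)" for \<omega> unfolding g_def by (rule integral_Y(2)[OF cL t0])
  have J: "(LINT s|lborel. g \<omega> s) = C * t + ?\<Delta> \<omega> + ?f x - ?f (Y t \<omega>)" for \<omega>
  proof -
    have i: "integrable lborel (\<lambda>s. indicator {0..t} s * ?L (Y s \<omega>))" by (rule integral_Y(2)[OF continuous_generator[OF C2] t0])
    have "(LINT s|lborel. g \<omega> s) = (LINT s|lborel. C * indicator {0..t} s - indicator {0..t} s * ?L (Y s \<omega>))"
      unfolding g_def by (simp add: algebra_simps)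
    also have "\<dots> = (LINT s|lborel. C * indicator {0..t} s) - (LINT s|lborel. indicator {0..t} s * ?L (Y s \<omega>))"
      by (rule Bochner_Integration.integral_diff[OF _ i]) (use t0 in simp)
    finally show ?thesis using t0 by simp
  qed
  have int\<Delta>: "integrable M (\<lambda>\<omega>. C * t + ?f x + ?\<Delta> \<omega>)" by (rule Bochner_Integration.integrable_add[OF _ \<Delta>(1)]) simp
  have J_le: "(LINT s|lborel. g \<omega> s) \<le> C * t + ?f x + ?\<Delta> \<omega>" for \<omega>
    unfolding J by (simp add: add_nonneg_nonneg)
  have J0: "0 \<le> (LINT s|lborel. g \<omega> s)" for \<omega> using g0 by simp
  have nn: "(\<integral>\<^sup>+p. ennreal (case_prod g p) \<partial>(M \<Otimes>\<^sub>M lborel)) \<le> ennreal (C * t + ?f x)"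
  proof -
    have "(\<integral>\<^sup>+p. ennreal (case_prod g p) \<partial>(M \<Otimes>\<^sub>M lborel)) = (\<integral>\<^sup>+\<omega>. \<integral>\<^sup>+s. ennreal (g \<omega> s) \<partial>lborel \<partial>M)"
      using lborel.nn_integral_fst[of "\<lambda>p. ennreal (case_prod g p)" M] gm by simp
    also have "\<dots> = (\<integral>\<^sup>+\<omega>. ennreal (LINT s|lborel. g \<omega> s) \<partial>M)"
      using gi g0 by (intro nn_integral_cong nn_integral_eq_integral) auto
    also have "\<dots> \<le> (\<integral>\<^sup>+\<omega>. ennreal (C * t + ?f x + ?\<Delta> \<omega>) \<partial>M)"
      using J_le by (intro nn_integral_mono ennreal_leI)
    also have "\<dots> = ennreal (LINT \<omega>|M. C * t + ?f x + ?\<Delta> \<omega>)"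
      using order.trans[OF J0 J_le] by (intro nn_integral_eq_integral int\<Delta>) auto
    also have "(LINT \<omega>|M. C * t + ?f x + ?\<Delta> \<omega>) = C * t + ?f x"
      by (subst Bochner_Integration.integral_add[OF _ \<Delta>(1)]) (use \<Delta>(2) prob_space in auto)
    finally show ?thesis .
  qed
  show gint: "integrable (M \<Otimes>\<^sub>M lborel) (case_prod g)"
    using gm g0 nn by (intro integrableI_nonneg) (auto intro: le_less_trans simp: case_prod_beta')
  show "(LINT p|(M \<Otimes>\<^sub>M lborel). case_prod g p) \<le> C * t + sqrt (1 + x\<^sup>2)"
  proof -
    have "ennreal (LINT p|(M \<Otimes>\<^sub>M lborel). case_prod g p) = (\<integral>\<^sup>+p. ennreal (case_prod g p) \<partial>(M \<Otimes>\<^sub>M lborel))"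
      using g0 by (intro nn_integral_eq_integral[symmetric] gint) (auto simp: case_prod_beta')
    then have "ennreal (LINT p|(M \<Otimes>\<^sub>M lborel). case_prod g p) \<le> ennreal (C * t + sqrt (1 + x\<^sup>2))"
      using nn by (simp only:)
    moreover have "0 \<le> C * t + sqrt (1 + x\<^sup>2)" using C t0 by (simp add: add_nonneg_nonneg)
    ultimately show ?thesis using ennreal_le_iff by blast
  qed
  have "integrable M (\<lambda>\<omega>. C * t + ?\<Delta> \<omega> + ?f x - (LINT s|lborel. g \<omega> s))"
    by (intro Bochner_Integration.integrable_diff[OF Bochner_Integration.integrable_add[OF
          Bochner_Integration.integrable_add[OF _ \<Delta>(1)]] MT.integrable_fst[OF gint]]) auto
  then have "integrable M (\<lambda>\<omega>. ?f (Y t \<omega>))" unfolding J by simp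
  then show "integrable M (\<lambda>\<omega>. ?f (X t \<omega>))" using expectation_Y(2)[OF t0, of ?f] by simp
qed

lemma occupation_integrable:
  fixes g :: "real \<Rightarrow> real"
  assumes [measurable]: "g \<in> borel_measurable borel" and g: "\<And>u. \<bar>g u\<bar> \<le> a * (1 + sqrt (1 + u\<^sup>2) + \<bar>q1 u\<bar>)"
    and t: "0 < t" and a: "0 \<le> a"
  shows "integrable (M \<Otimes>\<^sub>M lborel) (case_prod (\<lambda>\<omega> s. indicator {0..t} s * g (Y s \<omega>)))"
proof -
  obtain f1 f2 where L: "0 \<le> lyap_const" "bounded_C2 (\<lambda>x. sqrt (1 + x\<^sup>2)) f1 f2 1"
    "\<And>x. sqrt (1 + x\<^sup>2) \<le> lyap_const - generator f1 f2 x" "\<And>x. \<bar>q1 x\<bar> \<le> 2 * (lyap_const - generator f1 f2 x)"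
    by (rule lyap_const) (rule that)
  let ?g = "\<lambda>\<omega> s. indicator {0..t} s * (lyap_const - generator f1 f2 (Y s \<omega>))"
  have dom: "integrable (M \<Otimes>\<^sub>M lborel) (\<lambda>p. (4 * a) * case_prod ?g p)"
    using lyapunov_occupation(1)[OF L(2) t L(1,3)] by (rule integrable_mult_right)
  show ?thesis
  proof (rule Bochner_Integration.integrable_bound[OF dom])
    show "case_prod (\<lambda>\<omega> s. indicator {0..t} s * g (Y s \<omega>)) \<in> borel_measurable (M \<Otimes>\<^sub>M lborel)"
      using measurable_occupation[of g t] by (simp add: case_prod_beta')
    have le: "\<bar>g u\<bar> \<le> (4 * a) * (lyap_const - generator f1 f2 u)" for u
    proof -
      have "1 \<le> sqrt (1 + u\<^sup>2)" by simp
      moreover have "1 + v + w \<le> 4 * d" if "1 \<le> v" "v \<le> d" "w \<le> 2 * d" for v w d :: real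
        using that by linarith
      ultimately have "1 + sqrt (1 + u\<^sup>2) + \<bar>q1 u\<bar> \<le> 4 * (lyap_const - generator f1 f2 u)" using L(3,4)[of u] by blast
      from mult_left_mono[OF this a] show ?thesis using g[of u] by (simp add: mult.assoc mult.left_commute)
    qed
    have "norm (indicator {0..t} s * g u) \<le> norm ((4 * a) * (indicator {0..t} s * (lyap_const - generator f1 f2 u)))" for s u :: real
      using order.trans[OF le[of u] abs_ge_self] by (auto simp: indicator_def abs_mult)
    then show "AE p in (M \<Otimes>\<^sub>M lborel). norm (case p of (\<omega>, s) \<Rightarrow> indicator {0..t} s * g (Y s \<omega>)) \<le> norm ((4 * a) * case_prod ?g p)"
      by (intro AE_I2) (simp add: case_prod_beta')
  qed
qed

lemma occupation_Fubini:
  fixes g :: "real \<Rightarrow> real"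
  assumes gm: "g \<in> borel_measurable borel" and g: "\<And>u. \<bar>g u\<bar> \<le> a * (1 + sqrt (1 + u\<^sup>2) + \<bar>q1 u\<bar>)"
    and t: "0 < t" and a: "0 \<le> a"
  shows "integrable lborel (\<lambda>s. indicator {0..t} s * (LINT \<omega>|M. g (X s \<omega>)))"
    and "(LINT \<omega>|M. LINT s|lborel. indicator {0..t} s * g (Y s \<omega>)) = (LINT s|lborel. indicator {0..t} s * (LINT \<omega>|M. g (X s \<omega>)))"
    and "AE s in lborel. s \<in> {0..t} \<longrightarrow> integrable M (\<lambda>\<omega>. g (X s \<omega>))"
    and "(LINT s|lborel. indicator {0..t} s * (LINT \<omega>|M. g (X s \<omega>)))
      = (LINT p|(M \<Otimes>\<^sub>M lborel). case_prod (\<lambda>\<omega> s. indicator {0..t} s * g (Y s \<omega>)) p)"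
proof -
  note i = occupation_integrable[OF gm g t a]
  have eq: "(LINT \<omega>|M. indicator {0..t} s * g (Y s \<omega>)) = indicator {0..t} s * (LINT \<omega>|M. g (X s \<omega>))" for s
    using expectation_Y(1)[OF _ gm, of s] by (cases "s \<in> {0..t}") auto
  show "integrable lborel (\<lambda>s. indicator {0..t} s * (LINT \<omega>|M. g (X s \<omega>)))"
    using MT.integrable_snd[OF i] unfolding eq .
  show "(LINT \<omega>|M. LINT s|lborel. indicator {0..t} s * g (Y s \<omega>)) = (LINT s|lborel. indicator {0..t} s * (LINT \<omega>|M. g (X s \<omega>)))"
    using MT.integral_snd[OF i] MT.integral_fst[OF i] unfolding eq by simp
  show "(LINT s|lborel. indicator {0..t} s * (LINT \<omega>|M. g (X s \<omega>)))
      = (LINT p|(M \<Otimes>\<^sub>M lborel). case_prod (\<lambda>\<omega> s. indicator {0..t} s * g (Y s \<omega>)) p)"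
    using MT.integral_snd[OF i] unfolding eq .
  show "AE s in lborel. s \<in> {0..t} \<longrightarrow> integrable M (\<lambda>\<omega>. g (X s \<omega>))"
    using MT.AE_integrable_snd[OF i]
  proof eventually_elim
    case (elim s)
    then show ?case using expectation_Y(2)[OF _ gm, of s] by auto
  qed
qed

lemma integrable_X:
  assumes "0 < t"
  shows "integrable M (\<lambda>\<omega>. sqrt (1 + (X t \<omega>)\<^sup>2))" and "integrable M (X t)"
proof -
  obtain f1 f2 where L: "0 \<le> lyap_const" "bounded_C2 (\<lambda>x. sqrt (1 + x\<^sup>2)) f1 f2 1"
    "\<And>x. sqrt (1 + x\<^sup>2) \<le> lyap_const - generator f1 f2 x" "\<And>x. \<bar>q1 x\<bar> \<le> 2 * (lyap_const - generator f1 f2 x)"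
    by (rule lyap_const) (rule that)
  show i: "integrable M (\<lambda>\<omega>. sqrt (1 + (X t \<omega>)\<^sup>2))" by (rule lyapunov_occupation(3)[OF L(2) assms L(1,3)])
  have "\<bar>u\<bar> \<le> \<bar>sqrt (1 + u\<^sup>2)\<bar>" for u :: real by (rule order.trans[OF real_le_rsqrt abs_ge_self]) simp
  then show "integrable M (X t)"
    using assms by (intro Bochner_Integration.integrable_bound[OF i]) (auto intro!: AE_I2)
qed

lemma occupation_moment:
  assumes "0 < t"
  shows "(LINT s|lborel. indicator {0..t} s * (LINT \<omega>|M. sqrt (1 + (X s \<omega>)\<^sup>2))) \<le> lyap_const * t + sqrt (1 + x\<^sup>2)"
proof -
  obtain f1 f2 where L: "0 \<le> lyap_const" "bounded_C2 (\<lambda>x. sqrt (1 + x\<^sup>2)) f1 f2 1"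
    "\<And>x. sqrt (1 + x\<^sup>2) \<le> lyap_const - generator f1 f2 x" "\<And>x. \<bar>q1 x\<bar> \<le> 2 * (lyap_const - generator f1 f2 x)"
    by (rule lyap_const) (rule that)
  let ?f = "\<lambda>x::real. sqrt (1 + x\<^sup>2)"
  have le: "\<bar>?f u\<bar> \<le> 1 * (1 + sqrt (1 + u\<^sup>2) + \<bar>q1 u\<bar>)" for u by simp
  have m: "?f \<in> borel_measurable borel" by measurable
  have "(LINT s|lborel. indicator {0..t} s * (LINT \<omega>|M. ?f (X s \<omega>)))
      = (LINT p|(M \<Otimes>\<^sub>M lborel). case_prod (\<lambda>\<omega> s. indicator {0..t} s * ?f (Y s \<omega>)) p)"
    by (rule occupation_Fubini(4)[OF m le assms]) simp
  also have "\<dots> \<le> (LINT p|(M \<Otimes>\<^sub>M lborel). case_prod (\<lambda>\<omega> s. indicator {0..t} s * (lyap_const - generator f1 f2 (Y s \<omega>))) p)"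
  proof (rule integral_mono[OF occupation_integrable[OF m le assms] lyapunov_occupation(1)[OF L(2) assms L(1,3)]])
    show "(case p of (\<omega>, s) \<Rightarrow> indicator {0..t} s * ?f (Y s \<omega>)) \<le> (case p of (\<omega>, s) \<Rightarrow> indicator {0..t} s * (lyap_const - generator f1 f2 (Y s \<omega>)))" for p
      using L(3)[of "Y (snd p) (fst p)"] by (auto simp: case_prod_beta' indicator_def)
  qed simp
  also have "\<dots> \<le> lyap_const * t + sqrt (1 + x\<^sup>2)" by (rule lyapunov_occupation(2)[OF L(2) assms L(1,3)])
  finally show ?thesis .
qed

lemma generator_growth:
  assumes "bounded_C2 f f1 f2 b"
  shows "\<bar>generator f1 f2 u\<bar> \<le> b * (1 + sqrt (1 + u\<^sup>2) + \<bar>q1 u\<bar>)"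
proof -
  note bd = C2_bound[OF assms] and b = C2_nonneg[OF assms]
  have "\<bar>generator f1 f2 u\<bar> \<le> b + \<bar>q1 u\<bar> * b"
    using bd(2)[of u] mult_left_mono[OF bd(1)[of u] abs_ge_zero[of "q1 u"]] unfolding generator_def abs_mult[symmetric] by linarith
  also have "\<dots> \<le> b * (1 + sqrt (1 + u\<^sup>2) + \<bar>q1 u\<bar>)" using b by (simp add: algebra_simps)
  finally show ?thesis .
qed

text \<open>
  The generator of a test function grows at most like \<open>1 + \<bar>q'\<bar>\<close>, which is integrable along the path,
  so expectation and time integral can be exchanged.
\<close>

lemma Dynkin:
  assumes C2: "bounded_C2 f f1 f2 b" and t: "0 < t"
  shows "integrable M (\<lambda>\<omega>. f (X t \<omega>))"
    and "(LINT \<omega>|M. f (X t \<omega>)) = f x + (LINT s|lborel. indicator {0..t} s * (LINT \<omega>|M. generator f1 f2 (X s \<omega>)))"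
proof -
  have t0: "0 \<le> t" using t by simp
  have f: "f \<in> borel_measurable borel" by (rule borel_measurable_continuous_onI[OF C2_cont(1)[OF C2]])
  have gm: "generator f1 f2 \<in> borel_measurable borel" by (rule borel_measurable_continuous_onI[OF continuous_generator[OF C2]])
  note Fub = occupation_Fubini[OF gm generator_growth[OF C2] t C2_nonneg[OF C2]]
  note i = occupation_integrable[OF gm generator_growth[OF C2] t C2_nonneg[OF C2]]
  let ?I = "\<lambda>\<omega>. LINT s|lborel. indicator {0..t} s * generator f1 f2 (Y s \<omega>)"
  let ?\<Delta> = "\<lambda>\<omega>. f (Y t \<omega>) - f x - ?I \<omega>"
  have \<Delta>: "integrable M ?\<Delta>" "(LINT \<omega>|M. ?\<Delta> \<omega>) = 0" using Dynkin_martingale[OF C2 t] by auto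
  have iI: "integrable M ?I" by (rule MT.integrable_fst[OF i])
  have "integrable M (\<lambda>\<omega>. ?\<Delta> \<omega> + (f x + ?I \<omega>))"
    using \<Delta>(1) iI by (intro Bochner_Integration.integrable_add) auto
  then have iY: "integrable M (\<lambda>\<omega>. f (Y t \<omega>))" by simp
  then show "integrable M (\<lambda>\<omega>. f (X t \<omega>))" using expectation_Y(2)[OF t0 f] by simp
  have "(LINT \<omega>|M. ?\<Delta> \<omega>) = (LINT \<omega>|M. f (Y t \<omega>)) - f x - (LINT \<omega>|M. ?I \<omega>)"
    using iY iI prob_space by (simp add: Bochner_Integration.integral_diff)
  then show "(LINT \<omega>|M. f (X t \<omega>)) = f x + (LINT s|lborel. indicator {0..t} s * (LINT \<omega>|M. generator f1 f2 (X s \<omega>)))"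
    using \<Delta>(2) Fub(2) expectation_Y(1)[OF t0 f] by simp
qed

end

section \<open>Wasserstein distance on the line\<close>

lemma nn_integral_between:
  fixes a b :: real
  shows "(\<integral>\<^sup>+u. indicator {u. (a \<le> u) \<noteq> (b \<le> u)} u \<partial>lborel) = ennreal \<bar>a - b\<bar>"
proof -
  have "{u. (a \<le> u) \<noteq> (b \<le> u)} = {min a b..<max a b}" by auto
  then show ?thesis by (simp add: min_def max_def)
qed

lemma nn_integral_between_unit:
  fixes p p' :: real
  assumes "0 \<le> p" "p \<le> 1" "0 \<le> p'" "p' \<le> 1"
  shows "(\<integral>\<^sup>+v. indicator {v. 0 < v \<and> v < 1 \<and> (v \<le> p) \<noteq> (v \<le> p')} v \<partial>lborel) = ennreal \<bar>p - p'\<bar>"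
proof -
  let ?S = "{v::real. 0 < v \<and> v < 1 \<and> (v \<le> p) \<noteq> (v \<le> p')}"
  have "(\<integral>\<^sup>+v. indicator ?S v \<partial>lborel) = (\<integral>\<^sup>+v. indicator {min p p'<..max p p'} v \<partial>(lborel :: real measure))"
  proof (rule nn_integral_cong_AE)
    show "AE v in lborel. (indicator ?S v :: ennreal) = indicator {min p p'<..max p p'} v"
      using AE_lborel_singleton[of 1] by eventually_elim (use assms in \<open>auto simp: indicator_def\<close>)
  qed
  then show ?thesis by (simp add: min_def max_def)
qed

abbreviation cdf_distance :: "real measure \<Rightarrow> real measure \<Rightarrow> ennreal" where
  "cdf_distance \<mu> \<nu> \<equiv> \<integral>\<^sup>+u. ennreal \<bar>cdf \<mu> u - cdf \<nu> u\<bar> \<partial>lborel"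

text \<open>
  Both laws are images of Lebesgue measure on \<open>(0, 1)\<close> under their quantile functions.  The distance of
  two numbers is the measure of the set of levels \<open>u\<close> that separate them, and \<open>u\<close> separates the two
  quantiles of \<open>\<omega>\<close> exactly when \<open>\<omega>\<close> separates the values of the two distribution functions at \<open>u\<close>;
  exchanging the integrals gives the formula.
\<close>

lemma quantile_coupling:
  assumes "real_distribution \<mu>" "real_distribution \<nu>"
  obtains I J :: "real \<Rightarrow> real" and \<Omega> :: "real measure" where
    "prob_space \<Omega>" "I \<in> borel_measurable \<Omega>" "J \<in> borel_measurable \<Omega>"
    "distr \<Omega> borel I = \<mu>" "distr \<Omega> borel J = \<nu>"
    "(\<integral>\<^sup>+\<omega>. ennreal \<bar>I \<omega> - J \<omega>\<bar> \<partial>\<Omega>) = cdf_distance \<mu> \<nu>"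
    "(\<forall>u. cdf \<nu> u \<le> cdf \<mu> u) \<longrightarrow> (\<forall>\<omega>\<in>space \<Omega>. I \<omega> \<le> J \<omega>)"
proof -
  interpret \<mu>: cdf_distribution \<mu> using assms(1) by (simp add: cdf_distribution_def)
  interpret \<nu>: cdf_distribution \<nu> using assms(2) by (simp add: cdf_distribution_def)
  define \<Omega> :: "real measure" where "\<Omega> = restrict_space lborel {0<..<1}"
  define I where "I = (\<lambda>\<omega>. \<mu>.I \<omega>)"
  define J where "J = (\<lambda>\<omega>. \<nu>.I \<omega>)"
  have I: "\<omega> \<le> cdf \<mu> u \<longleftrightarrow> I \<omega> \<le> u" and J: "\<omega> \<le> cdf \<nu> u \<longleftrightarrow> J \<omega> \<le> u" if "0 < \<omega>" "\<omega> < 1" for \<omega> u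
    unfolding I_def J_def by (rule \<mu>.pseudoinverse[OF that], rule \<nu>.pseudoinverse[OF that])
  have P: "prob_space \<Omega>"
    unfolding \<Omega>_def by (auto simp: emeasure_restrict_space space_restrict_space intro!: prob_spaceI)
  have \<Omega>I: "I \<in> borel_measurable \<Omega>" "J \<in> borel_measurable \<Omega>"
  proof -
    have "sets \<Omega> = sets (restrict_space borel {0<..<1::real})"
      unfolding \<Omega>_def by (intro sets_restrict_space_cong) simp
    then show "I \<in> borel_measurable \<Omega>" "J \<in> borel_measurable \<Omega>"
      using \<mu>.measurable_CI \<nu>.measurable_CI unfolding I_def J_def by (auto cong: measurable_cong_sets)
  qed
  let ?D = "{p. 0 < fst p \<and> fst p < 1 \<and> (fst p \<le> cdf \<mu> (snd p)) \<noteq> (fst p \<le> cdf \<nu> (snd p))}"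
  have D: "?D \<in> sets (lborel \<Otimes>\<^sub>M lborel)"
  proof -
    have "{p \<in> space (borel \<Otimes>\<^sub>M borel). 0 < fst p \<and> fst p < 1 \<and> (fst p \<le> cdf \<mu> (snd p)) \<noteq> (fst p \<le> cdf \<nu> (snd p))} \<in> sets (borel \<Otimes>\<^sub>M borel)"
      by measurable
    moreover have "sets (lborel \<Otimes>\<^sub>M lborel) = sets (borel \<Otimes>\<^sub>M (borel :: real measure))"
      by (intro sets_pair_measure_cong) auto
    ultimately show ?thesis by (simp add: space_pair_measure)
  qed
  have "(\<integral>\<^sup>+\<omega>. ennreal \<bar>I \<omega> - J \<omega>\<bar> \<partial>\<Omega>) = (\<integral>\<^sup>+\<omega>. ennreal \<bar>I \<omega> - J \<omega>\<bar> * indicator {0<..<1} \<omega> \<partial>lborel)"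
    unfolding \<Omega>_def by (rule nn_integral_restrict_space) simp
  also have "\<dots> = (\<integral>\<^sup>+\<omega>. \<integral>\<^sup>+u. indicator ?D (\<omega>, u) \<partial>lborel \<partial>lborel)"
  proof (rule nn_integral_cong)
    fix \<omega> :: real
    show "ennreal \<bar>I \<omega> - J \<omega>\<bar> * indicator {0<..<1} \<omega> = (\<integral>\<^sup>+u. indicator ?D (\<omega>, u) \<partial>lborel)"
    proof (cases "0 < \<omega> \<and> \<omega> < 1")
      case True
      have "(\<integral>\<^sup>+u. indicator ?D (\<omega>, u) \<partial>lborel) = (\<integral>\<^sup>+u. indicator {u. (I \<omega> \<le> u) \<noteq> (J \<omega> \<le> u)} u \<partial>lborel)"
        using True I J by (intro nn_integral_cong) (auto simp: indicator_def)
      then show ?thesis using True nn_integral_between by simp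
    qed (auto simp: indicator_def)
  qed
  also have "\<dots> = (\<integral>\<^sup>+u. \<integral>\<^sup>+\<omega>. indicator ?D (\<omega>, u) \<partial>lborel \<partial>lborel)"
    using D by (intro lborel_pair.Fubini'[symmetric]) simp
  also have "\<dots> = cdf_distance \<mu> \<nu>"
  proof (rule nn_integral_cong)
    fix u
    have "(\<integral>\<^sup>+\<omega>. indicator ?D (\<omega>, u) \<partial>lborel) = (\<integral>\<^sup>+\<omega>. indicator {v. 0 < v \<and> v < 1 \<and> (v \<le> cdf \<mu> u) \<noteq> (v \<le> cdf \<nu> u)} \<omega> \<partial>lborel)"
      by (intro nn_integral_cong) (auto simp: indicator_def)
    also have "\<dots> = ennreal \<bar>cdf \<mu> u - cdf \<nu> u\<bar>"
      by (rule nn_integral_between_unit) (auto simp: \<mu>.cdf_nonneg \<nu>.cdf_nonneg \<mu>.cdf_bounded_prob \<nu>.cdf_bounded_prob)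
    finally show "(\<integral>\<^sup>+\<omega>. indicator ?D (\<omega>, u) \<partial>lborel) = ennreal \<bar>cdf \<mu> u - cdf \<nu> u\<bar>" .
  qed
  finally have eq: "(\<integral>\<^sup>+\<omega>. ennreal \<bar>I \<omega> - J \<omega>\<bar> \<partial>\<Omega>) = cdf_distance \<mu> \<nu>" .
  show thesis
  proof (rule that[OF P \<Omega>I _ _ eq])
    show "distr \<Omega> borel I = \<mu>" "distr \<Omega> borel J = \<nu>"
      using \<mu>.distr_I_eq_M \<nu>.distr_I_eq_M unfolding \<Omega>_def I_def J_def by auto
    show "(\<forall>u. cdf \<nu> u \<le> cdf \<mu> u) \<longrightarrow> (\<forall>\<omega>\<in>space \<Omega>. I \<omega> \<le> J \<omega>)"
    proof (intro impI ballI)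
      fix \<omega> assume le: "\<forall>u. cdf \<nu> u \<le> cdf \<mu> u" and "\<omega> \<in> space \<Omega>"
      then have \<omega>: "0 < \<omega>" "\<omega> < 1" by (auto simp: \<Omega>_def space_restrict_space)
      have "\<omega> \<le> cdf \<nu> (J \<omega>)" using J[OF \<omega>] by simp
      also have "\<dots> \<le> cdf \<mu> (J \<omega>)" using le by blast
      finally show "I \<omega> \<le> J \<omega>" using I[OF \<omega>] by simp
    qed
  qed
qed

lemma wasserstein_le_cdf:
  assumes "real_distribution \<mu>" "real_distribution \<nu>"
  shows "wasserstein \<mu> \<nu> \<le> cdf_distance \<mu> \<nu>"
proof -
  obtain I J :: "real \<Rightarrow> real" and \<Omega> :: "real measure" where c:
    "prob_space \<Omega>" "I \<in> borel_measurable \<Omega>" "J \<in> borel_measurable \<Omega>"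
    "distr \<Omega> borel I = \<mu>" "distr \<Omega> borel J = \<nu>"
    "(\<integral>\<^sup>+\<omega>. ennreal \<bar>I \<omega> - J \<omega>\<bar> \<partial>\<Omega>) = cdf_distance \<mu> \<nu>"
    "(\<forall>u. cdf \<nu> u \<le> cdf \<mu> u) \<longrightarrow> (\<forall>\<omega>\<in>space \<Omega>. I \<omega> \<le> J \<omega>)"
    by (rule quantile_coupling[OF assms(1,2)]) (rule that)
  have IJ: "(\<lambda>\<omega>. (I \<omega>, J \<omega>)) \<in> measurable \<Omega> borel"
    using c(2,3) by (rule borel_measurable_Pair)
  have m: "fst \<in> borel_measurable (borel :: (real \<times> real) measure)" "snd \<in> borel_measurable (borel :: (real \<times> real) measure)"
    by (auto intro!: borel_measurable_continuous_onI continuous_intros)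
  have "distr \<Omega> borel (\<lambda>\<omega>. (I \<omega>, J \<omega>)) \<in> couplings \<mu> \<nu>"
    unfolding couplings_def
    using prob_space.prob_space_distr[OF c(1) IJ] distr_distr[OF m(1) IJ] distr_distr[OF m(2) IJ] c(4,5)
    by (simp add: comp_def)
  then have "wasserstein \<mu> \<nu> \<le> (\<integral>\<^sup>+z. ennreal \<bar>fst z - snd z\<bar> \<partial>distr \<Omega> borel (\<lambda>\<omega>. (I \<omega>, J \<omega>)))"
    unfolding wasserstein_def by (rule INF_lower)
  also have "\<dots> = (\<integral>\<^sup>+\<omega>. ennreal \<bar>I \<omega> - J \<omega>\<bar> \<partial>\<Omega>)"
    using m by (subst nn_integral_distr[OF IJ]) auto
  finally show ?thesis using c(6) by simp
qed

lemma integral_mono_stochastic_order: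
  fixes f :: "real \<Rightarrow> real"
  assumes "real_distribution \<mu>" "real_distribution \<nu>" and le: "\<And>u. cdf \<nu> u \<le> cdf \<mu> u"
    and f: "mono f" "integrable \<mu> f" "integrable \<nu> f"
  shows "(LINT u|\<mu>. f u) \<le> (LINT u|\<nu>. f u)"
proof -
  obtain I J :: "real \<Rightarrow> real" and \<Omega> :: "real measure" where c:
    "prob_space \<Omega>" "I \<in> borel_measurable \<Omega>" "J \<in> borel_measurable \<Omega>"
    "distr \<Omega> borel I = \<mu>" "distr \<Omega> borel J = \<nu>"
    "(\<integral>\<^sup>+\<omega>. ennreal \<bar>I \<omega> - J \<omega>\<bar> \<partial>\<Omega>) = cdf_distance \<mu> \<nu>"
    "(\<forall>u. cdf \<nu> u \<le> cdf \<mu> u) \<longrightarrow> (\<forall>\<omega>\<in>space \<Omega>. I \<omega> \<le> J \<omega>)"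
    by (rule quantile_coupling[OF assms(1,2)]) (rule that)
  have le': "\<And>\<omega>. \<omega> \<in> space \<Omega> \<Longrightarrow> I \<omega> \<le> J \<omega>" using c(7) le by blast
  have fm: "f \<in> borel_measurable borel" by (rule borel_measurable_mono[OF f(1)])
  have "(LINT u|\<mu>. f u) = (LINT \<omega>|\<Omega>. f (I \<omega>))" unfolding c(4)[symmetric] by (rule integral_distr[OF c(2) fm])
  also have "\<dots> \<le> (LINT \<omega>|\<Omega>. f (J \<omega>))"
    using f(2,3) integrable_distr_eq[OF c(2) fm] integrable_distr_eq[OF c(3) fm] c(4,5) le'
    by (intro integral_mono monoD[OF f(1)]) auto
  also have "\<dots> = (LINT u|\<nu>. f u)" unfolding c(5)[symmetric] by (rule integral_distr[OF c(3) fm, symmetric])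
  finally show ?thesis .
qed

lemma cdf_distance_stochastic_order:
  assumes "real_distribution \<mu>" "real_distribution \<nu>" and le: "\<And>u. cdf \<nu> u \<le> cdf \<mu> u"
    and f: "integrable \<mu> (\<lambda>u. u)" "integrable \<nu> (\<lambda>u. u)"
  shows "cdf_distance \<mu> \<nu> = ennreal ((LINT u|\<nu>. u) - (LINT u|\<mu>. u))"
proof -
  obtain I J :: "real \<Rightarrow> real" and \<Omega> :: "real measure" where c:
    "prob_space \<Omega>" "I \<in> borel_measurable \<Omega>" "J \<in> borel_measurable \<Omega>"
    "distr \<Omega> borel I = \<mu>" "distr \<Omega> borel J = \<nu>"
    "(\<integral>\<^sup>+\<omega>. ennreal \<bar>I \<omega> - J \<omega>\<bar> \<partial>\<Omega>) = cdf_distance \<mu> \<nu>"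
    "(\<forall>u. cdf \<nu> u \<le> cdf \<mu> u) \<longrightarrow> (\<forall>\<omega>\<in>space \<Omega>. I \<omega> \<le> J \<omega>)"
    by (rule quantile_coupling[OF assms(1,2)]) (rule that)
  have le': "\<And>\<omega>. \<omega> \<in> space \<Omega> \<Longrightarrow> I \<omega> \<le> J \<omega>" using c(7) le by blast
  have id: "(\<lambda>u::real. u) \<in> borel_measurable borel" by simp
  have i: "integrable \<Omega> I" "integrable \<Omega> J"
    using f integrable_distr_eq[OF c(2) id] integrable_distr_eq[OF c(3) id] c(4,5) by auto
  have "(\<integral>\<^sup>+\<omega>. ennreal \<bar>I \<omega> - J \<omega>\<bar> \<partial>\<Omega>) = (\<integral>\<^sup>+\<omega>. ennreal (J \<omega> - I \<omega>) \<partial>\<Omega>)"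
    using le' by (intro nn_integral_cong) simp
  also have "\<dots> = ennreal (LINT \<omega>|\<Omega>. J \<omega> - I \<omega>)"
    using le' i by (intro nn_integral_eq_integral AE_I2) auto
  also have "(LINT \<omega>|\<Omega>. J \<omega> - I \<omega>) = (LINT u|\<nu>. u) - (LINT u|\<mu>. u)"
    using i integral_distr[OF c(2) id] integral_distr[OF c(3) id] c(4,5) by simp
  finally show ?thesis using c(6) by simp
qed

text \<open>
  A Lipschitz approximation from below of the indicator of \<open>{u<..}\<close>, which transfers statements about
  continuous test functions to distribution functions.
\<close>

definition ramp :: "nat \<Rightarrow> real \<Rightarrow> real \<Rightarrow> real" where
  "ramp m u z = max 0 (min 1 (real m * (z - u)))"

lemma ramp_mono: "mono (ramp m u)"
  unfolding ramp_def by (intro monoI max.mono min.mono mult_left_mono) auto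

lemma ramp_bounded: "0 \<le> ramp m u z" "ramp m u z \<le> 1" "\<bar>ramp m u z\<bar> \<le> 1"
  by (auto simp: ramp_def)

lemma ramp_Lipschitz: "\<bar>ramp m u z - ramp m u' z'\<bar> \<le> real m * \<bar>z - z'\<bar> + real m * \<bar>u - u'\<bar>"
proof -
  have "\<bar>ramp m u z - ramp m u' z'\<bar> \<le> \<bar>real m * (z - u) - real m * (z' - u')\<bar>"
    unfolding ramp_def by linarith
  also have "\<dots> = \<bar>real m * (z - z') - real m * (u - u')\<bar>" by (simp add: algebra_simps)
  also have "\<dots> \<le> \<bar>real m * (z - z')\<bar> + \<bar>real m * (u - u')\<bar>" by (rule abs_triangle_ineq4)
  finally show ?thesis by (simp add: abs_mult)
qed

lemma continuous_ramp: "continuous_on A (ramp m u)"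
  unfolding ramp_def[abs_def] by (intro continuous_intros)

lemma ramp_tendsto: "(\<lambda>m. ramp m u z) \<longlonglongrightarrow> indicator {u<..} z"
proof (cases "u < z")
  case True
  obtain N :: nat where N: "1 / (z - u) < real N" using reals_Archimedean2 by blast
  have "ramp m u z = 1" if "N \<le> m" for m
  proof -
    have "1 / (z - u) \<le> real m" using N that by linarith
    then have "1 \<le> real m * (z - u)" using True by (simp add: field_simps)
    then show ?thesis by (simp add: ramp_def)
  qed
  then have "\<forall>\<^sub>F m in sequentially. ramp m u z = 1" by (auto simp: eventually_sequentially)
  then show ?thesis using True by (simp add: tendsto_eventually)
next
  case False
  have "ramp m u z = 0" for m
  proof -
    have "real m * (z - u) \<le> 0" using False by (simp add: mult_le_0_iff)
    then show ?thesis by (simp add: ramp_def)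
  qed
  then show ?thesis using False by simp
qed

lemma (in real_distribution) integral_ramp_tendsto:
  "(\<lambda>m. LINT z|M. ramp m u z) \<longlonglongrightarrow> 1 - cdf M u"
proof -
  have [measurable]: "ramp m u \<in> borel_measurable borel" for m
    by (rule borel_measurable_continuous_onI[OF continuous_ramp])
  have "(\<lambda>m. LINT z|M. ramp m u z) \<longlonglongrightarrow> (LINT z|M. indicator {u<..} z)"
    by (rule integral_dominated_convergence[where w = "\<lambda>_. 1"]) (auto simp: ramp_bounded ramp_tendsto)
  moreover have "(LINT z|M. indicator {u<..} z) = measure M {u<..}"
    by simp
  moreover have "measure M {u<..} = 1 - cdf M u"
  proof -
    have "{u<..} = space M - {..u}" by auto
    then show ?thesis using prob_compl[of "{..u}"] by (simp add: cdf_def)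
  qed
  ultimately show ?thesis by simp
qed

section \<open>Exponential contraction\<close>

lemma integral_degenerate_interval:
  fixes g :: "real \<Rightarrow> real"
  shows "(LINT s|lborel. indicator {0..0::real} s * g s) = 0"
  by (rule integral_eq_zero_AE) (use AE_lborel_singleton[of "0::real"] in \<open>eventually_elim, auto simp: indicator_def\<close>)

context confined_langevin
begin

lemma Dynkin_nonneg_time:
  assumes C2: "bounded_C2 f f1 f2 b" and t: "0 \<le> t"
  shows "integrable M (\<lambda>\<omega>. f (X t \<omega>))"
    and "(LINT \<omega>|M. f (X t \<omega>)) = f x + (LINT s|lborel. indicator {0..t} s * (LINT \<omega>|M. generator f1 f2 (X s \<omega>)))"
proof -
  have [measurable]: "f \<in> borel_measurable borel" by (rule borel_measurable_continuous_onI[OF C2_cont(1)[OF C2]])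
  have X0 [measurable]: "X 0 \<in> borel_measurable M" by simp
  have ae: "AE \<omega> in M. f (X 0 \<omega>) = f x" using X_0 by eventually_elim simp
  have i0: "integrable M (\<lambda>\<omega>. f (X 0 \<omega>))" using ae by (subst integrable_cong_AE[where g = "\<lambda>_. f x"]) auto
  have e0: "(LINT \<omega>|M. f (X 0 \<omega>)) = f x" using ae prob_space by (subst integral_cong_AE[where g = "\<lambda>_. f x"]) auto
  show "integrable M (\<lambda>\<omega>. f (X t \<omega>))" using Dynkin(1)[OF C2] i0 t by (cases "t = 0") auto
  show "(LINT \<omega>|M. f (X t \<omega>)) = f x + (LINT s|lborel. indicator {0..t} s * (LINT \<omega>|M. generator f1 f2 (X s \<omega>)))"
    using Dynkin(2)[OF C2] e0 integral_degenerate_interval t by (cases "t = 0") auto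
qed

lemma bounded_C2_id: "bounded_C2 (\<lambda>x. x) (\<lambda>_. 1) (\<lambda>_. 0) 1"
  by (auto simp: bounded_C2_def intro!: derivative_eq_intros)

end

context langevin_family
begin

definition law :: "real \<Rightarrow> real \<Rightarrow> real measure" where
  "law t x = distr (M x) borel (X x t)"

lemma X_measurable: "0 \<le> t \<Longrightarrow> X x t \<in> borel_measurable (M x)"
proof -
  interpret confined_langevin "M x" "F x" "B x" q x "X x" by (rule confined)
  assume "0 \<le> t"
  then show ?thesis by (rule measurable_X)
qed

lemma real_distribution_law: "0 \<le> t \<Longrightarrow> real_distribution (law t x)"
proof -
  interpret confined_langevin "M x" "F x" "B x" q x "X x" by (rule confined)
  assume "0 \<le> t"
  then show ?thesis unfolding law_def by (intro real_distribution_distr measurable_X)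
qed

lemma integral_law:
  fixes f :: "real \<Rightarrow> real"
  assumes "0 \<le> t" "f \<in> borel_measurable borel"
  shows "(LINT u|law t x. f u) = P t f x" and "integrable (law t x) f \<longleftrightarrow> integrable (M x) (\<lambda>\<omega>. f (X x t \<omega>))"
  unfolding law_def P_def using integral_distr[OF X_measurable[OF assms(1)] assms(2)]
    integrable_distr_eq[OF X_measurable[OF assms(1)] assms(2)] by auto

lemma integrable_bounded:
  fixes f :: "real \<Rightarrow> real"
  assumes "0 \<le> t" "f \<in> borel_measurable borel" "\<And>z. \<bar>f z\<bar> \<le> c"
  shows "integrable (M x) (\<lambda>\<omega>. f (X x t \<omega>))"
proof -
  interpret confined_langevin "M x" "F x" "B x" q x "X x" by (rule confined)
  show ?thesis
    by (rule integrable_const_bound[where B = c])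
       (use assms in \<open>auto intro: measurable_compose[OF X_measurable[OF assms(1)]]\<close>)
qed

lemma P_ramp_tendsto:
  assumes "0 \<le> t"
  shows "(\<lambda>m. P t (ramp m u) x) \<longlonglongrightarrow> 1 - cdf (law t x) u"
proof -
  interpret real_distribution "law t x" by (rule real_distribution_law[OF assms])
  show ?thesis
    using integral_ramp_tendsto[of u] integral_law(1)[OF assms borel_measurable_continuous_onI[OF continuous_ramp]] by simp
qed

lemma cdf_law_antimono:
  assumes "0 \<le> t" "x \<le> y"
  shows "cdf (law t y) u \<le> cdf (law t x) u"
proof -
  have "1 - cdf (law t x) u \<le> 1 - cdf (law t y) u"
    by (rule LIMSEQ_le[OF P_ramp_tendsto[OF assms(1)] P_ramp_tendsto[OF assms(1)]])
       (use monoD[OF P_mono[OF assms(1) continuous_ramp ramp_mono ramp_bounded(3)] assms(2)] in auto)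
  then show ?thesis by simp
qed

lemma P_mono_integrable:
  fixes f :: "real \<Rightarrow> real"
  assumes t: "0 \<le> t" and "x \<le> y" "mono f" "integrable (M x) (\<lambda>\<omega>. f (X x t \<omega>))" "integrable (M y) (\<lambda>\<omega>. f (X y t \<omega>))"
  shows "P t f x \<le> P t f y"
proof -
  have fm: "f \<in> borel_measurable borel" by (rule borel_measurable_mono[OF assms(3)])
  show ?thesis
    using integral_mono_stochastic_order[OF real_distribution_law[OF t] real_distribution_law[OF t] cdf_law_antimono[OF t assms(2)] assms(3)]
      assms(4,5) integral_law[OF t fm] by simp
qed

lemma P_Dynkin:
  assumes "bounded_C2 f f1 f2 b" "0 \<le> t"
  shows "integrable (M x) (\<lambda>\<omega>. f (X x t \<omega>))"
    and "P t f x = f x + (LINT s|lborel. indicator {0..t} s * P s (generator f1 f2) x)"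
proof -
  interpret confined_langevin "M x" "F x" "B x" q x "X x" by (rule confined)
  show "integrable (M x) (\<lambda>\<omega>. f (X x t \<omega>))"
    "P t f x = f x + (LINT s|lborel. indicator {0..t} s * P s (generator f1 f2) x)"
    using Dynkin_nonneg_time[OF assms] unfolding P_def by auto
qed

lemma P_time_integrable:
  assumes "g \<in> borel_measurable borel" "\<And>u. \<bar>g u\<bar> \<le> a * (1 + sqrt (1 + u\<^sup>2) + \<bar>q1 u\<bar>)" "0 < t" "0 \<le> a"
  shows "integrable lborel (\<lambda>s. indicator {0..t} s * P s g x)"
    and "AE s in lborel. s \<in> {0..t} \<longrightarrow> integrable (M x) (\<lambda>\<omega>. g (X x s \<omega>))"
proof -
  interpret confined_langevin "M x" "F x" "B x" q x "X x" by (rule confined)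
  show "integrable lborel (\<lambda>s. indicator {0..t} s * P s g x)"
    "AE s in lborel. s \<in> {0..t} \<longrightarrow> integrable (M x) (\<lambda>\<omega>. g (X x s \<omega>))"
    using occupation_Fubini(1,3)[OF assms] unfolding P_def by auto
qed

lemma P_moment:
  assumes "0 < t"
  shows "(LINT s|lborel. indicator {0..t} s * P s (\<lambda>u. sqrt (1 + u\<^sup>2)) x) \<le> lyap_const * t + sqrt (1 + x\<^sup>2)"
proof -
  interpret confined_langevin "M x" "F x" "B x" q x "X x" by (rule confined)
  show ?thesis using occupation_moment[OF assms] unfolding P_def .
qed

lemma X_integrable: "0 \<le> t \<Longrightarrow> integrable (M x) (X x t)"
proof -
  interpret confined_langevin "M x" "F x" "B x" q x "X x" by (rule confined)
  assume "0 \<le> t"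
  then show ?thesis using Dynkin_nonneg_time(1)[OF bounded_C2_id] by simp
qed

text \<open>
  A discrete form of Gronwall's inequality: \<open>n\<close> steps of length \<open>t / n\<close> give the factor
  \<open>(1 + l t / n)^n\<close>, which tends to \<open>exp (l t)\<close>.
\<close>

lemma exp_decay_of_resolvent_bound:
  fixes u :: "real \<Rightarrow> real"
  assumes l: "0 < l" and step: "\<And>s t. 0 \<le> s \<Longrightarrow> s \<le> t \<Longrightarrow> u t * (1 + l * (t - s)) \<le> u s" and t: "0 \<le> t"
  shows "u t \<le> u 0 * exp (- l * t)"
proof -
  have "u t * (1 + l * t / real n) ^ n \<le> u 0" if n: "0 < n" for n
  proof -
    have "u (real k * (t / real n)) * (1 + l * t / real n) ^ k \<le> u 0" if "k \<le> n" for k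
      using that
    proof (induction k)
      case (Suc k)
      have pos: "0 \<le> 1 + l * t / real n" using l t by simp
      have "u (real (Suc k) * (t / real n)) * (1 + l * (real (Suc k) * (t / real n) - real k * (t / real n))) \<le> u (real k * (t / real n))"
        using t by (intro step mult_right_mono) auto
      also have "l * (real (Suc k) * (t / real n) - real k * (t / real n)) = l * t / real n" by (simp add: algebra_simps add_divide_distrib)
      finally have "u (real (Suc k) * (t / real n)) * (1 + l * t / real n) * (1 + l * t / real n) ^ k
          \<le> u (real k * (t / real n)) * (1 + l * t / real n) ^ k"
        using pos by (intro mult_right_mono) auto
      also have "\<dots> \<le> u 0" using Suc by simp
      finally show ?case by (simp add: mult.assoc)
    qed simp
    from this[of n] show ?thesis using n by simp
  qed
  then have "\<forall>\<^sub>F n in sequentially. u t * (1 + l * t / real n) ^ n \<le> u 0"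
    using eventually_gt_at_top[of 0] by (rule eventually_mono[rotated])
  moreover have "(\<lambda>n. u t * (1 + l * t / real n) ^ n) \<longlonglongrightarrow> u t * exp (l * t)"
    by (intro tendsto_mult tendsto_const tendsto_exp_limit_sequentially)
  ultimately have "u t * exp (l * t) \<le> u 0" by (intro tendsto_upperbound) auto
  then have "u t * exp (l * t) * exp (- l * t) \<le> u 0 * exp (- l * t)" by (rule mult_right_mono) simp
  then show ?thesis by (simp add: mult.assoc flip: exp_add)
qed

text \<open>
  The difference \<open>u\<close> of the expectations of \<open>G\<close> is an indefinite integral of \<open>\<kappa>\<close>.  Because
  \<open>h - l G\<close> is increasing, the stochastic order yields \<open>\<kappa> \<le> - l u\<close>; Dynkin's formula
  makes \<open>h\<close> integrable only at almost every time, hence the almost-everywhere formulation.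
\<close>

lemma cdf_contraction:
  "\<exists>b l. 0 < l \<and> 0 \<le> b \<and> (\<forall>x y t. 0 \<le> t \<longrightarrow>
     cdf_distance (law t x) (law t y) \<le> ennreal (b * \<bar>x - y\<bar> * exp (- l * t)))"
proof -
  obtain G V V' h b l where l: "0 < l" and dG: "\<And>x. (G has_real_derivative V x) (at x)"
    and dV: "\<And>x. (V has_real_derivative V' x) (at x)" and cV': "continuous_on UNIV V'"
    and Vb: "\<And>x. 1 \<le> V x" "\<And>x. V x \<le> b" "\<And>x. \<bar>V' x\<bar> \<le> b"
    and eq: "\<And>x. V' x - q1 x * V x = - h x"
    and hG: "\<And>x y. x \<le> y \<Longrightarrow> l * (G y - G x) \<le> h y - h x"
    using ex_contracting_function by metis
  have b: "1 \<le> b" using Vb(1,2)[of 0] by linarith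
  have Vabs: "\<bar>V x\<bar> \<le> b" for x using Vb(1,2)[of x] by linarith
  have C2: "bounded_C2 G V V' b" unfolding bounded_C2_def using dG dV cV' Vabs Vb(3) by blast
  let ?L = "generator V V'"
  have L: "?L u = - h u" for u unfolding generator_def by (rule eq)
  have Lm: "?L \<in> borel_measurable borel"
  proof -
    interpret confined_langevin "M 0" "F 0" "B 0" q 0 "X 0" by (rule confined)
    show ?thesis by (rule borel_measurable_continuous_onI[OF continuous_generator[OF C2]])
  qed
  have Lg: "\<bar>?L u\<bar> \<le> b * (1 + sqrt (1 + u\<^sup>2) + \<bar>q1 u\<bar>)" for u
  proof -
    interpret confined_langevin "M 0" "F 0" "B 0" q 0 "X 0" by (rule confined)
    show ?thesis by (rule generator_growth[OF C2])
  qed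
  have Gm: "G \<in> borel_measurable borel" by (rule borel_measurable_continuous_onI[OF C2_cont(1)[OF C2]])
  have G_expand: "y - x \<le> G y - G x" if "x \<le> y" for x y
    using mono_of_DERIV[of x y "\<lambda>u. G u - u" "\<lambda>u. V u - 1"] that Vb(1)
    by (force intro!: derivative_eq_intros dG)
  have G_mono: "mono G" using G_expand by (intro monoI) (smt (verit))
  have mean_contraction: "P t (\<lambda>u. u) y - P t (\<lambda>u. u) x \<le> b * (y - x) * exp (- l * t)"
    if xy: "x \<le> y" and t: "0 \<le> t" for x y t
  proof -
    define u where "u t = P t G y - P t G x" for t
    define \<kappa> where "\<kappa> r = P r ?L y - P r ?L x" for r
    have u_eq: "u t = G y - G x + (LINT r|lborel. indicator {0..t} r * \<kappa> r)" if "0 \<le> t" for t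
    proof (cases "t = 0")
      case True
      then show ?thesis
        unfolding True u_def P_0[OF Gm] integral_degenerate_interval by simp
    next
      case False
      then have "0 < t" using that by simp
      note i = P_time_integrable(1)[OF Lm Lg this, of _] 
      have "0 \<le> b" using b by simp
      have "(LINT r|lborel. indicator {0..t} r * \<kappa> r) = (LINT r|lborel. indicator {0..t} r * P r ?L y - indicator {0..t} r * P r ?L x)"
        unfolding \<kappa>_def by (simp add: right_diff_distrib)
      also have "\<dots> = (LINT r|lborel. indicator {0..t} r * P r ?L y) - (LINT r|lborel. indicator {0..t} r * P r ?L x)"
        using \<open>0 \<le> b\<close> by (intro Bochner_Integration.integral_diff i)
      finally show ?thesis unfolding u_def using P_Dynkin(2)[OF C2 that] by simp
    qed
    have u0: "0 \<le> u r" if "0 \<le> r" for r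
      unfolding u_def using P_mono_integrable[OF that xy G_mono] P_Dynkin(1)[OF C2 that] by simp
    have \<kappa>_int: "integrable lborel (\<lambda>r. indicator {0..t} r * \<kappa> r)" if "0 < t" for t
    proof -
      have "integrable lborel (\<lambda>r. indicator {0..t} r * P r ?L y - indicator {0..t} r * P r ?L x)"
        using b by (intro Bochner_Integration.integrable_diff P_time_integrable(1)[OF Lm Lg that]) auto
      then show ?thesis unfolding \<kappa>_def by (simp add: right_diff_distrib)
    qed
    have \<kappa>_le: "AE r in lborel. r \<in> {0..t} \<longrightarrow> \<kappa> r \<le> - l * u r" if "0 < t" for t
    proof -
      have b0: "0 \<le> b" using b by simp
      show ?thesis
        using P_time_integrable(2)[OF Lm Lg that b0, of x] P_time_integrable(2)[OF Lm Lg that b0, of y]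
      proof eventually_elim
        case (elim r)
        show ?case
        proof
          assume r: "r \<in> {0..t}"
          then have r0: "0 \<le> r" by simp
          have iL: "integrable (M z) (\<lambda>\<omega>. ?L (X z r \<omega>))" if "z \<in> {x, y}" for z using elim r that by auto
          have iG: "integrable (M z) (\<lambda>\<omega>. G (X z r \<omega>))" for z by (rule P_Dynkin(1)[OF C2 r0])
          let ?k = "\<lambda>u. - ?L u - l * G u"
          have "mono ?k" using hG by (intro monoI) (auto simp: L algebra_simps)
          then have "P r ?k x \<le> P r ?k y"
            using iL iG by (intro P_mono_integrable[OF r0 xy]) auto
          moreover have "P r ?k z = - P r ?L z - l * P r G z" if "z \<in> {x, y}" for z
            unfolding P_def using iL[OF that] iG[of z] by (simp add: Bochner_Integration.integral_diff)
          ultimately show "\<kappa> r \<le> - l * u r" unfolding \<kappa>_def u_def by (simp add: algebra_simps)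
        qed
      qed
    qed
    have diff: "u t - u s = (LINT r|lborel. indicator {s<..t} r * \<kappa> r)" if "0 \<le> s" "s < t" for s t
    proof -
      have t: "0 < t" using that by simp
      have i2: "integrable lborel (\<lambda>r. indicator {0..s} r * \<kappa> r)"
      proof -
        have "integrable lborel (\<lambda>r. indicator {0..s} r * (indicator {0..t} r * \<kappa> r))"
          using integrable_mult_indicator[OF _ \<kappa>_int[OF t], of "{0..s}"] by simp
        moreover have "(\<lambda>r. indicator {0..s} r * (indicator {0..t} r * \<kappa> r)) = (\<lambda>r. indicator {0..s} r * \<kappa> r)"
          using that by (auto simp: indicator_def)
        ultimately show ?thesis by simp
      qed
      have "u t - u s = (LINT r|lborel. indicator {0..t} r * \<kappa> r) - (LINT r|lborel. indicator {0..s} r * \<kappa> r)"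
        using u_eq[of t] u_eq[of s] that by simp
      also have "\<dots> = (LINT r|lborel. indicator {0..t} r * \<kappa> r - indicator {0..s} r * \<kappa> r)"
        by (rule Bochner_Integration.integral_diff[OF \<kappa>_int[OF t] i2, symmetric])
      also have "\<dots> = (LINT r|lborel. indicator {s<..t} r * \<kappa> r)"
        using that by (intro Bochner_Integration.integral_cong) (auto simp: indicator_def)
      finally show ?thesis .
    qed
    have i_st: "integrable lborel (\<lambda>r. indicator {s<..t} r * \<kappa> r)" if "0 \<le> s" "s < t" for s t
    proof -
      have "integrable lborel (\<lambda>r. indicator {s<..t} r * (indicator {0..t} r * \<kappa> r))"
        using integrable_mult_indicator[OF _ \<kappa>_int, of "{s<..t}" t] that by simp
      moreover have "(\<lambda>r. indicator {s<..t} r * (indicator {0..t} r * \<kappa> r)) = (\<lambda>r. indicator {s<..t} r * \<kappa> r)"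
        using that by (auto simp: indicator_def)
      ultimately show ?thesis by simp
    qed
    \<comment> \<open>Monotonicity of \<open>u\<close> comes first; it allows \<open>u r\<close> to be replaced by \<open>u t\<close> under the integral below.\<close>
    have anti: "u t \<le> u s" if "0 \<le> s" "s \<le> t" for s t
    proof (cases "s = t")
      case False
      then have st: "s < t" "0 < t" using that by auto
      have "(LINT r|lborel. indicator {s<..t} r * \<kappa> r) \<le> (LINT r|(lborel :: real measure). 0)"
      proof (rule integral_mono_AE[OF i_st[OF that(1) st(1)]])
        show "AE r in lborel. indicator {s<..t} r * \<kappa> r \<le> 0"
          using \<kappa>_le[OF st(2)]
        proof eventually_elim
          case (elim r)
          have "\<kappa> r \<le> 0" if "r \<in> {0..t}"
            using elim that u0[of r] l by (smt (verit) atLeastAtMost_iff mult_nonneg_nonneg mult_minus_left)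
          then show ?case using that(1) by (auto simp: indicator_def)
        qed
      qed simp
      then show ?thesis using diff[OF that(1) st(1)] by simp
    qed simp
    have step: "u t * (1 + l * (t - s)) \<le> u s" if "0 \<le> s" "s \<le> t" for s t
    proof (cases "s = t")
      case False
      then have st: "s < t" "0 < t" using that by auto
      have "(LINT r|lborel. indicator {s<..t} r * \<kappa> r) \<le> (LINT r|lborel. indicator {s<..t} r * (- l * u t))"
      proof (rule integral_mono_AE[OF i_st[OF that(1) st(1)]])
        show "integrable lborel (\<lambda>r. indicator {s<..t} r * (- l * u t))" using st by simp
        show "AE r in lborel. indicator {s<..t} r * \<kappa> r \<le> indicator {s<..t} r * (- l * u t)"
          using \<kappa>_le[OF st(2)]
        proof eventually_elim
          case (elim r)
          have "\<kappa> r \<le> - l * u t" if r: "r \<in> {s<..t}"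
          proof -
            have "u t \<le> u r" using r \<open>0 \<le> s\<close> by (intro anti) auto
            then have "l * u t \<le> l * u r" using l by simp
            then show ?thesis using elim r \<open>0 \<le> s\<close> by auto
          qed
          then show ?case by (auto simp: indicator_def)
        qed
      qed
      also have "\<dots> = - l * u t * (t - s)" using st by simp
      finally show ?thesis using diff[OF that(1) st(1)] by (simp add: algebra_simps)
    qed simp
    have decay: "u t \<le> u 0 * exp (- l * t)" by (rule exp_decay_of_resolvent_bound[OF l step t])
    have "P t (\<lambda>v. G v - v) x \<le> P t (\<lambda>v. G v - v) y"
    proof (rule P_mono_integrable[OF t xy])
      show "mono (\<lambda>v. G v - v)" using G_expand by (intro monoI) (simp add: algebra_simps)
      show "integrable (M x) (\<lambda>\<omega>. G (X x t \<omega>) - X x t \<omega>)" "integrable (M y) (\<lambda>\<omega>. G (X y t \<omega>) - X y t \<omega>)"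
        by (intro Bochner_Integration.integrable_diff P_Dynkin(1)[OF C2 t] X_integrable[OF t])+
    qed
    moreover have "P t (\<lambda>v. G v - v) z = P t G z - P t (\<lambda>v. v) z" for z
      unfolding P_def by (rule Bochner_Integration.integral_diff[OF P_Dynkin(1)[OF C2 t] X_integrable[OF t]])
    ultimately have "P t (\<lambda>u. u) y - P t (\<lambda>u. u) x \<le> u t" by (simp add: u_def)
    also have "\<dots> \<le> u 0 * exp (- l * t)" by (rule decay)
    also have "u 0 \<le> b * (y - x)"
      using C2_Lipschitz[OF C2, of y x] xy P_0[OF Gm] by (simp add: u_def)
    finally show ?thesis by (simp add: mult_right_mono)
  qed
  have ordered: "cdf_distance (law t x) (law t y) \<le> ennreal (b * (y - x) * exp (- l * t))"
    if "x \<le> y" "0 \<le> t" for x y t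
  proof -
    have id: "(\<lambda>u::real. u) \<in> borel_measurable borel" by simp
    have "cdf_distance (law t x) (law t y) = ennreal (P t (\<lambda>u. u) y - P t (\<lambda>u. u) x)"
      using cdf_distance_stochastic_order[OF real_distribution_law[OF that(2)] real_distribution_law[OF that(2)] cdf_law_antimono[OF that(2,1)]]
        integral_law[OF that(2) id] X_integrable[OF that(2)] by simp
    also have "\<dots> \<le> ennreal (b * (y - x) * exp (- l * t))"
      by (rule ennreal_leI[OF mean_contraction[OF that]])
    finally show ?thesis .
  qed
  have "cdf_distance (law t x) (law t y) \<le> ennreal (b * \<bar>x - y\<bar> * exp (- l * t))"
    if "0 \<le> t" for x y t
  proof (cases "x \<le> y")
    case True
    then show ?thesis using ordered[OF True that] by simp
  next
    case False
    then have "y \<le> x" by simp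
    from ordered[OF this that] show ?thesis using False by (simp add: abs_minus_commute[of "cdf (law t x) _"])
  qed
  then show ?thesis using l b by (intro exI[of _ b] exI[of _ l]) auto
qed

end

context langevin_family
begin

section \<open>Invariance of the Gibbs measure\<close>

text \<open>
  The time average of the first moment is bounded, so the moment itself cannot exceed the bound by
  \<open>1\<close> at all late times.
\<close>

lemma ex_time_bounded_moment:
  "\<exists>T. real n \<le> T \<and> 0 < T \<and> P T (\<lambda>u. sqrt (1 + u\<^sup>2)) x \<le> lyap_const + 1"
proof (rule ccontr)
  assume neg: "\<not> ?thesis"
  let ?f = "\<lambda>u::real. sqrt (1 + u\<^sup>2)"
  define a where "a = real n + 1"
  define c where "c = lyap_const"
  have c: "0 \<le> c" unfolding c_def by (rule lyap_const) 
  have big: "c + 1 \<le> P T ?f x" if "a \<le> T" for T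
  proof -
    have "real n \<le> T" "0 < T" using that by (auto simp: a_def)
    then show ?thesis using neg unfolding c_def by force
  qed
  define T where "T = ?f x + (c + 1) * a + a + 1"
  have a: "0 \<le> a" by (simp add: a_def)
  have T: "a < T" "0 < T" using c a by (auto simp: T_def add_nonneg_nonneg intro!: add_nonneg_pos add_pos_nonneg)
  have fm: "?f \<in> borel_measurable borel" by measurable
  have le: "\<bar>?f u\<bar> \<le> 1 * (1 + sqrt (1 + u\<^sup>2) + \<bar>q1 u\<bar>)" for u by simp
  have "(c + 1) * (T - a) = (LINT s|lborel. indicator {a..T} s * (c + 1))" using T by simp
  also have "\<dots> \<le> (LINT s|lborel. indicator {0..T} s * P s ?f x)"
  proof (rule integral_mono)
    show "integrable lborel (\<lambda>s. indicator {a..T} s * (c + 1))" using T by simp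
    show "integrable lborel (\<lambda>s. indicator {0..T} s * P s ?f x)" by (rule P_time_integrable(1)[OF fm le T(2)]) simp
    have "0 \<le> P s ?f x" for s unfolding P_def by (intro Bochner_Integration.integral_nonneg) simp
    then show "indicator {a..T} s * (c + 1) \<le> indicator {0..T} s * P s ?f x" for s
      using big[of s] a by (auto simp: indicator_def)
  qed
  also have "\<dots> \<le> c * T + ?f x" unfolding c_def by (rule P_moment[OF T(2)])
  finally have "T \<le> ?f x + (c + 1) * a" by (simp add: algebra_simps)
  then show False using a by (simp add: T_def)
qed

text \<open>
  Late times at which the first moment is bounded; they make the boundary terms in Dynkin's formula
  negligible after division by the time.
\<close>

definition times :: "real \<Rightarrow> nat \<Rightarrow> real" where
  "times x n = (SOME T. real n \<le> T \<and> 0 < T \<and> P T (\<lambda>u. sqrt (1 + u\<^sup>2)) x \<le> lyap_const + 1)"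

lemma times: "real n \<le> times x n" "0 < times x n" "P (times x n) (\<lambda>u. sqrt (1 + u\<^sup>2)) x \<le> lyap_const + 1"
  using someI_ex[OF ex_time_bounded_moment[where n = n and x = x]] unfolding times_def by auto

lemma bounded_div_times_tendsto_0:
  assumes "\<And>n. \<bar>a n\<bar> \<le> c"
  shows "(\<lambda>n. a n / times x n) \<longlonglongrightarrow> 0"
proof (rule Lim_null_comparison)
  have c: "0 \<le> c" using assms[of 0] by linarith
  show "\<forall>\<^sub>F n in sequentially. norm (a n / times x n) \<le> c / real n"
    using eventually_gt_at_top[of 0]
  proof eventually_elim
    case (elim n)
    have "\<bar>a n\<bar> / times x n \<le> c / real n"
      using assms[of n] c times(1)[of n x] times(2)[of x n] elim by (intro frac_le) auto
    then show ?case using times(2)[of x n] by (simp add: abs_divide)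
  qed
  show "(\<lambda>n. c / real n) \<longlonglongrightarrow> 0" by (rule lim_const_over_n)
qed

lemma bounded_growth:
  fixes g :: "real \<Rightarrow> real"
  assumes "\<And>z. \<bar>g z\<bar> \<le> c"
  shows "\<bar>g u\<bar> \<le> c * (1 + sqrt (1 + u\<^sup>2) + \<bar>q1 u\<bar>)"
proof -
  have "0 \<le> c" using assms[of 0] by linarith
  then have "c * 1 \<le> c * (1 + sqrt (1 + u\<^sup>2) + \<bar>q1 u\<bar>)" by (intro mult_left_mono) auto
  then show ?thesis using assms[of u] by linarith
qed

lemma P_bounded_time_integrable:
  assumes "continuous_on UNIV g" "\<And>z. \<bar>g z\<bar> \<le> c" "0 < T"
  shows "integrable lborel (\<lambda>s. indicator {0..T} s * P s g x)"
proof (rule P_time_integrable(1)[OF borel_measurable_continuous_onI[OF assms(1)] _ assms(3)])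
  show "\<bar>g u\<bar> \<le> c * (1 + sqrt (1 + u\<^sup>2) + \<bar>q1 u\<bar>)" for u
    by (rule bounded_growth) (rule assms(2))
  show "0 \<le> c" using assms(2)[of 0] by linarith
qed

text \<open>
  For \<open>\<phi>\<close> with \<open>L \<phi> = g - \<pi>(g)\<close>, Dynkin's formula expresses the deviation of the time average as
  \<open>(P\<^sub>T \<phi> x - \<phi> x) / T\<close>, and \<open>\<phi>\<close> grows at most linearly.
\<close>

lemma ergodic_average:
  assumes g: "continuous_on UNIV g" "\<And>z. \<bar>g z\<bar> \<le> c"
  shows "(\<lambda>n. (LINT s|lborel. indicator {0..times x n} s * P s g x) / times x n) \<longlonglongrightarrow> (LINT u|gibbs_measure q. g u)"
proof -
  interpret gibbs: prob_space "gibbs_measure q" by (rule prob_space_gibbs)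
  have gm [measurable]: "g \<in> borel_measurable borel" by (rule borel_measurable_continuous_onI[OF g(1)])
  define m where "m = (LINT u|gibbs_measure q. g u)"
  define r where "r = (\<lambda>u. g u - m)"
  have rm [measurable]: "r \<in> borel_measurable borel" unfolding r_def by measurable
  have cont: "continuous_on UNIV r" unfolding r_def by (intro continuous_intros g)
  have bd: "\<bar>r u\<bar> \<le> c + \<bar>m\<bar>" for u using g(2)[of u] unfolding r_def by linarith
  have ig: "integrable (gibbs_measure q) g"
    by (rule gibbs.integrable_const_bound[where B = c]) (use g(2) in auto)
  have cent: "(LINT u|lborel. r u * exp (- q u)) = 0"
  proof -
    have "(LINT u|gibbs_measure q. r u) = 0"
      unfolding r_def using ig gibbs.prob_space by (simp add: m_def)
    then show ?thesis using Z_pos integral_gibbs[OF rm] by simp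
  qed
  note pg = cont bd cent
  let ?\<psi> = "poisson_grad r" and ?\<psi>' = "\<lambda>x. q1 x * poisson_grad r x + r x"
  obtain b where b: "\<And>x. \<bar>?\<psi> x\<bar> \<le> b" "\<And>x. \<bar>q1 x * ?\<psi> x\<bar> \<le> b" using poisson_grad_bounded[OF pg] by blast
  obtain \<phi> where \<phi>: "\<And>x. (\<phi> has_real_derivative ?\<psi> x) (at x)"
    using antiderivative[OF continuous_on_poisson_grad[OF pg]] by blast
  define D where "D = b + c + \<bar>m\<bar>"
  have c0: "0 \<le> c + \<bar>m\<bar>" using bd[of 0] by linarith
  have D0: "0 \<le> D" using b(1)[of 0] c0 unfolding D_def by linarith
  have C2: "bounded_C2 \<phi> ?\<psi> ?\<psi>' D"
    unfolding bounded_C2_def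
  proof (intro conjI allI)
    show "continuous_on UNIV ?\<psi>'"
      by (intro continuous_intros continuous_on_q1 continuous_on_poisson_grad[OF pg] cont)
    show "\<bar>?\<psi> x\<bar> \<le> D" for x using b(1)[of x] c0 unfolding D_def by linarith
    show "\<bar>?\<psi>' x\<bar> \<le> D" for x using b(2)[of x] bd[of x] unfolding D_def by linarith
  qed (rule \<phi> DERIV_poisson_grad[OF pg])+
  have gen: "generator ?\<psi> ?\<psi>' = r" unfolding generator_def[abs_def] by simp
  let ?f = "\<lambda>u::real. sqrt (1 + u\<^sup>2)"
  have avg: "(LINT s|lborel. indicator {0..T} s * P s g x) = P T \<phi> x - \<phi> x + m * T" if T: "0 < T" for T
  proof -
    have Pr: "indicator {0..T} s * P s r x = indicator {0..T} s * P s g x - m * indicator {0..T} s" for s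
    proof (cases "s \<in> {0..T}")
      case True
      then have s: "0 \<le> s" by simp
      interpret confined_langevin "M x" "F x" "B x" q x "X x" by (rule confined)
      show ?thesis
        unfolding P_def r_def using integrable_bounded[OF s gm g(2)] prob_space True by simp
    qed simp
    have "P T \<phi> x = \<phi> x + (LINT s|lborel. indicator {0..T} s * P s r x)"
      using P_Dynkin(2)[OF C2, of T x] T unfolding gen by simp
    also have "(LINT s|lborel. indicator {0..T} s * P s r x) = (LINT s|lborel. indicator {0..T} s * P s g x) - (LINT s|lborel. m * indicator {0..T} s)"
      unfolding Pr using T by (intro Bochner_Integration.integral_diff P_bounded_time_integrable[OF g T]) auto
    finally show ?thesis using T by simp
  qed
  have P\<phi>: "\<bar>P (times x n) \<phi> x\<bar> \<le> \<bar>\<phi> 0\<bar> + D * (lyap_const + 1)" for n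
  proof -
    let ?T = "times x n"
    have T: "0 < ?T" "0 \<le> ?T" using times(2)[of x n] by auto
    interpret confined_langevin "M x" "F x" "B x" q x "X x" by (rule confined)
    have i\<phi>: "integrable (M x) (\<lambda>\<omega>. \<phi> (X x ?T \<omega>))" by (rule P_Dynkin(1)[OF C2 T(2)])
    have if0: "integrable (M x) (\<lambda>\<omega>. ?f (X x ?T \<omega>))" by (rule integrable_X(1)[OF T(1)])
    have "\<bar>\<phi> u\<bar> \<le> \<bar>\<phi> 0\<bar> + D * ?f u" for u
    proof -
      have "\<bar>u\<bar> \<le> ?f u" by (rule real_le_rsqrt) simp
      then have "\<bar>\<phi> u - \<phi> 0\<bar> \<le> D * ?f u"
        using C2_Lipschitz[OF C2, of u 0] mult_left_mono[OF _ D0, of "\<bar>u\<bar>" "?f u"] by simp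
      then show ?thesis by linarith
    qed
    then have "(LINT \<omega>|M x. \<bar>\<phi> (X x ?T \<omega>)\<bar>) \<le> (LINT \<omega>|M x. \<bar>\<phi> 0\<bar> + D * ?f (X x ?T \<omega>))"
      using i\<phi> if0 by (intro integral_mono integrable_abs) auto
    also have "\<dots> = \<bar>\<phi> 0\<bar> + D * P ?T ?f x" using if0 prob_space by (simp add: P_def)
    also have "\<dots> \<le> \<bar>\<phi> 0\<bar> + D * (lyap_const + 1)" using times(3)[of x n] D0 by (intro add_left_mono mult_left_mono)
    finally show ?thesis unfolding P_def using integral_abs_bound[of "M x" "\<lambda>\<omega>. \<phi> (X x ?T \<omega>)"] by linarith
  qed
  have "(\<lambda>n. (P (times x n) \<phi> x - \<phi> x) / times x n) \<longlonglongrightarrow> 0"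
  proof (rule bounded_div_times_tendsto_0)
    show "\<bar>P (times x n) \<phi> x - \<phi> x\<bar> \<le> \<bar>\<phi> 0\<bar> + D * (lyap_const + 1) + \<bar>\<phi> x\<bar>" for n
      using P\<phi>[of n] by linarith
  qed
  then have "(\<lambda>n. (P (times x n) \<phi> x - \<phi> x) / times x n + m) \<longlonglongrightarrow> 0 + m" by (intro tendsto_add tendsto_const)
  moreover have "(LINT s|lborel. indicator {0..times x n} s * P s g x) / times x n = (P (times x n) \<phi> x - \<phi> x) / times x n + m" for n
    using avg[OF times(2)[of x n]] times(2)[of x n] by (simp add: add_divide_distrib)
  ultimately show ?thesis unfolding m_def by simp
qed

text \<open>
  Time averages of \<open>P\<^sub>s (P\<^sub>t g) = P\<^sub>s\<^sub>+\<^sub>t g\<close> and of \<open>P\<^sub>s g\<close> differ only by two boundary pieces of length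
  \<open>t\<close>, so they have the same limit.
\<close>

lemma gibbs_invariant:
  assumes t: "0 \<le> t" and L: "\<And>z z'. \<bar>g z - g z'\<bar> \<le> L * \<bar>z - z'\<bar>" and g: "continuous_on UNIV g" "\<And>z. \<bar>g z\<bar> \<le> c"
  shows "(LINT z|gibbs_measure q. P t g z) = (LINT z|gibbs_measure q. g z)"
proof -
  have gm: "g \<in> borel_measurable borel" by (rule borel_measurable_continuous_onI[OF g(1)])
  have c0: "0 \<le> c" using g(2)[of 0] by linarith
  have Pc: "continuous_on UNIV (P t g)"
  proof (rule lipschitz_on_continuous_on)
    have "0 \<le> L" using L[of 0 1] by simp
    then show "(exp (2 * K * t) * L)-lipschitz_on UNIV (P t g)"
      using P_Lipschitz[OF t L g] by (intro lipschitz_onI) (auto simp: dist_real_def)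
  qed
  have Pb: "\<bar>P t g z\<bar> \<le> c" for z by (rule P_bounded[OF t gm g(2)])
  let ?A = "\<lambda>T. LINT s|lborel. indicator {0..T} s * P s g 0"
  let ?A' = "\<lambda>T. LINT s|lborel. indicator {0..T} s * P s (P t g) 0"
  have diff: "\<bar>?A' T - ?A T\<bar> \<le> 2 * t * c" if T: "0 < T" for T
  proof -
    have int: "integrable lborel (\<lambda>s. indicator {0..T + t} s * P s g 0)"
      using T t by (intro P_bounded_time_integrable[OF g]) simp
    have sub: "integrable lborel (\<lambda>s. indicator {a..b} s * P s g 0)" if "0 \<le> a" "b \<le> T + t" for a b
    proof -
      have "integrable lborel (\<lambda>s. indicator {a..b} s * (indicator {0..T + t} s * P s g 0))"
        using integrable_mult_indicator[OF _ int, of "{a..b}"] by simp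
      moreover have "(\<lambda>s. indicator {a..b} s * (indicator {0..T + t} s * P s g 0)) = (\<lambda>s. indicator {a..b} s * P s g 0)"
        using that by (auto simp: indicator_def)
      ultimately show ?thesis by simp
    qed
    have "?A' T = (LINT s|lborel. indicator {0..T} s * P (t + s) g 0)"
      using P_markov[OF _ t g] by (intro Bochner_Integration.integral_cong) (auto simp: indicator_def add.commute)
    also have "\<dots> = (LINT s|lborel. indicator {t..T + t} (t + 1 * s) * P (t + 1 * s) g 0)"
      by (intro Bochner_Integration.integral_cong) (auto simp: indicator_def)
    also have "\<dots> = (LINT s|lborel. indicator {t..T + t} s * P s g 0)"
      using lborel_integral_real_affine[of 1 "\<lambda>s. indicator {t..T + t} s * P s g 0" t] by simp
    finally have eq: "?A' T - ?A T = (LINT s|lborel. indicator {t..T + t} s * P s g 0 - indicator {0..T} s * P s g 0)"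
      using t T by (simp add: Bochner_Integration.integral_diff[OF sub sub])
    have "\<bar>?A' T - ?A T\<bar> \<le> (LINT s|lborel. \<bar>indicator {t..T + t} s * P s g 0 - indicator {0..T} s * P s g 0\<bar>)"
      unfolding eq by (rule integral_abs_bound)
    also have "\<dots> \<le> (LINT s|lborel. indicator {0..t} s * c + indicator {T..T + t} s * c)"
    proof (rule integral_mono)
      show "integrable lborel (\<lambda>s. \<bar>indicator {t..T + t} s * P s g 0 - indicator {0..T} s * P s g 0\<bar>)"
        using t T by (intro integrable_abs Bochner_Integration.integrable_diff sub) auto
      show "integrable lborel (\<lambda>s. indicator {0..t} s * c + indicator {T..T + t} s * c)"
        using t T by (intro Bochner_Integration.integrable_add) auto
      show "\<bar>indicator {t..T + t} s * P s g 0 - indicator {0..T} s * P s g 0\<bar> \<le> indicator {0..t} s * c + indicator {T..T + t} s * c" for s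
        using P_bounded[OF _ gm g(2), of s 0] c0 t T by (auto simp: indicator_def)
    qed
    also have "\<dots> = 2 * t * c" using t T by (simp add: Bochner_Integration.integral_add)
    finally show ?thesis .
  qed
  have "(\<lambda>n. (?A' (times 0 n) - ?A (times 0 n)) / times 0 n) \<longlonglongrightarrow> 0"
    by (rule bounded_div_times_tendsto_0) (rule diff[OF times(2)])
  then have "(\<lambda>n. ?A' (times 0 n) / times 0 n - ?A (times 0 n) / times 0 n) \<longlonglongrightarrow> 0" by (simp add: diff_divide_distrib)
  moreover have "(\<lambda>n. ?A' (times 0 n) / times 0 n - ?A (times 0 n) / times 0 n) \<longlonglongrightarrow>
      (LINT z|gibbs_measure q. P t g z) - (LINT z|gibbs_measure q. g z)"
    by (intro tendsto_diff ergodic_average[OF Pc Pb] ergodic_average[OF g])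
  ultimately have "(LINT z|gibbs_measure q. P t g z) - (LINT z|gibbs_measure q. g z) = 0"
    by (rule LIMSEQ_unique[symmetric])
  then show ?thesis by simp
qed

lemma real_distribution_gibbs: "real_distribution (gibbs_measure q)"
  using prob_space_gibbs by (intro real_distribution.intro real_distribution_axioms.intro) (auto simp: sets_gibbs)

lemma measurable_cdf_law: "0 \<le> t \<Longrightarrow> (\<lambda>z. cdf (law t z) u) \<in> borel_measurable borel"
proof -
  assume t: "0 \<le> t"
  have "mono (\<lambda>z. - cdf (law t z) u)" using cdf_law_antimono[OF t] by (auto intro!: monoI)
  from borel_measurable_uminus[OF borel_measurable_mono[OF this]] show ?thesis by simp
qed

text \<open>
  The ramp approximations are Lipschitz in the starting point and in the level jointly.
\<close>

lemma measurable_cdf_law_pair: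
  assumes t: "0 \<le> t"
  shows "(\<lambda>p. cdf (law t (fst p)) (snd p)) \<in> borel_measurable (borel \<Otimes>\<^sub>M borel)"
proof -
  have m: "(\<lambda>p. 1 - cdf (law t (fst p)) (snd p)) \<in> borel_measurable (borel :: (real \<times> real) measure)"
  proof (rule borel_measurable_LIMSEQ_real)
    show "(\<lambda>m. P t (ramp m (snd p)) (fst p)) \<longlonglongrightarrow> 1 - cdf (law t (fst p)) (snd p)" for p
      by (rule P_ramp_tendsto[OF t])
    show "(\<lambda>p. P t (ramp m (snd p)) (fst p)) \<in> borel_measurable borel" for m
    proof (rule borel_measurable_continuous_onI, rule lipschitz_on_continuous_on, rule lipschitz_onI)
      let ?C = "exp (2 * K * t) * real m + real m"
      fix p p' :: "real \<times> real"
      have 1: "\<bar>P t (ramp m (snd p)) (fst p) - P t (ramp m (snd p)) (fst p')\<bar> \<le> (exp (2 * K * t) * real m) * \<bar>fst p - fst p'\<bar>"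
        using ramp_Lipschitz[of m "snd p" _ "snd p"] by (intro P_Lipschitz[OF t _ continuous_ramp ramp_bounded(3)]) simp
      have 2: "\<bar>P t (ramp m (snd p)) (fst p') - P t (ramp m (snd p')) (fst p')\<bar> \<le> real m * \<bar>snd p - snd p'\<bar>"
      proof -
        interpret confined_langevin "M (fst p')" "F (fst p')" "B (fst p')" q "fst p'" "X (fst p')" by (rule confined)
        have i: "integrable (M (fst p')) (\<lambda>\<omega>. ramp m u (X (fst p') t \<omega>))" for u
          by (rule integrable_bounded[OF t borel_measurable_continuous_onI[OF continuous_ramp] ramp_bounded(3)])
        have "\<bar>P t (ramp m (snd p)) (fst p') - P t (ramp m (snd p')) (fst p')\<bar>
            = \<bar>LINT \<omega>|M (fst p'). ramp m (snd p) (X (fst p') t \<omega>) - ramp m (snd p') (X (fst p') t \<omega>)\<bar>"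
          unfolding P_def by (simp add: Bochner_Integration.integral_diff[OF i i])
        also have "\<dots> \<le> (LINT \<omega>|M (fst p'). \<bar>ramp m (snd p) (X (fst p') t \<omega>) - ramp m (snd p') (X (fst p') t \<omega>)\<bar>)"
          by (rule integral_abs_bound)
        also have "\<dots> \<le> (LINT \<omega>|M (fst p'). real m * \<bar>snd p - snd p'\<bar>)"
        proof (rule integral_mono)
          show "\<bar>ramp m (snd p) z - ramp m (snd p') z\<bar> \<le> real m * \<bar>snd p - snd p'\<bar>" for z
            using ramp_Lipschitz[of m "snd p" z "snd p'" z] by simp
        qed (auto intro!: integrable_abs Bochner_Integration.integrable_diff i)
        finally show ?thesis using prob_space by simp
      qed
      have 3: "\<bar>fst p - fst p'\<bar> \<le> dist p p'" "\<bar>snd p - snd p'\<bar> \<le> dist p p'"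
        using dist_fst_le[of p p'] dist_snd_le[of p p'] by (auto simp: dist_real_def)
      have "(exp (2 * K * t) * real m) * \<bar>fst p - fst p'\<bar> \<le> (exp (2 * K * t) * real m) * dist p p'"
        using 3 by (intro mult_left_mono) auto
      moreover have "real m * \<bar>snd p - snd p'\<bar> \<le> real m * dist p p'" using 3 by (intro mult_left_mono) auto
      ultimately show "dist (P t (ramp m (snd p)) (fst p)) (P t (ramp m (snd p')) (fst p')) \<le> ?C * dist p p'"
        using 1 2 unfolding dist_real_def distrib_right by linarith
    qed simp
  qed
  from borel_measurable_diff[OF borel_measurable_const[of 1] m] show ?thesis by (simp add: borel_prod)
qed

section \<open>Exponential convergence\<close>

lemma cdf_gibbs:
  assumes t: "0 \<le> t"
  shows "cdf (gibbs_measure q) u = (LINT z|gibbs_measure q. cdf (law t z) u)"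
    and "integrable (gibbs_measure q) (\<lambda>z. cdf (law t z) u)"
proof -
  interpret G: real_distribution "gibbs_measure q" by (rule real_distribution_gibbs)
  have bd: "0 \<le> cdf (law t z) v" "cdf (law t z) v \<le> 1" for z v
  proof -
    interpret real_distribution "law t z" by (rule real_distribution_law[OF t])
    show "0 \<le> cdf (law t z) v" "cdf (law t z) v \<le> 1" by (rule cdf_nonneg, rule cdf_bounded_prob)
  qed
  have meas: "(\<lambda>z. cdf (law t z) u) \<in> borel_measurable (gibbs_measure q)"
    using measurable_cdf_law[OF t] by (simp cong: measurable_cong_sets add: measurable_cong_sets[OF sets_gibbs refl])
  show i: "integrable (gibbs_measure q) (\<lambda>z. cdf (law t z) u)"
    by (rule G.integrable_const_bound[where B = 1]) (use bd meas in auto)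
  have Pm: "P t (ramp m u) \<in> borel_measurable (gibbs_measure q)" for m
    using borel_measurable_mono[OF P_mono[OF t continuous_ramp ramp_mono ramp_bounded(3)]]
    by (simp add: measurable_cong_sets[OF sets_gibbs refl])
  have "(\<lambda>m. LINT z|gibbs_measure q. P t (ramp m u) z) \<longlonglongrightarrow> (LINT z|gibbs_measure q. 1 - cdf (law t z) u)"
  proof (rule integral_dominated_convergence[where w = "\<lambda>_. 1"])
    show "AE z in gibbs_measure q. norm (P t (ramp m u) z) \<le> 1" for m
      using P_bounded[OF t borel_measurable_continuous_onI[OF continuous_ramp] ramp_bounded(3)] by simp
  qed (use P_ramp_tendsto[OF t] Pm meas in auto)
  moreover have "(LINT z|gibbs_measure q. P t (ramp m u) z) = (LINT z|gibbs_measure q. ramp m u z)" for m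
    using ramp_Lipschitz[of m u _ u] by (intro gibbs_invariant[OF t _ continuous_ramp ramp_bounded(3)]) simp
  ultimately have "(LINT z|gibbs_measure q. 1 - cdf (law t z) u) = 1 - cdf (gibbs_measure q) u"
    using G.integral_ramp_tendsto[of u] by (auto intro: LIMSEQ_unique)
  then show "cdf (gibbs_measure q) u = (LINT z|gibbs_measure q. cdf (law t z) u)"
    using i G.prob_space by simp
qed

text \<open>
  In the second part the distribution function of \<open>\<pi>\<close> is written as an average over the starting
  point, and the contraction estimate is integrated against \<open>\<pi>\<close>, which has a finite first moment.
\<close>

theorem exponential_convergence:
  "\<exists>r>0.
      (\<forall>x y. \<exists>C>0. \<forall>t\<ge>0. wasserstein (law t x) (law t y) \<le> ennreal (C * exp (- r * t))) \<and>
      (\<forall>x. \<exists>C. \<forall>t\<ge>0. wasserstein (gibbs_measure q) (law t x) \<le> ennreal (C * exp (- r * t)))"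
proof -
  obtain b l where l: "0 < l" and b: "0 \<le> b"
    and contr: "\<And>x y t. 0 \<le> t \<Longrightarrow>
      cdf_distance (law t x) (law t y) \<le> ennreal (b * \<bar>x - y\<bar> * exp (- l * t))"
    using cdf_contraction by blast
  interpret G: real_distribution "gibbs_measure q" by (rule real_distribution_gibbs)
  interpret GL: pair_sigma_finite "gibbs_measure q" lborel ..
  have part1: "wasserstein (law t x) (law t y) \<le> ennreal ((b * \<bar>x - y\<bar> + 1) * exp (- l * t))" if t: "0 \<le> t" for t x y
  proof -
    have "wasserstein (law t x) (law t y) \<le> ennreal (b * \<bar>x - y\<bar> * exp (- l * t))"
      by (rule order.trans[OF wasserstein_le_cdf[OF real_distribution_law[OF t] real_distribution_law[OF t]] contr[OF t]])
    also have "\<dots> \<le> ennreal ((b * \<bar>x - y\<bar> + 1) * exp (- l * t))" by (intro ennreal_leI mult_right_mono) auto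
    finally show ?thesis .
  qed
  have part2: "wasserstein (gibbs_measure q) (law t x) \<le> ennreal ((LINT z|gibbs_measure q. b * \<bar>z - x\<bar>) * exp (- l * t))"
    if t: "0 \<le> t" for t x
  proof -
    have iz: "integrable (gibbs_measure q) (\<lambda>z. b * \<bar>z - x\<bar> * exp (- l * t))"
    proof -
      have "integrable (gibbs_measure q) (\<lambda>z. z)"
        using integrable_gibbs_abs by (subst integrable_abs_iff[symmetric]) auto
      then show ?thesis by (intro integrable_mult_left integrable_mult_right integrable_abs Bochner_Integration.integrable_diff) auto
    qed
    let ?d = "\<lambda>z u. ennreal \<bar>cdf (law t z) u - cdf (law t x) u\<bar>"
    have dm: "case_prod ?d \<in> borel_measurable (gibbs_measure q \<Otimes>\<^sub>M lborel)"
    proof -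
      have s: "sets (gibbs_measure q \<Otimes>\<^sub>M lborel) = sets (borel \<Otimes>\<^sub>M (borel :: real measure))"
        by (intro sets_pair_measure_cong sets_gibbs sets_lborel)
      have [measurable]: "cdf (law t x) \<in> borel_measurable borel"
        using measurable_compose[OF _ measurable_cdf_law_pair[OF t], of "\<lambda>u. (x, u)" borel] by simp
      note [measurable] = measurable_cdf_law_pair[OF t]
      have "(\<lambda>p. ?d (fst p) (snd p)) \<in> borel_measurable (borel \<Otimes>\<^sub>M borel)" by measurable
      then show ?thesis unfolding measurable_cong_sets[OF s refl] by (simp add: case_prod_beta')
    qed
    have "wasserstein (gibbs_measure q) (law t x) \<le> cdf_distance (gibbs_measure q) (law t x)"
      by (rule wasserstein_le_cdf[OF real_distribution_gibbs real_distribution_law[OF t]])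
    also have "\<dots> \<le> (\<integral>\<^sup>+u. \<integral>\<^sup>+z. ?d z u \<partial>gibbs_measure q \<partial>lborel)"
    proof (rule nn_integral_mono)
      fix u
      have i: "integrable (gibbs_measure q) (\<lambda>z. cdf (law t z) u - cdf (law t x) u)" using cdf_gibbs(2)[OF t] by simp
      have "cdf (gibbs_measure q) u - cdf (law t x) u = (LINT z|gibbs_measure q. cdf (law t z) u - cdf (law t x) u)"
        using cdf_gibbs[OF t, of u] G.prob_space by simp
      then have "\<bar>cdf (gibbs_measure q) u - cdf (law t x) u\<bar> \<le> (LINT z|gibbs_measure q. \<bar>cdf (law t z) u - cdf (law t x) u\<bar>)"
        using integral_abs_bound by metis
      then have "ennreal \<bar>cdf (gibbs_measure q) u - cdf (law t x) u\<bar> \<le> ennreal (LINT z|gibbs_measure q. \<bar>cdf (law t z) u - cdf (law t x) u\<bar>)"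
        by (rule ennreal_leI)
      also have "\<dots> = (\<integral>\<^sup>+z. ?d z u \<partial>gibbs_measure q)"
        using i by (intro nn_integral_eq_integral[symmetric] integrable_abs) auto
      finally show "ennreal \<bar>cdf (gibbs_measure q) u - cdf (law t x) u\<bar> \<le> (\<integral>\<^sup>+z. ?d z u \<partial>gibbs_measure q)" .
    qed
    also have "\<dots> = (\<integral>\<^sup>+z. \<integral>\<^sup>+u. ?d z u \<partial>lborel \<partial>gibbs_measure q)"
      by (rule GL.Fubini'[OF dm])
    also have "\<dots> \<le> (\<integral>\<^sup>+z. ennreal (b * \<bar>z - x\<bar> * exp (- l * t)) \<partial>gibbs_measure q)"
      by (intro nn_integral_mono contr[OF t])
    also have "\<dots> = ennreal (LINT z|gibbs_measure q. b * \<bar>z - x\<bar> * exp (- l * t))"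
      using b by (intro nn_integral_eq_integral iz) auto
    finally show ?thesis by simp
  qed
  show ?thesis
  proof (rule exI[of _ l], intro conjI allI)
    show "\<exists>C>0. \<forall>t\<ge>0. wasserstein (law t x) (law t y) \<le> ennreal (C * exp (- l * t))" for x y
      by (rule exI[of _ "b * \<bar>x - y\<bar> + 1"]) (use part1 b in \<open>auto intro: add_nonneg_pos\<close>)
    show "\<exists>C. \<forall>t\<ge>0. wasserstein (gibbs_measure q) (law t x) \<le> ennreal (C * exp (- l * t))" for x
      by (rule exI[of _ "LINT z|gibbs_measure q. b * \<bar>z - x\<bar>"]) (use part2 in auto)
  qed (rule l)
qed

end

theorem theorem4p3:
  fixes q :: "real \<Rightarrow> real"
    and M :: "real \<Rightarrow> 'a measure"
    and F :: "real \<Rightarrow> real \<Rightarrow> 'a measure"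
    and B X :: "real \<Rightarrow> real \<Rightarrow> 'a \<Rightarrow> real"
    and P :: "real \<Rightarrow> real \<Rightarrow> real measure"
  assumes "smooth q"
    and "\<And>x. langevin_solution (M x) (F x) (B x) q x (X x)"
    and "\<And>x t. 0 \<le> t \<Longrightarrow> P t x = distr (M x) borel (X x t)"
    and "filterlim (deriv (deriv q)) at_top at_infinity"
  shows "\<exists>r>0.
      (\<forall>x y. \<exists>C>0. \<forall>t\<ge>0. wasserstein (P t x) (P t y) \<le> ennreal (C * exp (- r * t))) \<and>
      (\<forall>x. \<exists>C. \<forall>t\<ge>0. wasserstein (gibbs_measure q) (P t x) \<le> ennreal (C * exp (- r * t)))"
proof -
  interpret langevin_family q M F B X
    by (intro langevin_family.intro langevin_family_axioms.intro confining_potential.intro assms)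
  have law: "P t x = law t x" if "0 \<le> t" for t x
    using assms(3)[OF that] by (simp add: law_def)
  from exponential_convergence show ?thesis by (simp add: law cong: imp_cong)
qed

end
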